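(* Let $T>0$, $M>0$, $\alpha>0$. Then there exists a continuous, concave and increasing function $G_T:[0,\infty)\to[0,\infty)$ with $G_T(\zeta)\to 0$ as $\zeta\to 0$ (depending only on $T,M,\alpha,\kappa,\phi$) such that the following holds. Let $f_0,g_0$ be probability densities on $\mathbb{R}^{2d}$ with $f_0,g_0\in L^1\cap L^\infty$, $f_0,g_0\ge 0$, satisfying $$\max\left\{\int_{\mathbb R^{2d}}\bigl(|x|^2+e^{\alpha |v|}\bigr) f_0(z)\,dz,\ \int_{\mathbb R^{2d}}\bigl(|x|^2+e^{\alpha |v|}\bigr) g_0(z)\,dz \right\}\le M,$$ and let $\mu$ and $\nu$ be two measure-valued solutions on $[0,T]$ to the kinetic Cucker--Smale equation with initial data $d\mu_0=f_0\,dz$ and $d\nu_0=g_0\,dz$, having densities $f,g\in \mathcal{C}([0,T);L^1(\mathbb{R}^{2d}))\cap L^\infty_+([0,T)\times\mathbb{R}^{2d})$ respectively, i.e. $d\mu_t=f(t,z)\,dz$ and $d\nu_t=g(t,z)\,dz$. Then $$\sup_{0\le t\le T}W_1(\mu_t,\nu_t)\le G_T\bigl(W_1(\mu_0,\nu_0)\bigr).$$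
   Context: Notation: $z=(x,v)\in\mathbb{R}^d\times\mathbb{R}^d$, $dz=dx\,dv$; $|\cdot|$ is the Euclidean norm; $L^\infty_+$ denotes nonnegative $L^\infty$ functions; $W_1$ is the 1-Wasserstein distance on probability measures on $\mathbb{R}^{2d}$ with finite first moment. Fix $\kappa>0$ and a communication weight $\phi\in W^{1,\infty}([0,\infty))$ with $0\le\phi(r)\le\|\phi\|_{L^\infty}$ for all $r\ge0$. The kinetic Cucker--Smale (KCS) equation is $$\partial_t f+\nabla_x\cdot(vf)+\nabla_v\cdot(L[f]f)=0,\qquad L[f](t,x,v)=-\kappa\int_{\mathbb{R}^{2d}}\phi(|x-x_*|)(v-v_* )f(t,x_*,v_* )\,dx_*dv_*.$$ For a family of measures $\mu_t$, $L[\mu_t](x,v)=-\kappa\int\phi(|x-x_*|)(v-v_* )\,d\mu_t(x_*,v_* )$. A measure-valued solution $\mu=(\mu_t)$ on a time interval starting at $0$ is an $L^\infty$-in-time family of probability measures on $\mathbb{R}^{2d}$ such that $t\mapsto\int\varphi\,d\mu_t$ is continuous for all compactly supported $C^1$ functions $\varphi$, and for all compactly supported $C^1$ test functions $\psi(t,x,v)$, $$\int\psi(t,\cdot)\,d\mu_t-\int\psi(0,\cdot)\,d\mu_0=\int_0^t\int\bigl(\partial_s\psi+v\cdot\nabla_x\psi+L[\mu_s]\cdot\nabla_v\psi\bigr)\,d\mu_s\,ds .$$ Standing framework for solutions with densities: $|z|^2f(t)\in L^1(\mathbb{R}^{2d})$ for each time $t$, and the solution is transported by its characteristic flow, i.e.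 $\mu_t=(\Phi^t)_\#\mu_0$, where $\Phi^t(z)=(X(t),V(t))$ solves $\dot X=V$, $\dot V=L[f](t,X,V)$, $(X,V)(0)=z$ (and likewise for $g$). *)

theory Defs
  imports "HOL-Probability.Probability"
begin

definition Linfty :: "'a measure \<Rightarrow> ('a \<Rightarrow> real) \<Rightarrow> bool" where
  "Linfty M f \<longleftrightarrow> f \<in> borel_measurable M \<and> (\<exists>C. AE x in M. \<bar>f x\<bar> \<le> C)"

definition Linfty_norm :: "'a measure \<Rightarrow> ('a \<Rightarrow> real) \<Rightarrow> ereal" where
  "Linfty_norm M f = esssup M (\<lambda>x. ereal \<bar>f x\<bar>)"

text \<open>Functions are identified with Borel representatives, so that \<open>f t\<close> is defined for every \<open>t\<close>.\<close>

definition continuous_L1 :: "real set \<Rightarrow> (real \<Rightarrow> 'a::euclidean_space \<Rightarrow> real) \<Rightarrow> bool" where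
  "continuous_L1 I f \<longleftrightarrow>
     (\<forall>t\<in>I. integrable lborel (f t)) \<and>
     (\<forall>t\<in>I. ((\<lambda>s. LINT z|lborel. \<bar>f s z - f t z\<bar>) \<longlongrightarrow> 0) (at t within I))"

definition Linfty_nonneg :: "real set \<Rightarrow> (real \<Rightarrow> 'a::euclidean_space \<Rightarrow> real) \<Rightarrow> bool" where
  "Linfty_nonneg I f \<longleftrightarrow>
     (let M = restrict_space lborel (I \<times> UNIV) in
       Linfty M (\<lambda>(t, z). f t z) \<and> (AE (t, z) in M. 0 \<le> f t z))"

definition C1_compact_support :: "('a::euclidean_space \<Rightarrow> real) \<Rightarrow> bool" where
  "C1_compact_support f \<longleftrightarrow>
     (\<exists>f'. (\<forall>x. (f has_derivative blinfun_apply (f' x)) (at x)) \<and> continuous_on UNIV f') \<and>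
     compact (closure {x. f x \<noteq> 0})"

text \<open>
  The Sobolev space \<open>W\<close> with exponents \<open>(1, \<infinity>)\<close> on the half-line: bounded, with a bounded weak
  derivative.  As usual, a class is identified with its continuous representative, which is what
  gives the values at individual points a meaning.  The values of \<open>\<phi>\<close> at negative
  arguments play no role.
\<close>

definition W1infty_halfline :: "(real \<Rightarrow> real) \<Rightarrow> bool" where
  "W1infty_halfline \<phi> \<longleftrightarrow>
     continuous_on {0..} \<phi> \<and>
     Linfty (restrict_space lborel {0..}) \<phi> \<and>
     (\<exists>\<phi>'. Linfty (restrict_space lborel {0..}) \<phi>' \<and>
       (\<forall>\<eta>. C1_compact_support \<eta> \<and> closure {r. \<eta> r \<noteq> 0} \<subseteq> {0<..} \<longrightarrow>
         (LINT r:{0..}|lborel. \<phi> r * deriv \<eta> r) = - (LINT r:{0..}|lborel. \<phi>' r * \<eta> r)))"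

definition couplings :: "'a measure \<Rightarrow> 'b measure \<Rightarrow> ('a \<times> 'b) measure set" where
  "couplings \<mu> \<nu> =
     {\<gamma>. sets \<gamma> = sets (\<mu> \<Otimes>\<^sub>M \<nu>) \<and> distr \<gamma> \<mu> fst = \<mu> \<and> distr \<gamma> \<nu> snd = \<nu>}"

text \<open>
  On \<open>'a = 'b \<times> 'b\<close> with \<open>'b\<close> Euclidean, \<open>dist\<close> is the Euclidean distance of the product.
\<close>

definition W1 :: "'a::metric_space measure \<Rightarrow> 'a measure \<Rightarrow> ennreal" where
  "W1 \<mu> \<nu> = (INF \<gamma>\<in>couplings \<mu> \<nu>. \<integral>\<^sup>+ (z, w). ennreal (dist z w) \<partial>\<gamma>)"

definition alignment_kernel ::
    "(real \<Rightarrow> real) \<Rightarrow> 'a::euclidean_space \<Rightarrow> 'a \<Rightarrow> 'a \<times> 'a \<Rightarrow> 'a" where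
  "alignment_kernel \<phi> x v = (\<lambda>(x', v'). \<phi> (norm (x - x')) *\<^sub>R (v - v'))"

definition alignment ::
    "real \<Rightarrow> (real \<Rightarrow> real) \<Rightarrow> ('a::euclidean_space \<times> 'a) measure \<Rightarrow> 'a \<Rightarrow> 'a \<Rightarrow> 'a" where
  "alignment \<kappa> \<phi> \<mu> x v = - \<kappa> *\<^sub>R (LINT z'|\<mu>. alignment_kernel \<phi> x v z')"

definition grad :: "('a::euclidean_space \<Rightarrow> real) \<Rightarrow> 'a \<Rightarrow> 'a" where
  "grad F x = (\<Sum>b\<in>Basis. frechet_derivative F (at x) b *\<^sub>R b)"

definition kcs_operator ::
    "real \<Rightarrow> (real \<Rightarrow> real) \<Rightarrow> ('a::euclidean_space \<times> 'a) measure \<Rightarrow>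
      (real \<times> 'a \<times> 'a \<Rightarrow> real) \<Rightarrow> real \<Rightarrow> 'a \<times> 'a \<Rightarrow> real" where
  "kcs_operator \<kappa> \<phi> \<mu> \<psi> s = (\<lambda>(x, v).
     deriv (\<lambda>s. \<psi> (s, x, v)) s
     + v \<bullet> grad (\<lambda>x. \<psi> (s, x, v)) x
     + alignment \<kappa> \<phi> \<mu> x v \<bullet> grad (\<lambda>v. \<psi> (s, x, v)) v)"

text \<open>
  Measurability into \<^const>\<open>prob_algebra\<close> expresses that the measures form a measurable family of
  probability measures; boundedness in time is automatic, as the total mass is \<open>1\<close>.
  The integrability clauses state that the integrals in the weak formulation exist (Bochner
  integrals of non-integrable functions are \<open>0\<close> by convention).
\<close>

definition measure_valued_solution ::
    "real \<Rightarrow> (real \<Rightarrow> real) \<Rightarrow> real \<Rightarrow> (real \<Rightarrow> ('a::euclidean_space \<times> 'a) measure) \<Rightarrow> bool" where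
  "measure_valued_solution \<kappa> \<phi> T \<mu> \<longleftrightarrow>
     \<mu> \<in> restrict_space borel {0..T} \<rightarrow>\<^sub>M prob_algebra borel \<and>
     (\<forall>\<eta>. C1_compact_support \<eta> \<longrightarrow> continuous_on {0..T} (\<lambda>t. LINT z|\<mu> t. \<eta> z)) \<and>
     (AE s in restrict_space lborel {0..T}.
        \<forall>x v. integrable (\<mu> s) (alignment_kernel \<phi> x v)) \<and>
     (\<forall>\<psi>. C1_compact_support \<psi> \<longrightarrow>
        (AE s in restrict_space lborel {0..T}. integrable (\<mu> s) (kcs_operator \<kappa> \<phi> (\<mu> s) \<psi> s)) \<and>
        set_integrable lborel {0..T} (\<lambda>s. LINT z|\<mu> s. kcs_operator \<kappa> \<phi> (\<mu> s) \<psi> s z) \<and>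
        (\<forall>t\<in>{0..T}.
          (LINT z|\<mu> t. \<psi> (t, z)) - (LINT z|\<mu> 0. \<psi> (0, z)) =
          (LINT s:{0..t}|lborel. LINT z|\<mu> s. kcs_operator \<kappa> \<phi> (\<mu> s) \<psi> s z)))"

definition transported_by_characteristics ::
    "real \<Rightarrow> (real \<Rightarrow> real) \<Rightarrow> real set \<Rightarrow> (real \<Rightarrow> ('a::euclidean_space \<times> 'a) measure) \<Rightarrow> bool" where
  "transported_by_characteristics \<kappa> \<phi> I \<mu> \<longleftrightarrow>
     (\<exists>X V.
       (\<forall>z. (X 0 z, V 0 z) = z) \<and>
       (\<forall>z. \<forall>t\<in>I.
          ((\<lambda>s. X s z) has_vector_derivative V t z) (at t within I) \<and>
          ((\<lambda>s. V s z) has_vector_derivative alignment \<kappa> \<phi> (\<mu> t) (X t z) (V t z)) (at t within I)) \<and>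
       (\<forall>t\<in>I. (\<lambda>z. (X t z, V t z)) \<in> borel \<rightarrow>\<^sub>M borel \<and>
          \<mu> t = distr (\<mu> 0) borel (\<lambda>z. (X t z, V t z))))"

definition has_density_in_framework ::
    "real \<Rightarrow> (real \<Rightarrow> real) \<Rightarrow> real \<Rightarrow> (real \<Rightarrow> ('a::euclidean_space \<times> 'a) measure) \<Rightarrow>
      (real \<Rightarrow> 'a \<times> 'a \<Rightarrow> real) \<Rightarrow> bool" where
  "has_density_in_framework \<kappa> \<phi> T \<mu> f \<longleftrightarrow>
     continuous_L1 {0..<T} f \<and> Linfty_nonneg {0..<T} f \<and>
     (\<forall>t\<in>{0..<T}. \<mu> t = density lborel (\<lambda>z. ennreal (f t z))) \<and>
     (\<forall>t\<in>{0..<T}. integrable lborel (\<lambda>z. (norm z)\<^sup>2 * f t z)) \<and>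
     transported_by_characteristics \<kappa> \<phi> {0..<T} \<mu>"

definition bounded_probability_density :: "('a::euclidean_space \<Rightarrow> real) \<Rightarrow> bool" where
  "bounded_probability_density f \<longleftrightarrow>
     integrable lborel f \<and> Linfty lborel f \<and> (AE z in lborel. 0 \<le> f z) \<and>
     (LINT z|lborel. f z) = 1"

definition initial_moment :: "real \<Rightarrow> ('a::euclidean_space \<times> 'a \<Rightarrow> real) \<Rightarrow> ennreal" where
  "initial_moment \<alpha> f = (\<integral>\<^sup>+ (x, v). ennreal (((norm x)\<^sup>2 + exp (\<alpha> * norm v)) * f (x, v)) \<partial>lborel)"

end

theory Submission
  imports Defs
begin

text \<open>
  Couple the initial data by some \<open>\<gamma>\<close> and move both components of a pair along their own characteristic
  flows \<open>\<Phi>\<close> and \<open>\<Psi>\<close>. The transported coupling has the cost \<open>Q t = \<integral> \<bar>\<Phi> t z - \<Psi> t w\<bar> d\<gamma>\<close>, which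
  dominates the distance of the two solutions at time \<open>t\<close>; so it suffices to bound \<open>Q\<close> in terms of
  \<open>Q 0\<close> and to optimise over \<open>\<gamma>\<close> at the end.

  The communication weight is Lipschitz, hence the alignment force is Lipschitz in the velocity, but in
  the position only with a constant that is proportional to the speed. Since speeds stay below a multiple of
  \<open>\<lambda> = 1 + \<bar>v\<bar>\<close>, where \<open>v\<close> is the velocity component of \<open>w\<close>, the gap \<open>D\<close> of a pair satisfies
  \<open>\<bar>D'\<bar> \<le> A \<lambda> (D + S)\<close> as long as \<open>\<integral> \<lambda> D d\<gamma> \<le> S\<close> (\<open>gap_growth\<close>). The rate is unbounded, so Gronwall
  costs a factor \<open>exp (A \<lambda> (t - s))\<close>; for short times this factor is integrable because of the exponential
  velocity moment, and the contribution of \<open>S\<close> is small enough to be absorbed. This leaves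
  \<open>\<integral> \<lambda> D t d\<gamma> \<le> 2 \<integral> \<lambda> exp (\<theta> \<lambda>) D s d\<gamma>\<close>, and interpolation with the fourth moment of the weight and the
  second moment of \<open>D\<close> yields \<open>Q t \<le> C sqrt (Q s)\<close> whenever \<open>t - s\<close> is at most a fixed step length
  (\<open>cost_step\<close>). The modulus is the iterate of \<open>\<zeta> \<mapsto> C sqrt \<zeta>\<close> over the finitely many steps that cover
  \<open>[0, T]\<close>: a Hoelder modulus whose exponent halves in each step.

  Three points need separate arguments.

  \<^item> The first moment of the solution is known to be finite at each time, but the force field can only be
    controlled if it is locally bounded in time. It is lower semicontinuous by Fatou's lemma, and on a
    short interval on which it is bounded its values differ by a factor of at most \<open>3\<close>. By Baire's
    theorem a function with these two properties is bounded (\<open>bounded_of_local_comparability\<close>).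

  \<^item> The flow lives on \<open>[0, T)\<close>, while the estimate includes time \<open>T\<close>. Trajectories are Lipschitz in time,
    so the flow has a limit at \<open>T\<close>; it transports the initial measure to the solution at \<open>T\<close> since
    the two measures agree on compactly supported continuously differentiable functions, and these determine
    a probability measure (\<open>prob_measure_eqI_C1_compact_support\<close>).

  \<^item> The Lipschitz bound for the communication weight is extracted from its bounded weak derivative by
    testing with the difference of two smoothed steps (\<open>W1infty_halfline_lipschitz\<close>).
\<close>

section \<open>Gronwall estimates and local boundedness\<close>

lemma norm_components_le:
  fixes z :: "'a::real_normed_vector \<times> 'b::real_normed_vector"
  shows "norm (fst z) \<le> norm z" "norm (snd z) \<le> norm z"
  by (metis norm_fst_le norm_snd_le prod.collapse)+

text \<open>
  The norm is not differentiable at the origin; adding \<open>e\<close> under the root makes the chain rule available,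
  and \<open>e\<close> is sent to \<open>0\<close> afterwards.
\<close>

lemma has_real_derivative_regularized_norm:
  fixes U :: "real \<Rightarrow> 'a::real_inner"
  assumes dU: "(U has_derivative (\<lambda>x. x *\<^sub>R U')) (at t)" and e: "0 < e"
  shows "((\<lambda>t. sqrt (U t \<bullet> U t + e)) has_real_derivative
    (U t \<bullet> U') / sqrt (U t \<bullet> U t + e)) (at t)"
proof -
  have pos: "U t \<bullet> U t + e > 0"
      using e by (simp add: add_nonneg_pos)
  have "((\<lambda>t. U t \<bullet> U t + e) has_derivative (\<lambda>x. x * (2 * (U t \<bullet> U')))) (at t)"
    using has_derivative_add[OF has_derivative_inner[OF dU dU] has_derivative_const[of e]]
    by (simp add: inner_commute[of U'] mult.left_commute)
  then have dsq: "((\<lambda>t. U t \<bullet> U t + e) has_real_derivative 2 * (U t \<bullet> U')) (at t)"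
    by (simp only: has_field_derivative_def mult_commute_abs)
  have "((\<lambda>t. sqrt (U t \<bullet> U t + e)) has_real_derivative inverse (sqrt (U t \<bullet> U t + e)) / 2 * (2 * (U t \<bullet> U'))) (at t)"
    by (rule DERIV_chain'[OF dsq DERIV_real_sqrt[OF pos]])
  moreover have "inverse (sqrt (U t \<bullet> U t + e)) / 2 * (2 * (U t \<bullet> U')) = (U t \<bullet> U') / sqrt (U t \<bullet> U t + e)"
    by (simp add: inverse_eq_divide)
  ultimately show ?thesis by (simp only:)
qed

text \<open>
  The derivative is only assumed to exist pointwise, so there is no integral inequality to start from.
  Instead, the regularised norm plus \<open>S\<close>, multiplied by the integrating factor \<open>exp (- c t)\<close>, has a
  nonpositive derivative.
\<close>

lemma norm_gronwall:
  fixes U :: "real \<Rightarrow> 'a::real_inner"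
  assumes "a \<le> b" and cont: "continuous_on {a..b} U"
    and deriv: "\<And>t. a < t \<Longrightarrow> t < b \<Longrightarrow> (U has_vector_derivative U' t) (at t)"
    and bound: "\<And>t. a < t \<Longrightarrow> t < b \<Longrightarrow> norm (U' t) \<le> c * (norm (U t) + S)"
    and "c \<ge> 0" "S \<ge> 0"
  shows "norm (U b) + S \<le> (norm (U a) + S) * exp (c * (b - a))"
proof -
  have reg: "norm (U b) + S \<le> (sqrt (norm (U a) ^ 2 + e) + S) * exp (c * (b - a))" if "e > 0" for e
  proof -
    define g where "g = (\<lambda>t. sqrt (U t \<bullet> U t + e))"
    have pos: "U t \<bullet> U t + e > 0" for t
      using that by (simp add: add_nonneg_pos)
    have gpos: "g t > 0" for t
      unfolding g_def using pos by simp
    have g_ge: "norm (U t) \<le> g t" for t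
      unfolding g_def norm_eq_sqrt_inner using that by (intro real_sqrt_le_mono) simp
    define h where "h t = (g t + S) * exp (- c * (t - a))" for t
    have "h b \<le> h a"
    proof (rule DERIV_nonpos_imp_decreasing_open[OF \<open>a \<le> b\<close>])
      fix t assume t: "a < t" "t < b"
      have dg: "(g has_real_derivative (U t \<bullet> U' t) / g t) (at t)"
        using has_real_derivative_regularized_norm[OF _ that] deriv[OF t]
        unfolding has_vector_derivative_def g_def by blast
      have "U t \<bullet> U' t \<le> norm (U t) * norm (U' t)"
        by (rule norm_cauchy_schwarz)
      also have "\<dots> \<le> g t * (c * (g t + S))"
      proof (rule mult_mono)
        show "norm (U' t) \<le> c * (g t + S)"
          by (rule order_trans[OF bound[OF t]]) (simp add: mult_left_mono g_ge \<open>c \<ge> 0\<close>)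
      qed (use g_ge gpos[of t] in auto)
      finally have le: "(U t \<bullet> U' t) / g t \<le> c * (g t + S)"
        using gpos[of t] by (simp add: field_simps)
      have "(h has_real_derivative
             ((U t \<bullet> U' t) / g t - c * (g t + S)) * exp (- c * (t - a))) (at t)"
        unfolding h_def by (rule derivative_eq_intros dg refl | simp add: algebra_simps)+
      moreover have "((U t \<bullet> U' t) / g t - c * (g t + S)) * exp (- c * (t - a)) \<le> 0"
        using le by (intro mult_nonpos_nonneg) auto
      ultimately show "\<exists>y. (h has_real_derivative y) (at t) \<and> y \<le> 0" by blast
    next
      show "continuous_on {a..b} h"
        unfolding h_def g_def by (intro continuous_intros cont)
    qed
    then have "(g b + S) * exp (- c * (b - a)) \<le> g a + S" by (simp add: h_def)
    then have "(g b + S) * exp (- c * (b - a)) * exp (c * (b - a)) \<le> (g a + S) * exp (c * (b - a))"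
      by (rule mult_right_mono) simp
    then have "g b + S \<le> (g a + S) * exp (c * (b - a))"
      by (simp add: mult.assoc flip: exp_add)
    then show ?thesis
      using g_ge[of b] by (simp add: g_def power2_norm_eq_inner)
  qed
  have "((\<lambda>e. (sqrt (norm (U a) ^ 2 + e) + S) * exp (c * (b - a)))
      \<longlongrightarrow> (sqrt (norm (U a) ^ 2 + 0) + S) * exp (c * (b - a))) (at_right 0)"
    by (intro tendsto_intros)
  moreover have "\<forall>\<^sub>F e in at_right 0. norm (U b) + S
      \<le> (sqrt (norm (U a) ^ 2 + e) + S) * exp (c * (b - a))"
    using reg by (auto simp: eventually_at_right_less eventually_at_filter)
  ultimately have "norm (U b) + S \<le> (sqrt (norm (U a) ^ 2 + 0) + S) * exp (c * (b - a))"
    by (intro tendsto_lowerbound) auto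
  then show ?thesis by simp
qed

text \<open>
  Boundedness makes the supremum \<open>S\<close> of \<open>g\<close> a finite number, and then \<open>S \<le> B + S / 2\<close> can be solved for \<open>S\<close>.
  This replaces Gronwall's inequality for functions of time that are not known to be measurable or continuous.
\<close>

lemma bounded_absorption:
  fixes g :: "'i \<Rightarrow> real"
  assumes "bdd_above (g ` J)"
    and step: "\<And>S i. (\<And>j. j \<in> J \<Longrightarrow> g j \<le> S) \<Longrightarrow> i \<in> J \<Longrightarrow> g i \<le> B + S / 2"
    and "i \<in> J"
  shows "g i \<le> 2 * B"
proof -
  define S where "S = (SUP j\<in>J. g j)"
  have le: "g j \<le> S" if "j \<in> J" for j
    unfolding S_def using that assms(1) by (rule cSUP_upper)
  have "S \<le> B + S / 2"
    unfolding S_def using \<open>i \<in> J\<close> step[OF le] by (intro cSUP_least) (auto simp: S_def)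
  with le[OF \<open>i \<in> J\<close>] show ?thesis by linarith
qed

lemma bdd_above_of_locally_bounded:
  fixes m :: "real \<Rightarrow> real"
  assumes loc: "\<And>t. t \<in> {a..b} \<Longrightarrow> \<exists>e>0. bdd_above (m ` ({a..b} \<inter> ball t e))"
  shows "bdd_above (m ` {a..b})"
proof -
  obtain e where e: "\<And>t. t \<in> {a..b} \<Longrightarrow> e t > 0 \<and> bdd_above (m ` ({a..b} \<inter> ball t (e t)))"
    using loc by metis
  have "{a..b} \<subseteq> (\<Union>t\<in>{a..b}. ball t (e t))" using e by force
  then obtain F where F: "F \<subseteq> {a..b}" "finite F" "{a..b} \<subseteq> (\<Union>t\<in>F. ball t (e t))"
    using compactE_image[OF compact_Icc[of a b], of "{a..b}" "\<lambda>t. ball t (e t)"] by (metis open_ball)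
  have "bdd_above (\<Union>t\<in>F. m ` ({a..b} \<inter> ball t (e t)))"
    using F e by (subst bdd_above_UN) auto
  moreover have "m ` {a..b} \<subseteq> (\<Union>t\<in>F. m ` ({a..b} \<inter> ball t (e t)))" using F(3) by blast
  ultimately show ?thesis by (rule bdd_above_mono)
qed

text \<open>
  Let \<open>C\<close> be the closed set of times near which \<open>m\<close> is unbounded. If \<open>C\<close> were nonempty, Baire's theorem
  would provide a neighbourhood on which \<open>m \<le> N\<close> along \<open>C\<close>. A time \<open>t\<close> of this neighbourhood outside \<open>C\<close>
  is separated from \<open>C\<close> by an interval that reaches a nearest point \<open>d \<in> C\<close> and has no other point in \<open>C\<close>;
  on it \<open>m\<close> is locally bounded, so comparability carries the bound at \<open>d\<close> over to \<open>t\<close>. Hence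
  \<open>m\<close> would be bounded near a point of \<open>C\<close>. Comparability has to work in both directions of time,
  as \<open>d\<close> may lie on either side of \<open>t\<close>.
\<close>

lemma bounded_of_local_comparability:
  fixes m :: "real \<Rightarrow> real"
  assumes closed: "\<And>N. closed {t \<in> {a..b}. m t \<le> N}"
    and "\<delta> > 0"
    and nonneg: "\<And>t. t \<in> {a..b} \<Longrightarrow> 0 \<le> m t"
    and comparable: "\<And>s t p q. a \<le> s \<Longrightarrow> s \<le> t \<Longrightarrow> t \<le> b \<Longrightarrow> t - s \<le> \<delta> \<Longrightarrow>
       bdd_above (m ` {s..t}) \<Longrightarrow> p \<in> {s..t} \<Longrightarrow> q \<in> {s..t} \<Longrightarrow> m p \<le> 3 * m q"
  shows "bdd_above (m ` {a..b})"
proof -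
  define C where "C = {t \<in> {a..b}. \<forall>e>0. \<not> bdd_above (m ` ({a..b} \<inter> ball t e))}"
  have C_sub: "C \<subseteq> {a..b}" by (auto simp: C_def)
  have "closed C"
    unfolding closed_sequential_limits
  proof (intro allI impI; elim conjE)
    fix x l assume x: "\<forall>n. x n \<in> C" and lim: "x \<longlonglongrightarrow> l"
    have "l \<in> {a..b}"
      using closed_sequentially[OF closed_atLeastAtMost[of a b] _ lim] x C_sub by blast
    moreover have "\<not> bdd_above (m ` ({a..b} \<inter> ball l e))" if "e > 0" for e
    proof
      assume bdd: "bdd_above (m ` ({a..b} \<inter> ball l e))"
      obtain n where n: "dist (x n) l < e / 2"
        using metric_LIMSEQ_D[OF lim, of "e / 2"] \<open>e > 0\<close> by (meson half_gt_zero order_refl)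
      have "ball (x n) (e / 2) \<subseteq> ball l e"
        using n by (smt (verit) dist_commute dist_triangle field_sum_of_halves mem_ball subsetI)
      then have "bdd_above (m ` ({a..b} \<inter> ball (x n) (e / 2)))"
        by (intro bdd_above_mono[OF bdd]) blast
      then show False using x \<open>e > 0\<close> unfolding C_def by (metis (lifting) half_gt_zero mem_Collect_eq)
    qed
    ultimately show "l \<in> C" by (simp add: C_def)
  qed
  have "C = {}"
  proof (rule ccontr)
    assume "C \<noteq> {}"
    define \<G> where "\<G> = range (\<lambda>N::nat. C - {t \<in> {a..b}. m t \<le> real N})"
    have "\<Inter>\<G> = {}"
      using C_sub real_arch_simple by (fastforce simp: \<G>_def)
    have "\<not> (\<forall>G\<in>\<G>. C \<subseteq> closure G)"
    proof
      assume "\<forall>G\<in>\<G>. C \<subseteq> closure G"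
      moreover have "openin (top_of_set C) G" if "G \<in> \<G>" for G
        using that closed by (auto simp: \<G>_def Diff_eq openin_open_Int)
      ultimately have "C \<subseteq> closure (\<Inter>\<G>)"
        using \<open>closed C\<close> by (intro Baire) (auto simp: \<G>_def)
      with \<open>\<Inter>\<G> = {}\<close> \<open>C \<noteq> {}\<close> show False by simp
    qed
    then obtain N :: nat and c where "c \<in> C" "c \<notin> closure (C - {t \<in> {a..b}. m t \<le> real N})"
      by (auto simp: \<G>_def)
    then obtain e0 where "e0 > 0" and e0: "\<And>y. y \<in> C \<Longrightarrow> dist y c < e0 \<Longrightarrow> m y \<le> real N"
      unfolding closure_approachable using C_sub by auto
    define e where "e = min e0 (\<delta> / 2)"
    have "e > 0" using \<open>e0 > 0\<close> \<open>\<delta> > 0\<close> by (simp add: e_def)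
    have "m t \<le> 3 * real N" if t: "t \<in> {a..b}" "dist t c < e" for t
    proof (cases "t \<in> C")
      case True
      then have "m t \<le> real N" using e0 t by (simp add: e_def)
      then show ?thesis by simp
    next
      case False
      have "t \<noteq> c" using False \<open>c \<in> C\<close> by blast
      define I where "I = {min c t..max c t}"
      have cI: "compact (C \<inter> I)" unfolding I_def
        by (intro closed_Int_compact \<open>closed C\<close> compact_Icc)
      have cne: "C \<inter> I \<noteq> {}" using \<open>c \<in> C\<close> by (auto simp: I_def)
      obtain d where d: "d \<in> C \<inter> I" and dmin: "\<And>y. y \<in> C \<inter> I \<Longrightarrow> dist t d \<le> dist t y"
        using distance_attains_inf[of "C \<inter> I" t] compact_imp_closed[OF cI] cne by blast
      have "d \<noteq> t" using False d by blast
      have dab: "d \<in> {a..b}" using d C_sub by blast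
      have noC: "y \<notin> C" if "y \<in> {min d t..max d t}" "y \<noteq> d" for y
      proof
        assume "y \<in> C"
        have "y \<in> I" using that(1) d by (auto simp: I_def)
        then have "dist t d \<le> dist t y" using dmin \<open>y \<in> C\<close> by blast
        then show False using that by (auto simp: dist_real_def min_def max_def split: if_splits)
      qed
      have len: "\<bar>t - d\<bar> \<le> \<delta>" "dist d c < e0"
        using d t \<open>\<delta> > 0\<close> by (auto simp: I_def dist_real_def e_def min_def max_def split: if_splits)
      have loc: "bdd_above (m ` {p..q})" if pq: "{p..q} \<subseteq> {min d t..max d t} - {d}" for p q
      proof (rule bdd_above_of_locally_bounded)
        fix y assume y: "y \<in> {p..q}"
        have hull: "{min d t..max d t} \<subseteq> {a..b}" using dab t by auto
        have "y \<in> {min d t..max d t}" "y \<noteq> d" using y pq by blast+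
        then have "y \<notin> C" "y \<in> {a..b}" using noC hull by blast+
        then obtain r where "r > 0" "bdd_above (m ` ({a..b} \<inter> ball y r))" unfolding C_def by auto
        moreover have "{p..q} \<inter> ball y r \<subseteq> {a..b} \<inter> ball y r" using pq hull by blast
        ultimately show "\<exists>r>0. bdd_above (m ` ({p..q} \<inter> ball y r))"
          by (meson bdd_above_mono image_mono)
      qed
      have mt: "m y \<le> 3 * m t" if "y \<in> {min d t..max d t}" "y \<noteq> d" for y
      proof -
        have sub: "{min y t..max y t} \<subseteq> {min d t..max d t} - {d}"
          using that \<open>d \<noteq> t\<close> by (auto simp: min_def max_def split: if_splits)
        show ?thesis
        proof (rule comparable[of "min y t" "max y t"])
          show "bdd_above (m ` {min y t..max y t})" by (rule loc[OF sub])
        qed (use that t dab len in \<open>auto simp: min_def max_def split: if_splits\<close>)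
      qed
      (* The comparison up to the endpoint d requires boundedness on the closed interval, which follows
         because the values away from d are controlled by the value at t. *)
      have "m y \<le> max (m d) (3 * m t)" if "y \<in> {min d t..max d t}" for y
        using mt[OF that] by (cases "y = d") (auto simp: le_max_iff_disj)
      then have "bdd_above (m ` {min d t..max d t})"
        by (intro bdd_aboveI2)
      then have "m t \<le> 3 * m d"
        using t dab len
        by (intro comparable[of "min d t" "max d t"]) (auto simp: min_def max_def split: if_splits)
      moreover have "m d \<le> real N" using e0 d len by blast
      ultimately show ?thesis by simp
    qed
    then have "bdd_above (m ` ({a..b} \<inter> ball c e))"
      by (intro bdd_aboveI[of _ "3 * real N"]) (auto simp: dist_commute)
    then show False using \<open>c \<in> C\<close> \<open>e > 0\<close> by (auto simp: C_def)
  qed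
  then show ?thesis
    by (intro bdd_above_of_locally_bounded) (auto simp: C_def)
qed

section \<open>The communication weight is Lipschitz\<close>

lemma has_real_derivative_pos_part_sq:
  "((\<lambda>x::real. (max 0 x)\<^sup>2) has_real_derivative 2 * max 0 x) (at x)"
proof -
  consider "x > 0" | "x < 0" | "x = 0" by linarith
  then show ?thesis
  proof cases
    case 1
    have "((\<lambda>x::real. x\<^sup>2) has_real_derivative 2 * max 0 x) (at x)"
      using 1 by (auto intro!: derivative_eq_intros)
    then show ?thesis
      by (rule has_field_derivative_transform_within_open[where S = "{0<..}"]) (use 1 in auto)
  next
    case 2
    have "((\<lambda>x::real. 0) has_real_derivative 2 * max 0 x) (at x)"
      using 2 by (auto intro!: derivative_eq_intros)
    then show ?thesis
      by (rule has_field_derivative_transform_within_open[where S = "{..<0}"]) (use 2 in auto)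
  next
    case 3
    have "((\<lambda>y::real. max 0 y) \<longlongrightarrow> max 0 0) (at 0)"
      by (intro tendsto_intros)
    moreover have "\<forall>\<^sub>F y in at 0. max 0 y = ((max 0 y)\<^sup>2 - (max 0 0)\<^sup>2) / (y - (0::real))"
      by (auto simp: eventually_at_filter power2_eq_square max_def)
    ultimately have "((\<lambda>y::real. ((max 0 y)\<^sup>2 - (max 0 0)\<^sup>2) / (y - 0)) \<longlongrightarrow> max 0 0) (at 0)"
      by (rule Lim_transform_eventually)
    then show ?thesis using 3 by (simp add: has_field_derivative_iff)
  qed
qed

lemma C1_compact_supportI:
  fixes f :: "'a::euclidean_space \<Rightarrow> real"
  assumes "\<And>x. (f has_derivative blinfun_apply (f' x)) (at x)" "continuous_on UNIV f'"
    and "bounded {x. f x \<noteq> 0}"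
  shows "C1_compact_support f"
  unfolding C1_compact_support_def using assms by auto

lemma C1_compact_support_realI:
  fixes f :: "real \<Rightarrow> real"
  assumes f: "\<And>x. (f has_real_derivative f' x) (at x)" and cont: "continuous_on UNIV f'"
    and "{x. f x \<noteq> 0} \<subseteq> {a..b}"
  shows "C1_compact_support f"
proof (rule C1_compact_supportI)
  show "(f has_derivative blinfun_apply (blinfun_mult_right (f' x))) (at x)" for x
    using f[of x] by (simp only: has_field_derivative_def blinfun_mult_right.rep_eq)
  show "continuous_on UNIV (\<lambda>x. blinfun_mult_right (f' x))"
    by (rule bounded_linear.continuous_on[OF bounded_linear_blinfun_mult_right cont])
  show "bounded {x. f x \<noteq> 0}"
    using assms(3) bounded_closed_interval bounded_subset by blast
qed

text \<open>
  A probability density supported in \<open>[a, a + 2 h]\<close>; averages against it converge to point values at \<open>a\<close>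
  as \<open>h\<close> tends to \<open>0\<close>.
\<close>

definition tent :: "real \<Rightarrow> real \<Rightarrow> real \<Rightarrow> real" where
  "tent h a r = (max 0 (r - a) - 2 * max 0 (r - a - h) + max 0 (r - a - 2 * h)) / h\<^sup>2"

text \<open>
  The distribution function of \<^term>\<open>tent h a\<close>. Written with squares of positive parts, its continuous
  differentiability needs no case distinction at the break points.
\<close>

definition ramp :: "real \<Rightarrow> real \<Rightarrow> real \<Rightarrow> real" where
  "ramp h a r =
     ((max 0 (r - a))\<^sup>2 - 2 * (max 0 (r - a - h))\<^sup>2 + (max 0 (r - a - 2 * h))\<^sup>2) / (2 * h\<^sup>2)"

lemma has_real_derivative_ramp:
  assumes "h > 0" shows "(ramp h a has_real_derivative tent h a r) (at r)"
proof -
  have shift: "((\<lambda>r. (max 0 (r - c))\<^sup>2) has_real_derivative 2 * max 0 (r - c)) (at r)" for c :: real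
  proof -
    have "((\<lambda>r. r - c) has_real_derivative 1) (at r)"
      by (auto intro!: derivative_eq_intros)
    then have "((\<lambda>r. (max 0 (r - c))\<^sup>2) has_real_derivative 2 * max 0 (r - c) * 1) (at r)"
      by (rule DERIV_chain'[where g = "\<lambda>x. (max 0 x)\<^sup>2" and f = "\<lambda>r. r - c"])
        (rule has_real_derivative_pos_part_sq)
    then show ?thesis by simp
  qed
  have "((\<lambda>r. ((max 0 (r - a))\<^sup>2 - 2 * (max 0 (r - (a + h)))\<^sup>2 + (max 0 (r - (a + 2 * h)))\<^sup>2) / (2 * h\<^sup>2))
      has_real_derivative (2 * max 0 (r - a) - 2 * (2 * max 0 (r - (a + h))) + 2 * max 0 (r - (a + 2 * h))) / (2 * h\<^sup>2)) (at r)"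
    by (intro DERIV_cdivide DERIV_add DERIV_diff DERIV_cmult shift)
  moreover have "(\<lambda>r. ((max 0 (r - a))\<^sup>2 - 2 * (max 0 (r - (a + h)))\<^sup>2 + (max 0 (r - (a + 2 * h)))\<^sup>2) / (2 * h\<^sup>2)) = ramp h a"
    by (rule ext) (simp add: ramp_def diff_diff_eq)
  moreover have "(2 * max 0 (r - a) - 2 * (2 * max 0 (r - (a + h))) + 2 * max 0 (r - (a + 2 * h))) / (2 * h\<^sup>2) = tent h a r"
    using assms unfolding tent_def diff_diff_eq by (simp add: field_simps)
  ultimately show ?thesis by simp
qed

lemma tent_nonneg: "h > 0 \<Longrightarrow> 0 \<le> tent h a r"
  unfolding tent_def by (intro divide_nonneg_nonneg) (auto simp: max_def)

lemma tent_eq_0: "h > 0 \<Longrightarrow> r \<notin> {a..a + 2 * h} \<Longrightarrow> tent h a r = 0"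
  unfolding tent_def by (auto simp: max_def)

lemma continuous_on_tent: "h > 0 \<Longrightarrow> continuous_on A (tent h a)"
  unfolding tent_def by (intro continuous_intros) auto

lemma ramp_left: "h > 0 \<Longrightarrow> r \<le> a \<Longrightarrow> ramp h a r = 0"
  unfolding ramp_def by (simp add: max_def)

lemma ramp_right:
  assumes "h > 0" "r \<ge> a + 2 * h" shows "ramp h a r = 1"
proof -
  have "(max 0 (r - a))\<^sup>2 - 2 * (max 0 (r - a - h))\<^sup>2 + (max 0 (r - a - 2 * h))\<^sup>2
      = (r - a)\<^sup>2 - 2 * (r - a - h)\<^sup>2 + (r - a - 2 * h)\<^sup>2"
    using assms by (simp add: max_def)
  also have "\<dots> = 2 * h\<^sup>2" by (simp add: power2_eq_square algebra_simps)
  finally show ?thesis using assms by (simp add: ramp_def)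
qed

lemma ramp_mono: assumes "h > 0" "r \<le> s" shows "ramp h a r \<le> ramp h a s"
  using assms(2) by (rule DERIV_nonneg_imp_nondecreasing)
    (blast intro: has_real_derivative_ramp tent_nonneg assms(1))

lemma ramp_range: assumes "h > 0" shows "ramp h a r \<in> {0..1}"
proof -
  have "ramp h a (min r a) \<le> ramp h a r" "ramp h a r \<le> ramp h a (max r (a + 2 * h))"
    by (intro ramp_mono assms; simp)+
  then show ?thesis using assms by (simp add: ramp_left ramp_right)
qed

lemma tent_average:
  fixes \<phi> :: "real \<Rightarrow> real"
  assumes "0 \<le> a" "h > 0" and cont: "continuous_on {0..} \<phi>"
    and close: "\<And>r. r \<in> {a..a + 2 * h} \<Longrightarrow> \<bar>\<phi> r - c\<bar> \<le> e"
  shows "set_integrable lborel {0..} (\<lambda>r. \<phi> r * tent h a r)"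
    and "\<bar>(LINT r:{0..}|lborel. \<phi> r * tent h a r) - c\<bar> \<le> e"
proof -
  let ?I = "{a..a + 2 * h}"
  have restrict: "indicator {0..} r *\<^sub>R (\<psi> r * tent h a r) = indicator ?I r *\<^sub>R (\<psi> r * tent h a r)"
    for \<psi> :: "real \<Rightarrow> real" and r
    using tent_eq_0[OF \<open>h > 0\<close>, of r a] \<open>0 \<le> a\<close> by (cases "r \<in> ?I") (auto simp: indicator_def)
  have int: "set_integrable lborel ?I (\<lambda>r. \<psi> r * tent h a r)"
    if "continuous_on {0..} \<psi>" for \<psi> :: "real \<Rightarrow> real"
    using \<open>0 \<le> a\<close> \<open>h > 0\<close>
    by (intro borel_integrable_atLeastAtMost' continuous_intros continuous_on_tent
        continuous_on_subset[OF that]) auto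
  show "set_integrable lborel {0..} (\<lambda>r. \<phi> r * tent h a r)"
    using int[OF cont] unfolding set_integrable_def restrict .
  have I_tent: "set_integrable lborel ?I (tent h a)"
    by (intro borel_integrable_atLeastAtMost' continuous_on_tent \<open>h > 0\<close>)
  have mass: "(LINT r:?I|lborel. tent h a r) = 1"
  proof -
    have "(\<integral>r. tent h a r * indicator ?I r \<partial>lborel) = ramp h a (a + 2 * h) - ramp h a a"
      using \<open>h > 0\<close> continuous_on_tent[OF \<open>h > 0\<close>, of UNIV a]
      by (intro integral_FTC_Icc_real has_real_derivative_ramp)
        (auto simp: continuous_on_eq_continuous_at)
    then show ?thesis
      using \<open>h > 0\<close> by (simp add: set_lebesgue_integral_def mult.commute ramp_left ramp_right)
  qed
  have "(LINT r:{0..}|lborel. \<phi> r * tent h a r) = (LINT r:?I|lborel. \<phi> r * tent h a r)"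
    unfolding set_lebesgue_integral_def restrict ..
  then have "(LINT r:{0..}|lborel. \<phi> r * tent h a r) - c
      = (LINT r:?I|lborel. \<phi> r * tent h a r) - (LINT r:?I|lborel. c * tent h a r)"
    using mass by simp
  also have "\<dots> = (LINT r:?I|lborel. \<phi> r * tent h a r - c * tent h a r)"
    by (rule set_integral_diff(2)[symmetric]) (use int[OF cont] I_tent in auto)
  also have "\<bar>\<dots>\<bar> \<le> (LINT r:?I|lborel. \<bar>\<phi> r * tent h a r - c * tent h a r\<bar>)"
    unfolding set_lebesgue_integral_def
    by (rule order_trans[OF integral_abs_bound]) (simp add: abs_mult)
  also have "\<dots> \<le> (LINT r:?I|lborel. e * tent h a r)"
  proof (rule set_integral_mono)
    show "set_integrable lborel ?I (\<lambda>r. \<bar>\<phi> r * tent h a r - c * tent h a r\<bar>)"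
      by (intro set_integrable_abs set_integral_diff(1)) (use int[OF cont] I_tent in auto)
    show "set_integrable lborel ?I (\<lambda>r. e * tent h a r)" using I_tent by auto
    show "\<bar>\<phi> r * tent h a r - c * tent h a r\<bar> \<le> e * tent h a r" if "r \<in> ?I" for r
      using close[OF that] tent_nonneg[OF \<open>h > 0\<close>, of a r]
      by (simp add: abs_mult mult_right_mono flip: left_diff_distrib)
  qed
  also have "\<dots> = e" using mass by simp
  finally show "\<bar>(LINT r:{0..}|lborel. \<phi> r * tent h a r) - c\<bar> \<le> e" .
qed

text \<open>
  Test the weak derivative with \<open>\<eta> = ramp h (a + h) - ramp h (b + h)\<close>. On one side, \<open>\<eta>'\<close> is a difference
  of two averaging kernels, so the integral is close to \<open>\<phi> a - \<phi> b\<close>; on the other side, \<open>0 \<le> \<bar>\<eta>\<bar> \<le> 1\<close> with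
  support in an interval of length \<open>b - a + 2 h\<close>.
\<close>

lemma W1infty_halfline_lipschitz:
  assumes "W1infty_halfline \<phi>"
  obtains L where "L \<ge> 0" "\<And>r s. 0 \<le> r \<Longrightarrow> 0 \<le> s \<Longrightarrow> \<bar>\<phi> r - \<phi> s\<bar> \<le> L * \<bar>r - s\<bar>"
proof -
  have cont: "continuous_on {0..} \<phi>" using assms by (simp add: W1infty_halfline_def)
  obtain \<phi>' where \<phi>'_Linfty: "Linfty (restrict_space lborel {0..}) \<phi>'"
    and weak: "\<And>\<eta>. C1_compact_support \<eta> \<Longrightarrow> closure {r. \<eta> r \<noteq> 0} \<subseteq> {0<..} \<Longrightarrow>
         (LINT r:{0..}|lborel. \<phi> r * deriv \<eta> r) = - (LINT r:{0..}|lborel. \<phi>' r * \<eta> r)"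
    using assms unfolding W1infty_halfline_def by blast
  obtain C where "AE r in restrict_space lborel {0..}. \<bar>\<phi>' r\<bar> \<le> C"
    using \<phi>'_Linfty unfolding Linfty_def by blast
  then have C: "AE r in lborel. r \<in> {0..} \<longrightarrow> \<bar>\<phi>' r\<bar> \<le> C"
    by (subst (asm) AE_restrict_space_iff) auto
  define L where "L = max 0 C"
  have "L \<ge> 0" by (simp add: L_def)
  have upper: "\<bar>\<phi> a - \<phi> b\<bar> \<le> L * (b - a)" if "0 \<le> a" "a < b" for a b
  proof (rule field_le_epsilon)
    fix e :: real assume "e > 0"
    define e' where "e' = e / (3 * L + 3)"
    have "e' > 0" using \<open>e > 0\<close> \<open>L \<ge> 0\<close> by (simp add: e'_def)
    obtain d where "d > 0"
      and d: "\<And>r. 0 \<le> r \<Longrightarrow> dist r a < d \<Longrightarrow> \<bar>\<phi> r - \<phi> a\<bar> \<le> e'"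
             "\<And>r. 0 \<le> r \<Longrightarrow> dist r b < d \<Longrightarrow> \<bar>\<phi> r - \<phi> b\<bar> \<le> e'"
    proof -
      have "\<exists>d>0. \<forall>r\<in>{0..}. dist r c < d \<longrightarrow> dist (\<phi> r) (\<phi> c) < e'" if "0 \<le> c" for c
        using cont[unfolded continuous_on_iff] \<open>e' > 0\<close> that by simp
      from this[of a] this[of b] obtain d1 d2
        where "d1 > 0" "\<forall>r\<in>{0..}. dist r a < d1 \<longrightarrow> dist (\<phi> r) (\<phi> a) < e'"
          and "d2 > 0" "\<forall>r\<in>{0..}. dist r b < d2 \<longrightarrow> dist (\<phi> r) (\<phi> b) < e'"
        using \<open>0 \<le> a\<close> \<open>a < b\<close> by auto
      then show ?thesis
        by (intro that[of "min d1 d2"]) (auto simp: dist_real_def intro: less_imp_le)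
    qed
    define h where "h = min e' (d / 4)"
    have h: "h > 0" "h \<le> e'" "3 * h < d" using \<open>e' > 0\<close> \<open>d > 0\<close> by (auto simp: h_def)
    (* The shift by h keeps the support away from 0 even if a = 0. *)
    define \<eta> where "\<eta> r = ramp h (a + h) r - ramp h (b + h) r" for r
    have d\<eta>: "(\<eta> has_real_derivative tent h (a + h) r - tent h (b + h) r) (at r)" for r
      unfolding \<eta>_def by (intro DERIV_diff has_real_derivative_ramp h(1))
    have supp: "{r. \<eta> r \<noteq> 0} \<subseteq> {a + h..b + 3 * h}"
    proof
      fix r assume "r \<in> {r. \<eta> r \<noteq> 0}"
      then have "\<eta> r \<noteq> 0" by simp
      then have "\<not> r \<le> a + h" "\<not> r \<ge> b + h + 2 * h"
        using ramp_left[OF h(1), of r "a + h"] ramp_left[OF h(1), of r "b + h"]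
          ramp_right[OF h(1), of "a + h" r] ramp_right[OF h(1), of "b + h" r] \<open>a < b\<close>
        by (auto simp: \<eta>_def)
      then show "r \<in> {a + h..b + 3 * h}" by auto
    qed
    have "C1_compact_support \<eta>"
      by (rule C1_compact_support_realI[OF d\<eta> _ supp])
        (intro continuous_intros continuous_on_tent h(1))
    moreover have "closure {r. \<eta> r \<noteq> 0} \<subseteq> {0<..}"
    proof -
      have "closure {r. \<eta> r \<noteq> 0} \<subseteq> {a + h..b + 3 * h}"
        by (rule closure_minimal[OF supp]) simp
      then show ?thesis using \<open>0 \<le> a\<close> h(1) by auto
    qed
    ultimately have "(LINT r:{0..}|lborel. \<phi> r * deriv \<eta> r) = - (LINT r:{0..}|lborel. \<phi>' r * \<eta> r)"
      by (rule weak)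
    moreover have "deriv \<eta> r = tent h (a + h) r - tent h (b + h) r" for r
      using d\<eta> by (rule DERIV_imp_deriv)
    ultimately have eq: "(LINT r:{0..}|lborel. \<phi> r * tent h (a + h) r - \<phi> r * tent h (b + h) r)
        = - (LINT r:{0..}|lborel. \<phi>' r * \<eta> r)"
      by (simp add: right_diff_distrib)
    have ca: "\<bar>\<phi> r - \<phi> a\<bar> \<le> e'" if "r \<in> {a + h..a + h + 2 * h}" for r
      using that h \<open>0 \<le> a\<close> by (intro d(1)) (auto simp: dist_real_def)
    have cb: "\<bar>\<phi> r - \<phi> b\<bar> \<le> e'" if "r \<in> {b + h..b + h + 2 * h}" for r
      using that h \<open>0 \<le> a\<close> \<open>a < b\<close> by (intro d(2)) (auto simp: dist_real_def)
    note A = tent_average[OF _ h(1) cont ca] note B = tent_average[OF _ h(1) cont cb]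
    have "(LINT r:{0..}|lborel. \<phi> r * tent h (a + h) r - \<phi> r * tent h (b + h) r)
        = (LINT r:{0..}|lborel. \<phi> r * tent h (a + h) r) - (LINT r:{0..}|lborel. \<phi> r * tent h (b + h) r)"
      by (rule set_integral_diff(2)) (use A(1) B(1) \<open>0 \<le> a\<close> \<open>a < b\<close> h(1) in auto)
    moreover have "\<bar>LINT r:{0..}|lborel. \<phi>' r * \<eta> r\<bar> \<le> L * (b - a + 2 * h)"
    proof -
      have bd: "\<bar>\<eta> r\<bar> \<le> indicator {a + h..b + 3 * h} r" for r
        using ramp_range[OF h(1), of "a + h" r] ramp_range[OF h(1), of "b + h" r] supp
        by (cases "r \<in> {a + h..b + 3 * h}") (auto simp: \<eta>_def)
      have "\<bar>LINT r:{0..}|lborel. \<phi>' r * \<eta> r\<bar> \<le> (LINT r|lborel. \<bar>indicator {0..} r *\<^sub>R (\<phi>' r * \<eta> r)\<bar>)"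
        unfolding set_lebesgue_integral_def by (rule integral_abs_bound)
      also have "\<dots> \<le> (LINT r|lborel. L * indicator {a + h..b + 3 * h} r)"
      proof (rule integral_mono_AE')
        show "integrable lborel (\<lambda>r. L * indicator {a + h..b + 3 * h} r)"
          by (intro integrable_mult_right integrable_real_indicator) (auto simp: emeasure_lborel_Icc_eq)
        show "AE r in lborel. \<bar>indicator {0..} r *\<^sub>R (\<phi>' r * \<eta> r)\<bar> \<le> L * indicator {a + h..b + 3 * h} r"
          using C
        proof eventually_elim
          case (elim r)
          have "\<bar>\<phi>' r\<bar> * \<bar>\<eta> r\<bar> \<le> L * indicator {a + h..b + 3 * h} r" if "r \<ge> 0"
            using elim that bd[of r] \<open>L \<ge> 0\<close> by (intro mult_mono) (auto simp: L_def)
          then show ?case using \<open>L \<ge> 0\<close> by (auto simp: indicator_def abs_mult split: if_splits)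
        qed
        show "AE r in lborel. 0 \<le> L * indicator {a + h..b + 3 * h} r" using \<open>L \<ge> 0\<close> by auto
      qed
      also have "\<dots> = L * (b - a + 2 * h)" using \<open>a < b\<close> h(1) by simp
      finally show ?thesis .
    qed
    moreover have near: "\<bar>(LINT r:{0..}|lborel. \<phi> r * tent h (a + h) r) - \<phi> a\<bar> \<le> e'"
      "\<bar>(LINT r:{0..}|lborel. \<phi> r * tent h (b + h) r) - \<phi> b\<bar> \<le> e'"
      using A(2) B(2) \<open>0 \<le> a\<close> \<open>a < b\<close> h(1) by auto
    ultimately have "\<bar>\<phi> a - \<phi> b\<bar> \<le> L * (b - a + 2 * h) + 2 * e'"
      using eq near unfolding abs_le_iff by linarith
    also have "\<dots> \<le> L * (b - a + 2 * e') + 2 * e'"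
      using h \<open>L \<ge> 0\<close> by (intro add_mono mult_left_mono) auto
    also have "\<dots> \<le> L * (b - a) + e' * (3 * L + 3)"
      using \<open>L \<ge> 0\<close> \<open>e' > 0\<close> by (simp add: algebra_simps)
    also have "e' * (3 * L + 3) = e" using \<open>L \<ge> 0\<close> by (simp add: e'_def)
    finally show "\<bar>\<phi> a - \<phi> b\<bar> \<le> L * (b - a) + e" .
  qed
  show ?thesis
  proof (rule that[OF \<open>L \<ge> 0\<close>])
    fix r s :: real assume rs: "0 \<le> r" "0 \<le> s"
    consider "r < s" | "s < r" | "r = s" by linarith
    then show "\<bar>\<phi> r - \<phi> s\<bar> \<le> L * \<bar>r - s\<bar>"
    proof cases
      case 1 then show ?thesis using upper[of r s] rs by simp
    next
      case 2 then show ?thesis using upper[of s r] rs by (simp add: abs_minus_commute)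
    qed simp
  qed
qed

lemma W1infty_halfline_bounded:
  assumes "W1infty_halfline \<phi>"
    and "\<And>r. 0 \<le> r \<Longrightarrow> 0 \<le> \<phi> r \<and> ereal (\<phi> r) \<le> Linfty_norm (restrict_space lborel {0..}) \<phi>"
  obtains K where "K \<ge> 0" "\<And>r. 0 \<le> r \<Longrightarrow> \<phi> r \<in> {0..K}"
proof -
  let ?M = "restrict_space lborel {0::real..}"
  have "Linfty ?M \<phi>" using assms(1) by (simp add: W1infty_halfline_def)
  then obtain C where meas: "\<phi> \<in> borel_measurable ?M" and C: "AE x in ?M. \<bar>\<phi> x\<bar> \<le> C"
    unfolding Linfty_def by blast
  have "Linfty_norm ?M \<phi> \<le> ereal C"
    unfolding Linfty_norm_def
  proof (rule esssup_I)
    show "(\<lambda>x. ereal \<bar>\<phi> x\<bar>) \<in> borel_measurable ?M" using meas by measurable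
  qed (use C in auto)
  then have "\<phi> r \<le> C" if "0 \<le> r" for r
    using assms(2)[OF that] by (metis ereal_less_eq(3) order_trans)
  moreover have "C \<ge> 0" using assms(2)[of 0] calculation[of 0] by simp
  ultimately show ?thesis using assms(2) that[of C] by auto
qed

section \<open>Probability measures are determined by smooth test functions\<close>

lemma C1_compact_support_imp_continuous:
  assumes "C1_compact_support f" shows "continuous_on UNIV f"
  using assms unfolding C1_compact_support_def
  by (metis UNIV_I continuous_at_imp_continuous_on has_derivative_continuous)

lemma C1_compact_support_mult:
  assumes "C1_compact_support f" "C1_compact_support g"
  shows "C1_compact_support (\<lambda>x. f x * g x)"
proof -
  obtain f' where f': "\<And>x. (f has_derivative blinfun_apply (f' x)) (at x)" "continuous_on UNIV f'"
    and supp: "bounded {x. f x \<noteq> 0}"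
    using assms(1) unfolding C1_compact_support_def by auto
  obtain g' where g': "\<And>x. (g has_derivative blinfun_apply (g' x)) (at x)" "continuous_on UNIV g'"
    using assms(2) unfolding C1_compact_support_def by auto
  show ?thesis
  proof (rule C1_compact_supportI)
    show "((\<lambda>x. f x * g x) has_derivative blinfun_apply (f x *\<^sub>R g' x + g x *\<^sub>R f' x)) (at x)" for x
      by (rule has_derivative_eq_rhs[OF has_derivative_mult[OF f'(1) g'(1)]])
        (simp add: fun_eq_iff blinfun.add_left blinfun.scaleR_left mult.commute)
    show "continuous_on UNIV (\<lambda>x. f x *\<^sub>R g' x + g x *\<^sub>R f' x)"
      by (intro continuous_intros f'(2) g'(2) C1_compact_support_imp_continuous assms)
    show "bounded {x. f x * g x \<noteq> 0}"
      by (rule bounded_subset[OF supp]) auto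
  qed
qed

lemma C1_compact_support_compose:
  assumes "C1_compact_support f"
    and h: "\<And>r. (h has_real_derivative h' r) (at r)" "continuous_on UNIV h'" and "h 0 = 0"
  shows "C1_compact_support (\<lambda>x. h (f x))"
proof -
  obtain f' where f': "\<And>x. (f has_derivative blinfun_apply (f' x)) (at x)" "continuous_on UNIV f'"
    and supp: "bounded {x. f x \<noteq> 0}"
    using assms(1) unfolding C1_compact_support_def by auto
  show ?thesis
  proof (rule C1_compact_supportI)
    show "((\<lambda>x. h (f x)) has_derivative blinfun_apply (h' (f x) *\<^sub>R f' x)) (at x)" for x
      by (rule has_derivative_eq_rhs[OF
            has_derivative_compose[OF f'(1) h(1)[unfolded has_field_derivative_def]]])
        (simp add: fun_eq_iff blinfun.scaleR_left)
    show "continuous_on UNIV (\<lambda>x. h' (f x) *\<^sub>R f' x)"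
      by (intro continuous_intros f'(2) continuous_on_compose2[OF h(2)]
          C1_compact_support_imp_continuous assms(1)) auto
    show "bounded {x. h (f x) \<noteq> 0}"
      by (rule bounded_subset[OF supp]) (use \<open>h 0 = 0\<close> in auto)
  qed
qed

lemma C1_compact_support_bump:
  fixes c :: "'a::euclidean_space"
  shows "C1_compact_support (\<lambda>x. (max 0 (r\<^sup>2 - (norm (x - c))\<^sup>2))\<^sup>2)"
proof (rule C1_compact_supportI)
  let ?q = "\<lambda>x. r\<^sup>2 - (norm (x - c))\<^sup>2"
  let ?q' = "\<lambda>x. (- 2) *\<^sub>R blinfun_inner_left (x - c)"
  have q': "(?q has_derivative blinfun_apply (?q' x)) (at x)" for x
    unfolding power2_norm_eq_inner
    by (auto intro!: derivative_eq_intros simp: fun_eq_iff blinfun.minus_left blinfun.scaleR_left inner_commute)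
  show "((\<lambda>x. (max 0 (?q x))\<^sup>2) has_derivative blinfun_apply ((2 * max 0 (?q x)) *\<^sub>R ?q' x)) (at x)" for x
    by (rule has_derivative_eq_rhs[OF
          has_derivative_compose[OF q' has_real_derivative_pos_part_sq[unfolded has_field_derivative_def]]])
      (simp add: fun_eq_iff blinfun.minus_left blinfun.scaleR_left)
  show "continuous_on UNIV (\<lambda>x. (2 * max 0 (?q x)) *\<^sub>R ?q' x)"
    by (intro continuous_intros bounded_linear.continuous_on[OF bounded_linear_blinfun_inner_left])
  show "bounded {x. (max 0 (?q x))\<^sup>2 \<noteq> 0}"
  proof (rule bounded_subset[OF bounded_cball[of c "\<bar>r\<bar>"]])
    show "{x. (max 0 (?q x))\<^sup>2 \<noteq> 0} \<subseteq> cball c \<bar>r\<bar>"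
    proof
      fix x assume "x \<in> {x. (max 0 (?q x))\<^sup>2 \<noteq> 0}"
      then have "(norm (x - c))\<^sup>2 \<le> r\<^sup>2" by (auto simp: max_def split: if_splits)
      then have "norm (x - c) \<le> \<bar>r\<bar>" by (metis abs_le_square_iff abs_norm_cancel)
      then show "x \<in> cball c \<bar>r\<bar>" by (simp add: dist_norm norm_minus_commute)
    qed
  qed
qed

text \<open>
  The positivity sets of test functions with values in \<open>[0, 1]\<close> are closed under intersection (multiply the
  functions) and contain all balls, so they generate the Borel sets. The measure of \<open>{u > 0}\<close> is the limit of
  the integrals of \<open>1 - (1 - u)^n\<close>, which are again test functions.
\<close>

lemma prob_measure_eqI_C1_compact_support:
  fixes M N :: "'a::euclidean_space measure"
  assumes M: "prob_space M" "sets M = sets borel" and N: "prob_space N" "sets N = sets borel"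
    and eq: "\<And>\<eta>. C1_compact_support \<eta> \<Longrightarrow> (LINT x|M. \<eta> x) = (LINT x|N. \<eta> x)"
  shows "M = N"
proof -
  define E where "E = {{x. u x > 0} | u :: 'a \<Rightarrow> real. C1_compact_support u \<and> (\<forall>x. 0 \<le> u x \<and> u x \<le> 1)}"
  have E_open: "open X" if "X \<in> E" for X
    using that C1_compact_support_imp_continuous
    by (auto simp: E_def intro!: open_Collect_less)
  have ball_E: "ball c r \<in> E" if "r > 0" for c r
  proof -
    let ?b = "\<lambda>x. (max 0 (r\<^sup>2 - (norm (x - c))\<^sup>2))\<^sup>2"
    let ?u = "\<lambda>x. inverse ((r\<^sup>2)\<^sup>2) * ?b x"
    have "C1_compact_support ?u"
      by (rule C1_compact_support_compose[OF C1_compact_support_bump,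
            where h = "\<lambda>s. inverse ((r\<^sup>2)\<^sup>2) * s" and h' = "\<lambda>_. inverse ((r\<^sup>2)\<^sup>2)"])
        (auto intro!: derivative_eq_intros)
    moreover have "0 \<le> ?u x" "?u x \<le> 1" for x
    proof -
      have "?b x \<le> (r\<^sup>2)\<^sup>2" by (intro power_mono) auto
      then show "?u x \<le> 1" using that by (simp add: field_simps)
    qed auto
    moreover have "ball c r = {x. ?u x > 0}"
    proof -
      have "x \<in> ball c r \<longleftrightarrow> (norm (x - c))\<^sup>2 < r\<^sup>2" for x
        using that power2_less_imp_less[of "norm (x - c)" r] power_strict_mono[of "norm (x - c)" r 2]
        by (auto simp: dist_norm norm_minus_commute)
      moreover have "(norm (x - c))\<^sup>2 < r\<^sup>2 \<longleftrightarrow> 0 < ?u x" for x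
      proof -
        define m where "m = max 0 (r\<^sup>2 - (norm (x - c))\<^sup>2)"
        have "0 < inverse ((r\<^sup>2)\<^sup>2) * m\<^sup>2 \<longleftrightarrow> m \<noteq> 0"
          using that by (simp add: zero_less_mult_iff)
        moreover have "m \<noteq> 0 \<longleftrightarrow> (norm (x - c))\<^sup>2 < r\<^sup>2" by (auto simp: m_def max_def)
        ultimately show ?thesis by (simp add: m_def)
      qed
      ultimately show ?thesis by blast
    qed
    ultimately show ?thesis unfolding E_def by (intro CollectI exI[of _ ?u] conjI allI)
  qed
  have "Int_stable E"
  proof (rule Int_stableI)
    fix A B assume "A \<in> E" "B \<in> E"
    then obtain u v where uv: "A = {x. u x > 0}" "C1_compact_support u" "\<And>x. 0 \<le> u x \<and> u x \<le> 1"
      "B = {x. v x > 0}" "C1_compact_support v" "\<And>x. 0 \<le> v x \<and> v x \<le> 1"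
      unfolding E_def by auto
    have "A \<inter> B = {x. u x * v x > 0}"
    proof -
      have "0 < u x * v x \<longleftrightarrow> 0 < u x \<and> 0 < v x" for x
        using uv(3)[of x] uv(6)[of x] by (auto simp: zero_less_mult_iff)
      then show ?thesis by (auto simp: uv(1,4))
    qed
    moreover have "0 \<le> u x * v x \<and> u x * v x \<le> 1" for x
      using uv(3,6) by (simp add: mult_le_one)
    ultimately show "A \<inter> B \<in> E"
      unfolding E_def using C1_compact_support_mult[OF uv(2,5)]
      by (intro CollectI exI[of _ "\<lambda>x. u x * v x"] conjI allI) auto
  qed
  have meas_lim: "(\<lambda>n. LINT x|P. 1 - (1 - u x) ^ n) \<longlonglongrightarrow> measure P {x. u x > 0}"
    if P: "prob_space P" "sets P = sets borel"
      and u: "C1_compact_support u" "\<And>x. 0 \<le> u x \<and> u x \<le> 1" for P :: "'a measure" and u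
  proof -
    interpret prob_space P by (rule P)
    have mu[measurable]: "u \<in> borel_measurable P"
      using C1_compact_support_imp_continuous[OF u(1)] P(2)
      by (simp add: borel_measurable_continuous_onI cong: measurable_cong_sets)
    have "(\<lambda>n. LINT x|P. 1 - (1 - u x) ^ n) \<longlonglongrightarrow> (LINT x|P. indicator {x. u x > 0} x)"
    proof (rule integral_dominated_convergence[where w = "\<lambda>_. 1"])
      show "AE x in P. (\<lambda>n. 1 - (1 - u x) ^ n) \<longlonglongrightarrow> indicator {x. u x > 0} x"
      proof (rule AE_I2)
        fix x
        show "(\<lambda>n. 1 - (1 - u x) ^ n) \<longlonglongrightarrow> indicator {x. u x > 0} x"
        proof (cases "u x > 0")
          case True
          then have "(\<lambda>n. 1 - (1 - u x) ^ n) \<longlonglongrightarrow> 1 - 0"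
            using u(2)[of x] by (intro tendsto_diff tendsto_const LIMSEQ_power_zero) auto
          then show ?thesis using True by simp
        next
          case False
          then have "u x = 0" using u(2)[of x] by auto
          then show ?thesis by simp
        qed
      qed
      show "AE x in P. norm (1 - (1 - u x) ^ n) \<le> 1" for n
        using u(2) by (intro AE_I2) (auto simp: power_le_one)
    qed (use P(2) in measurable)
    moreover have "(LINT x|P. indicator {x. u x > 0} x) = measure P {x. u x > 0}"
      using sets_eq_imp_space_eq[OF P(2)] by simp
    ultimately show ?thesis by simp
  qed
  have Meq: "emeasure M X = emeasure N X" if "X \<in> E" for X
  proof -
    obtain u where u: "X = {x. u x > 0}" "C1_compact_support u" "\<And>x. 0 \<le> u x \<and> u x \<le> 1"
      using \<open>X \<in> E\<close> unfolding E_def by auto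
    have "C1_compact_support (\<lambda>x. 1 - (1 - u x) ^ n)" for n
      by (rule C1_compact_support_compose[OF u(2), where h = "\<lambda>s. 1 - (1 - s) ^ n"
            and h' = "\<lambda>s. of_nat n * (1 - s) ^ (n - 1)"])
        (auto intro!: derivative_eq_intros continuous_intros)
    then have "(\<lambda>n. LINT x|M. 1 - (1 - u x) ^ n) = (\<lambda>n. LINT x|N. 1 - (1 - u x) ^ n)"
      using eq by blast
    then have "measure M X = measure N X"
      using meas_lim[OF M u(2,3)] meas_lim[OF N u(2,3)] u(1) LIMSEQ_unique by metis
    then show ?thesis
      using M(1) N(1) by (simp add: finite_measure.emeasure_eq_measure prob_space_def)
  qed
  have sigma: "sigma_sets UNIV E = sets borel"
  proof (rule antisym)
    show "sigma_sets UNIV E \<subseteq> sets borel"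
    proof -
      have "E \<subseteq> sets borel" using E_open borel_open by blast
      then show ?thesis using sets.sigma_sets_subset[of E borel] by simp
    qed
    have "X \<in> sigma_sets UNIV E" if "open X" for X :: "'a set"
    proof -
      define \<B> where "\<B> = {S \<in> E. S \<subseteq> X}"
      show ?thesis
      proof (rule Lindelof[of \<B>])
        show "open S" if "S \<in> \<B>" for S using that E_open by (simp add: \<B>_def)
      next
        fix \<F> assume \<F>: "\<F> \<subseteq> \<B>" "countable \<F>" "\<Union>\<F> = \<Union>\<B>"
        have "x \<in> \<Union>\<B>" if x: "x \<in> X" for x
        proof -
          obtain r where r: "r > 0" "ball x r \<subseteq> X"
            using \<open>open X\<close> x by (rule openE)
          then have "ball x r \<in> \<B>" by (simp add: \<B>_def ball_E)
          then show ?thesis using r(1) by (intro UnionI[of "ball x r"]) auto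
        qed
        moreover have "\<Union>\<B> \<subseteq> X" unfolding \<B>_def by blast
        ultimately have "X = \<Union>\<F>" unfolding \<F>(3) by blast
        moreover have "\<F> \<subseteq> sigma_sets UNIV E"
          using \<F>(1) by (auto simp: \<B>_def)
        then have "\<Union>\<F> \<in> sigma_sets UNIV E"
          using \<F>(2) by (intro sigma_sets_UNION) auto
        ultimately show ?thesis by simp
      qed
    qed
    then have "Collect open \<subseteq> sigma_sets UNIV E" by blast
    then show "sets borel \<subseteq> sigma_sets UNIV E"
      unfolding borel_def by (simp add: sigma_sets_mono)
  qed
  show ?thesis
  proof (rule measure_eqI_generator_eq[OF \<open>Int_stable E\<close> _ Meq, where \<Omega> = UNIV
        and A = "\<lambda>n. ball 0 (real (Suc n))"])
    show "sets M = sigma_sets UNIV E" "sets N = sigma_sets UNIV E" using sigma M N by auto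
    show "range (\<lambda>n. ball (0::'a) (real (Suc n))) \<subseteq> E" using ball_E by auto
    show "(\<Union>n. ball (0::'a) (real (Suc n))) = UNIV"
    proof -
      have "\<exists>n. norm x < real (Suc n)" for x :: 'a
        using reals_Archimedean2[of "norm x"] by (metis less_Suc_eq less_trans of_nat_less_iff)
      then show ?thesis by auto
    qed
    show "emeasure M (ball 0 (real (Suc i))) \<noteq> \<infinity>" for i
      using M(1) by (simp add: finite_measure.emeasure_finite prob_space_def)
  qed auto
qed

section \<open>A priori bounds for the characteristic flow\<close>

lemma nn_integral_limit_le:
  fixes f :: "nat \<Rightarrow> 'a \<Rightarrow> ennreal"
  assumes "\<And>n. f n \<in> borel_measurable M"
    and "\<And>x. x \<in> space M \<Longrightarrow> (\<lambda>n. f n x) \<longlonglongrightarrow> g x"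
    and "\<And>n. (\<integral>\<^sup>+x. f n x \<partial>M) \<le> N"
  shows "(\<integral>\<^sup>+x. g x \<partial>M) \<le> N"
proof -
  have "(\<integral>\<^sup>+x. g x \<partial>M) = (\<integral>\<^sup>+x. liminf (\<lambda>n. f n x) \<partial>M)"
    by (intro nn_integral_cong lim_imp_Liminf[symmetric] assms(2)) auto
  also have "\<dots> \<le> liminf (\<lambda>n. \<integral>\<^sup>+x. f n x \<partial>M)"
    by (rule nn_integral_liminf[OF assms(1)])
  also have "\<dots> \<le> liminf (\<lambda>n::nat. N)"
    by (intro Liminf_mono always_eventually allI assms(3))
  finally show ?thesis by (simp add: Liminf_const)
qed

locale cs_weight =
  fixes \<kappa> :: real and \<phi> :: "real \<Rightarrow> real" and K L :: real
  assumes kappa_pos: "0 < \<kappa>" and K_nonneg: "0 \<le> K" and L_nonneg: "0 \<le> L"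
    and weight_range: "\<And>r. 0 \<le> r \<Longrightarrow> \<phi> r \<in> {0..K}"
    and weight_lipschitz: "\<And>r s. 0 \<le> r \<Longrightarrow> 0 \<le> s \<Longrightarrow> \<bar>\<phi> r - \<phi> s\<bar> \<le> L * \<bar>r - s\<bar>"
begin

definition speed :: real where "speed = \<kappa> * K"

lemma speed_nonneg: "0 \<le> speed"
  using kappa_pos K_nonneg by (simp add: speed_def)

text \<open>
  In this time, the sum of \<open>\<bar>\<Phi> t z\<bar>\<close> and a bound for the moment changes at most by the factor \<open>3 / 2\<close>.
\<close>

definition comparison_step :: real where "comparison_step = ln (3 / 2) / (1 + speed)"

lemma comparison_step_pos: "0 < comparison_step"
  using speed_nonneg by (simp add: comparison_step_def)

lemma abs_weight_le: "0 \<le> r \<Longrightarrow> \<bar>\<phi> r\<bar> \<le> K"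
  using weight_range[of r] by auto

lemma continuous_on_weight: "continuous_on {0..} \<phi>"
proof -
  have "L-lipschitz_on {0..} \<phi>"
    using weight_lipschitz L_nonneg by (intro lipschitz_onI) (auto simp: dist_real_def)
  then show ?thesis by (rule lipschitz_on_continuous_on)
qed

lemma kernel_measurable [measurable]:
  "alignment_kernel \<phi> x v \<in> borel_measurable (borel :: ('a::euclidean_space \<times> 'a) measure)"
proof (rule borel_measurable_continuous_onI)
  show "continuous_on UNIV (alignment_kernel \<phi> x v)"
    unfolding alignment_kernel_def case_prod_unfold
    by (intro continuous_intros continuous_on_compose2[OF continuous_on_weight]) auto
qed

lemma norm_kernel_le: "norm (alignment_kernel \<phi> x v z) \<le> K * (norm v + norm z)"
proof -
  have "norm (v - snd z) \<le> norm v + norm z"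
    using norm_triangle_ineq4[of v "snd z"] norm_components_le(2)[of z] by simp
  then have "\<bar>\<phi> (norm (x - fst z))\<bar> * norm (v - snd z) \<le> K * (norm v + norm z)"
    using K_nonneg by (intro mult_mono abs_weight_le) auto
  then show ?thesis by (simp add: alignment_kernel_def case_prod_unfold)
qed

text \<open>
  Only the speeds of the second pair occur on the right-hand side: write the difference as a change of the relative
  velocity, with coefficient at most \<open>K\<close>, plus a change of the weight, with the relative velocity of the
  second pair as a factor.
\<close>

lemma kernel_lipschitz:
  "norm (alignment_kernel \<phi> x v (y, w) - alignment_kernel \<phi> x' v' (y', w'))
    \<le> K * (norm (v - v') + norm (w - w'))
      + L * (norm (x - x') + norm (y - y')) * (norm v' + norm w')"
proof -
  define a where "a = v - w"
  define a' where "a' = v' - w'"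
  define p where "p = \<phi> (norm (x - y))"
  define p' where "p' = \<phi> (norm (x' - y'))"
  have "norm (a - a') \<le> norm (v - v') + norm (w - w')"
    using norm_triangle_ineq4[of "v - v'" "w - w'"] by (simp add: a_def a'_def algebra_simps)
  then have 1: "norm (p *\<^sub>R (a - a')) \<le> K * (norm (v - v') + norm (w - w'))"
    unfolding norm_scaleR p_def using K_nonneg by (intro mult_mono abs_weight_le) auto
  have "\<bar>norm (x - y) - norm (x' - y')\<bar> \<le> norm ((x - x') - (y - y'))"
    using norm_triangle_ineq3[of "x - y" "x' - y'"] by (simp add: algebra_simps)
  also have "\<dots> \<le> norm (x - x') + norm (y - y')" by (rule norm_triangle_ineq4)
  finally have "L * \<bar>norm (x - y) - norm (x' - y')\<bar> \<le> L * (norm (x - x') + norm (y - y'))"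
    by (rule mult_left_mono) (rule L_nonneg)
  then have "\<bar>p - p'\<bar> \<le> L * (norm (x - x') + norm (y - y'))"
    unfolding p_def p'_def
    using weight_lipschitz[of "norm (x - y)" "norm (x' - y')"] by (auto intro: order_trans)
  moreover have "norm a' \<le> norm v' + norm w'"
    unfolding a'_def by (rule norm_triangle_ineq4)
  ultimately have 2: "norm ((p - p') *\<^sub>R a')
      \<le> L * (norm (x - x') + norm (y - y')) * (norm v' + norm w')"
    unfolding norm_scaleR by (intro mult_mono) auto
  have "alignment_kernel \<phi> x v (y, w) - alignment_kernel \<phi> x' v' (y', w')
      = p *\<^sub>R (a - a') + (p - p') *\<^sub>R a'"
    by (simp add: alignment_kernel_def a_def a'_def p_def p'_def algebra_simps)
  then show ?thesis using norm_triangle_mono[OF 1 2] by simp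
qed

end

text \<open>
  One solution on \<open>[0, T)\<close>, seen through its flow: \<open>\<Phi> t z\<close> is the phase-space position at time \<open>t\<close> of the
  characteristic that starts in \<open>z\<close>. All integrals are pulled back to the initial measure.
\<close>

locale cs_flow = cs_weight \<kappa> \<phi> K L
  for \<kappa> :: real and \<phi> :: "real \<Rightarrow> real" and K L :: real +
  fixes T :: real and \<mu> :: "real \<Rightarrow> ('a::euclidean_space \<times> 'a) measure"
    and \<Phi> :: "real \<Rightarrow> 'a \<times> 'a \<Rightarrow> 'a \<times> 'a"
  assumes T_pos: "0 < T"
    and prob_initial: "prob_space (\<mu> 0)" and sets_initial [measurable_cong]: "sets (\<mu> 0) = sets borel"
    and flow_0: "\<And>z. \<Phi> 0 z = z"
    and flow_deriv: "\<And>t z. t \<in> {0..<T} \<Longrightarrow>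
      ((\<lambda>s. \<Phi> s z) has_vector_derivative
        (snd (\<Phi> t z), alignment \<kappa> \<phi> (\<mu> t) (fst (\<Phi> t z)) (snd (\<Phi> t z)))) (at t within {0..<T})"
    and flow_measurable: "\<And>t. t \<in> {0..<T} \<Longrightarrow> \<Phi> t \<in> borel \<rightarrow>\<^sub>M borel"
    and flow_push: "\<And>t. t \<in> {0..<T} \<Longrightarrow> \<mu> t = distr (\<mu> 0) borel (\<Phi> t)"
    and flow_integrable: "\<And>t. t \<in> {0..<T} \<Longrightarrow> integrable (\<mu> 0) (\<lambda>z. norm (\<Phi> t z))"
begin

sublocale prob_space "\<mu> 0" by (rule prob_initial)

lemma flow_measurable_initial: "t \<in> {0..<T} \<Longrightarrow> \<Phi> t \<in> \<mu> 0 \<rightarrow>\<^sub>M borel"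
  using flow_measurable by (simp cong: measurable_cong_sets add: sets_initial)

definition moment :: "real \<Rightarrow> real" where
  "moment t = (LINT z|\<mu> 0. norm (\<Phi> t z))"

lemma moment_nonneg: "0 \<le> moment t"
  by (simp add: moment_def)

lemma alignment_eq:
  assumes "t \<in> {0..<T}"
  shows "alignment \<kappa> \<phi> (\<mu> t) x v = - \<kappa> *\<^sub>R (LINT w|\<mu> 0. alignment_kernel \<phi> x v (\<Phi> t w))"
  unfolding alignment_def flow_push[OF assms]
  by (subst integral_distr) (auto simp: flow_measurable_initial[OF assms] kernel_measurable)

lemma kernel_integrable:
  assumes "t \<in> {0..<T}"
  shows "integrable (\<mu> 0) (\<lambda>w. alignment_kernel \<phi> x v (\<Phi> t w))"
proof (rule Bochner_Integration.integrable_bound)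
  show "integrable (\<mu> 0) (\<lambda>w. K * (norm v + norm (\<Phi> t w)))"
    using flow_integrable[OF assms] by simp
  show "(\<lambda>w. alignment_kernel \<phi> x v (\<Phi> t w)) \<in> borel_measurable (\<mu> 0)"
    by (rule measurable_compose[OF flow_measurable_initial[OF assms] kernel_measurable])
  show "AE w in \<mu> 0. norm (alignment_kernel \<phi> x v (\<Phi> t w)) \<le> norm (K * (norm v + norm (\<Phi> t w)))"
    using norm_kernel_le K_nonneg by (intro AE_I2) (simp add: order_trans[OF norm_kernel_le])
qed

lemma norm_alignment_le:
  assumes "t \<in> {0..<T}"
  shows "norm (alignment \<kappa> \<phi> (\<mu> t) x v) \<le> speed * (norm v + moment t)"
proof -
  have "norm (LINT w|\<mu> 0. alignment_kernel \<phi> x v (\<Phi> t w))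
      \<le> (LINT w|\<mu> 0. norm (alignment_kernel \<phi> x v (\<Phi> t w)))"
    by (rule integral_norm_bound)
  also have "\<dots> \<le> (LINT w|\<mu> 0. K * (norm v + norm (\<Phi> t w)))"
    using flow_integrable[OF assms] kernel_integrable[OF assms]
    by (intro integral_mono norm_kernel_le) auto
  also have "\<dots> = K * (norm v + moment t)"
    using flow_integrable[OF assms] by (simp add: moment_def prob_space)
  finally show ?thesis
    using kappa_pos unfolding alignment_eq[OF assms] speed_def
    by (simp add: mult.assoc)
qed

lemma norm_velocity_field_le:
  assumes "t \<in> {0..<T}" "moment t \<le> S"
  shows "norm (snd z, alignment \<kappa> \<phi> (\<mu> t) (fst z) (snd z)) \<le> (1 + speed) * (norm z + S)"
proof -
  have z: "norm (snd z) \<le> norm z" using norm_components_le(2)[of z] by simp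
  have "speed * (norm (snd z) + moment t) \<le> speed * (norm z + S)"
    using z assms(2) speed_nonneg by (intro mult_left_mono) auto
  then have "norm (alignment \<kappa> \<phi> (\<mu> t) (fst z) (snd z)) \<le> speed * (norm z + S)"
    using norm_alignment_le[OF assms(1)] by (rule order_trans[rotated])
  moreover have "norm (snd z) \<le> norm z + S" using z moment_nonneg[of t] assms(2) by simp
  ultimately show ?thesis
    using norm_Pair_le[of "snd z" "alignment \<kappa> \<phi> (\<mu> t) (fst z) (snd z)"]
    by (simp add: algebra_simps)
qed

lemma continuous_on_flow: "continuous_on {0..<T} (\<lambda>s. \<Phi> s z)"
  using flow_deriv has_vector_derivative_continuous continuous_on_eq_continuous_within by blast

lemma flow_deriv_interior:
  assumes "0 < t" "t < T"
  shows "((\<lambda>s. \<Phi> s z) has_vector_derivative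
        (snd (\<Phi> t z), alignment \<kappa> \<phi> (\<mu> t) (fst (\<Phi> t z)) (snd (\<Phi> t z)))) (at t)"
proof -
  have "at t within {0..<T} = at t"
    using assms by (intro at_within_interior) auto
  then show ?thesis using flow_deriv[of t z] assms by simp
qed

lemma flow_growth_forward:
  assumes "0 \<le> s" "s \<le> t" "t < T" and S: "\<And>r. r \<in> {s..t} \<Longrightarrow> moment r \<le> S"
  shows "norm (\<Phi> t z) + S \<le> (norm (\<Phi> s z) + S) * exp ((1 + speed) * (t - s))"
proof (rule norm_gronwall[OF \<open>s \<le> t\<close>, where U = "\<lambda>r. \<Phi> r z"])
  show "continuous_on {s..t} (\<lambda>r. \<Phi> r z)"
    by (rule continuous_on_subset[OF continuous_on_flow]) (use assms in auto)
  fix r assume r: "s < r" "r < t"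
  show "((\<lambda>r. \<Phi> r z) has_vector_derivative
      (snd (\<Phi> r z), alignment \<kappa> \<phi> (\<mu> r) (fst (\<Phi> r z)) (snd (\<Phi> r z)))) (at r)"
    by (rule flow_deriv_interior) (use r assms in auto)
  show "norm (snd (\<Phi> r z), alignment \<kappa> \<phi> (\<mu> r) (fst (\<Phi> r z)) (snd (\<Phi> r z)))
      \<le> (1 + speed) * (norm (\<Phi> r z) + S)"
    by (rule norm_velocity_field_le) (use r assms in auto)
next
  show "0 \<le> S" using S[of s] moment_nonneg[of s] \<open>s \<le> t\<close> by auto
qed (use speed_nonneg in auto)

text \<open>
  The velocity field has the same linear growth bound when time is reversed, so the forward argument applies to
  \<open>r \<mapsto> \<Phi> (s + t - r) z\<close>.
\<close>

lemma flow_growth_backward: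
  assumes "0 \<le> s" "s \<le> t" "t < T" and S: "\<And>r. r \<in> {s..t} \<Longrightarrow> moment r \<le> S"
  shows "norm (\<Phi> s z) + S \<le> (norm (\<Phi> t z) + S) * exp ((1 + speed) * (t - s))"
proof -
  have "norm (\<Phi> (s + t - t) z) + S \<le> (norm (\<Phi> (s + t - s) z) + S) * exp ((1 + speed) * (t - s))"
  proof (rule norm_gronwall[OF \<open>s \<le> t\<close>, where U = "\<lambda>r. \<Phi> (s + t - r) z"])
    show "continuous_on {s..t} (\<lambda>r. \<Phi> (s + t - r) z)"
      by (rule continuous_on_compose2[OF continuous_on_flow])
        (use assms in \<open>auto intro!: continuous_intros\<close>)
    fix r assume r: "s < r" "r < t"
    let ?r = "s + t - r"
    let ?F = "(snd (\<Phi> ?r z), alignment \<kappa> \<phi> (\<mu> ?r) (fst (\<Phi> ?r z)) (snd (\<Phi> ?r z)))"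
    have "((\<lambda>r. s + t - r) has_vector_derivative - 1) (at r)"
      by (auto intro!: derivative_eq_intros)
    moreover have "((\<lambda>r. \<Phi> r z) has_vector_derivative ?F) (at ?r)"
      by (rule flow_deriv_interior) (use r assms in auto)
    ultimately have "(((\<lambda>r. \<Phi> r z) \<circ> (\<lambda>r. s + t - r)) has_vector_derivative (- 1) *\<^sub>R ?F) (at r)"
      by (rule vector_diff_chain_at)
    then show "((\<lambda>r. \<Phi> (s + t - r) z) has_vector_derivative - ?F) (at r)"
      unfolding o_def scaleR_minus1_left .
    have "norm ?F \<le> (1 + speed) * (norm (\<Phi> ?r z) + S)"
      by (rule norm_velocity_field_le) (use r assms in auto)
    then show "norm (- ?F) \<le> (1 + speed) * (norm (\<Phi> ?r z) + S)"
      by (simp del: uminus_Pair)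
  next
    show "0 \<le> S" using S[of s] moment_nonneg[of s] \<open>s \<le> t\<close> by auto
  qed (use speed_nonneg in auto)
  then show ?thesis by simp
qed

lemma velocity_growth:
  assumes "t \<in> {0..<T}" and S: "\<And>r. r \<in> {0..t} \<Longrightarrow> moment r \<le> S"
  shows "norm (snd (\<Phi> t z)) + S \<le> (norm (snd z) + S) * exp (speed * t)"
proof -
  have "norm (snd (\<Phi> t z)) + S \<le> (norm (snd (\<Phi> 0 z)) + S) * exp (speed * (t - 0))"
  proof (rule norm_gronwall[where U = "\<lambda>r. snd (\<Phi> r z)"])
    show "continuous_on {0..t} (\<lambda>r. snd (\<Phi> r z))"
      by (intro continuous_on_snd continuous_on_subset[OF continuous_on_flow]) (use assms in auto)
    fix r assume r: "0 < r" "r < t"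
    have "((\<lambda>r. \<Phi> r z) has_vector_derivative
      (snd (\<Phi> r z), alignment \<kappa> \<phi> (\<mu> r) (fst (\<Phi> r z)) (snd (\<Phi> r z)))) (at r)"
      by (rule flow_deriv_interior) (use r assms in auto)
    from bounded_linear.has_vector_derivative[OF bounded_linear_snd this]
    show "((\<lambda>r. snd (\<Phi> r z)) has_vector_derivative
        alignment \<kappa> \<phi> (\<mu> r) (fst (\<Phi> r z)) (snd (\<Phi> r z))) (at r)" by simp
    have "norm (alignment \<kappa> \<phi> (\<mu> r) (fst (\<Phi> r z)) (snd (\<Phi> r z)))
        \<le> speed * (norm (snd (\<Phi> r z)) + moment r)"
      by (rule norm_alignment_le) (use r assms in auto)
    also have "\<dots> \<le> speed * (norm (snd (\<Phi> r z)) + S)"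
      using S[of r] r speed_nonneg by (intro mult_left_mono) auto
    finally show "norm (alignment \<kappa> \<phi> (\<mu> r) (fst (\<Phi> r z)) (snd (\<Phi> r z)))
        \<le> speed * (norm (snd (\<Phi> r z)) + S)" .
  next
    show "0 \<le> S" using S[of 0] moment_nonneg[of 0] assms(1) by auto
  qed (use speed_nonneg assms in auto)
  then show ?thesis by (simp add: flow_0)
qed

text \<open>
  If \<open>S\<close> bounds the moment on the interval, integrating the growth estimate between \<open>q\<close> and \<open>r\<close> gives
  \<open>moment r + S \<le> 3 / 2 * (moment q + S)\<close>, and half of \<open>S\<close> is absorbed.
\<close>

lemma moment_comparable:
  assumes "0 \<le> s" "s \<le> t" "t < T" "t - s \<le> comparison_step"
    and bdd: "bdd_above (moment ` {s..t})" and p: "p \<in> {s..t}" and q: "q \<in> {s..t}"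
  shows "moment p \<le> 3 * moment q"
proof -
  have "moment p \<le> 2 * (3 / 2 * moment q)"
  proof (rule bounded_absorption[OF bdd _ p])
    fix S r assume S: "\<And>j. j \<in> {s..t} \<Longrightarrow> moment j \<le> S" and r: "r \<in> {s..t}"
    have "0 \<le> S" using S[OF r] moment_nonneg[of r] by linarith
    have factor: "exp ((1 + speed) * d) \<le> 3 / 2" if "d \<le> comparison_step" for d
    proof -
      have "(1 + speed) * d \<le> (1 + speed) * comparison_step"
        using that speed_nonneg by (intro mult_left_mono) auto
      also have "\<dots> = ln (3 / 2)" using speed_nonneg by (simp add: comparison_step_def)
      finally have "exp ((1 + speed) * d) \<le> exp (ln (3 / 2))" by (simp only: exp_le_cancel_iff)
      also have "\<dots> = 3 / 2" by (rule exp_ln) simp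
      finally show ?thesis .
    qed
    have pointwise: "norm (\<Phi> r z) + S \<le> (norm (\<Phi> q z) + S) * (3 / 2)" for z
    proof (cases "q \<le> r")
      case True
      have "norm (\<Phi> r z) + S \<le> (norm (\<Phi> q z) + S) * exp ((1 + speed) * (r - q))"
        by (rule flow_growth_forward) (use S r q assms True in auto)
      also have "\<dots> \<le> (norm (\<Phi> q z) + S) * (3 / 2)"
        using \<open>0 \<le> S\<close> r q assms by (intro mult_left_mono factor) auto
      finally show ?thesis .
    next
      case False
      have "norm (\<Phi> r z) + S \<le> (norm (\<Phi> q z) + S) * exp ((1 + speed) * (q - r))"
        by (rule flow_growth_backward) (use S r q assms False in auto)
      also have "\<dots> \<le> (norm (\<Phi> q z) + S) * (3 / 2)"
        using \<open>0 \<le> S\<close> r q assms by (intro mult_left_mono factor) auto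
      finally show ?thesis .
    qed
    have I: "integrable (\<mu> 0) (\<lambda>z. norm (\<Phi> r z))" "integrable (\<mu> 0) (\<lambda>z. norm (\<Phi> q z))"
      using r q assms by (auto intro!: flow_integrable)
    have "(LINT z|\<mu> 0. norm (\<Phi> r z) + S) \<le> (LINT z|\<mu> 0. (norm (\<Phi> q z) + S) * (3 / 2))"
      using I by (intro integral_mono pointwise) auto
    then have "moment r + S \<le> (moment q + S) * (3 / 2)"
      using I by (simp add: moment_def prob_space)
    then show "moment r \<le> 3 / 2 * moment q + S / 2" by (simp add: algebra_simps)
  qed
  then show ?thesis by simp
qed

text \<open>Trajectories are continuous in time, hence the moment is lower semicontinuous by Fatou's lemma.\<close>

lemma closed_moment_sublevel:
  assumes "b < T" shows "closed {t \<in> {0..b}. moment t \<le> N}"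
  unfolding closed_sequential_limits
proof (intro allI impI; elim conjE)
  fix t l assume t: "\<forall>n. t n \<in> {t \<in> {0..b}. moment t \<le> N}" and lim: "t \<longlonglongrightarrow> l"
  have l: "l \<in> {0..b}"
    using closed_sequentially[OF closed_atLeastAtMost[of 0 b] _ lim] t by blast
  have nn: "(\<integral>\<^sup>+z. ennreal (norm (\<Phi> r z)) \<partial>\<mu> 0) = ennreal (moment r)" if "r \<in> {0..b}" for r
    unfolding moment_def using that assms
    by (intro nn_integral_eq_integral flow_integrable) auto
  have "(\<integral>\<^sup>+z. ennreal (norm (\<Phi> l z)) \<partial>\<mu> 0) \<le> ennreal N"
  proof (rule nn_integral_limit_le[where f = "\<lambda>n z. ennreal (norm (\<Phi> (t n) z))"])
    fix n
    have tn: "t n \<in> {0..b}" "moment (t n) \<le> N" using t by auto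
    have [measurable]: "\<Phi> (t n) \<in> \<mu> 0 \<rightarrow>\<^sub>M borel"
      using tn assms by (intro flow_measurable_initial) auto
    show "(\<lambda>z. ennreal (norm (\<Phi> (t n) z))) \<in> borel_measurable (\<mu> 0)" by measurable
    show "(\<integral>\<^sup>+z. ennreal (norm (\<Phi> (t n) z)) \<partial>\<mu> 0) \<le> ennreal N"
      using nn[OF tn(1)] tn(2) by (simp add: ennreal_leI)
  next
    fix z
    have "t n \<in> {0..<T}" for n using spec[OF t, of n] assms by auto
    then have "\<forall>\<^sub>F n in sequentially. t n \<in> {0..<T}" by simp
    moreover have "l \<in> {0..<T}" using l assms by auto
    ultimately have "(\<lambda>n. \<Phi> (t n) z) \<longlonglongrightarrow> \<Phi> l z"
      by (intro continuous_on_tendsto_compose[OF continuous_on_flow lim])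
    then show "(\<lambda>n. ennreal (norm (\<Phi> (t n) z))) \<longlonglongrightarrow> ennreal (norm (\<Phi> l z))"
      by (intro tendsto_ennrealI tendsto_norm)
  qed
  then have "ennreal (moment l) \<le> ennreal N" using nn[OF l] by simp
  moreover have "0 \<le> N" using t moment_nonneg by (metis (mono_tags, lifting) mem_Collect_eq order_trans)
  ultimately show "l \<in> {t \<in> {0..b}. moment t \<le> N}" using l by simp
qed

lemma bdd_above_moment:
  assumes "b < T" shows "bdd_above (moment ` {0..b})"
  by (rule bounded_of_local_comparability[OF closed_moment_sublevel comparison_step_pos moment_nonneg moment_comparable])
    (use assms in auto)

text \<open>Each comparison step costs a factor \<open>3\<close>.\<close>

lemma moment_le:
  assumes "t \<in> {0..<T}" shows "moment t \<le> 3 ^ nat \<lceil>T / comparison_step\<rceil> * moment 0"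
proof -
  have *: "r \<in> {0..<T} \<Longrightarrow> r \<le> real k * comparison_step \<Longrightarrow> moment r \<le> 3 ^ k * moment 0" for k r
  proof (induction k arbitrary: r)
    case 0
    then show ?case by simp
  next
    case (Suc k)
    define s where "s = max 0 (r - comparison_step)"
    have "s \<in> {0..<T}" "s \<le> real k * comparison_step" "s \<le> r" "r - s \<le> comparison_step"
      using Suc.prems comparison_step_pos by (auto simp: s_def algebra_simps max_def)
    moreover from this have "moment s \<le> 3 ^ k * moment 0" by (intro Suc.IH)
    moreover have "bdd_above (moment ` {s..r})"
      by (rule bdd_above_mono[OF bdd_above_moment[of r]]) (use Suc.prems \<open>s \<in> _\<close> in auto)
    ultimately have "moment r \<le> 3 * moment s"
      using Suc.prems by (intro moment_comparable[of s r]) auto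
    with \<open>moment s \<le> _\<close> show ?case by simp
  qed
  have "T / comparison_step \<le> real (nat \<lceil>T / comparison_step\<rceil>)" by (rule real_nat_ceiling_ge)
  then have "T \<le> real (nat \<lceil>T / comparison_step\<rceil>) * comparison_step"
    using comparison_step_pos by (simp add: field_simps)
  then show ?thesis using assms by (intro *) auto
qed

end

section \<open>The flow at the final time\<close>

lemma C1_compact_support_bounded:
  assumes "C1_compact_support f"
  obtains C where "\<And>x. \<bar>f x\<bar> \<le> C"
proof -
  let ?S = "closure {x. f x \<noteq> 0}"
  have "compact ?S" using assms by (simp add: C1_compact_support_def)
  moreover have "continuous_on ?S f"
    using C1_compact_support_imp_continuous[OF assms] by (rule continuous_on_subset) simp
  ultimately have "bounded (f ` ?S)"
    by (intro compact_imp_bounded compact_continuous_image)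
  then obtain C where C: "\<And>x. x \<in> ?S \<Longrightarrow> \<bar>f x\<bar> \<le> C" unfolding bounded_iff by auto
  have "\<bar>f x\<bar> \<le> max 0 C" for x
  proof (cases "f x = 0")
    case False
    then have "x \<in> ?S" by (intro subsetD[OF closure_subset]) simp
    from C[OF this] show ?thesis by simp
  qed simp
  then show ?thesis by (rule that)
qed

context cs_flow
begin

definition moment_bound :: real where
  "moment_bound = 3 ^ nat \<lceil>T / comparison_step\<rceil> * moment 0"

lemma moment_le_bound: "t \<in> {0..<T} \<Longrightarrow> moment t \<le> moment_bound"
  using moment_le by (simp add: moment_bound_def)

lemma norm_flow_le:
  assumes "t \<in> {0..<T}" "moment_bound \<le> S"
  shows "norm (\<Phi> t z) \<le> (norm z + S) * exp ((1 + speed) * T)"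
proof -
  have S: "moment r \<le> S" if "r \<in> {0..<T}" for r using moment_le_bound[OF that] assms(2) by simp
  have "0 \<le> S" using S[of 0] moment_nonneg[of 0] T_pos by simp
  have "norm (\<Phi> t z) + S \<le> (norm (\<Phi> 0 z) + S) * exp ((1 + speed) * (t - 0))"
    by (rule flow_growth_forward) (use assms S in auto)
  also have "\<dots> \<le> (norm z + S) * exp ((1 + speed) * T)"
    unfolding flow_0 using \<open>0 \<le> S\<close> assms speed_nonneg by (intro mult_left_mono) auto
  finally show ?thesis using \<open>0 \<le> S\<close> by simp
qed

lemma norm_velocity_le:
  assumes "t \<in> {0..<T}" "moment_bound \<le> S"
  shows "norm (snd (\<Phi> t z)) \<le> (norm (snd z) + S) * exp (speed * T)"
proof -
  have S: "moment r \<le> S" if "r \<in> {0..<T}" for r using moment_le_bound[OF that] assms(2) by simp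
  have "0 \<le> S" using S[of 0] moment_nonneg[of 0] T_pos by simp
  have "norm (snd (\<Phi> t z)) + S \<le> (norm (snd z) + S) * exp (speed * t)"
    by (rule velocity_growth) (use assms S in auto)
  also have "\<dots> \<le> (norm (snd z) + S) * exp (speed * T)"
    using \<open>0 \<le> S\<close> assms speed_nonneg by (intro mult_left_mono) (auto intro!: mult_left_mono)
  finally show ?thesis using \<open>0 \<le> S\<close> by simp
qed

lemma flow_lipschitz:
  obtains C where "C-lipschitz_on {0..<T} (\<lambda>t. \<Phi> t z)"
proof -
  define R where "R = (norm z + moment_bound) * exp ((1 + speed) * T)"
  define C where "C = (1 + speed) * (R + moment_bound)"
  have "0 \<le> moment_bound" using moment_nonneg[of 0] by (simp add: moment_bound_def)
  then have "0 \<le> C" using speed_nonneg by (simp add: C_def R_def)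
  have le: "norm (\<Phi> t z - \<Phi> s z) \<le> C * (t - s)" if st: "0 \<le> s" "s < t" "t < T" for s t
  proof -
    have "norm (\<Phi> t z - \<Phi> s z) \<le> C * t - C * s"
    proof (rule differentiable_bound_general[OF \<open>s < t\<close>, where f = "\<lambda>r. \<Phi> r z" and \<phi> = "\<lambda>r. C * r"])
      show "continuous_on {s..t} (\<lambda>r. \<Phi> r z)"
        by (rule continuous_on_subset[OF continuous_on_flow]) (use st in auto)
      show "continuous_on {s..t} (\<lambda>r. C * r)" by (intro continuous_intros)
      fix r assume r: "s < r" "r < t"
      show "((\<lambda>r. \<Phi> r z) has_vector_derivative
          (snd (\<Phi> r z), alignment \<kappa> \<phi> (\<mu> r) (fst (\<Phi> r z)) (snd (\<Phi> r z)))) (at r)"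
        by (rule flow_deriv_interior) (use r st in auto)
      show "((\<lambda>r. C * r) has_vector_derivative C) (at r)"
        by (auto intro!: derivative_eq_intros)
      have rT: "r \<in> {0..<T}" using r st by auto
      have "norm (snd (\<Phi> r z), alignment \<kappa> \<phi> (\<mu> r) (fst (\<Phi> r z)) (snd (\<Phi> r z)))
          \<le> (1 + speed) * (norm (\<Phi> r z) + moment_bound)"
        by (rule norm_velocity_field_le[OF rT moment_le_bound[OF rT]])
      also have "\<dots> \<le> C"
        unfolding C_def R_def using speed_nonneg norm_flow_le[OF rT order_refl]
        by (intro mult_left_mono) auto
      finally show "norm (snd (\<Phi> r z), alignment \<kappa> \<phi> (\<mu> r) (fst (\<Phi> r z)) (snd (\<Phi> r z))) \<le> C" .
    qed
    then show ?thesis by (simp add: right_diff_distrib)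
  qed
  show ?thesis
  proof (rule that, rule lipschitz_onI[OF _ \<open>0 \<le> C\<close>])
    fix s t assume "s \<in> {0..<T}" "t \<in> {0..<T}"
    then consider "0 \<le> s" "s < t" "t < T" | "0 \<le> t" "t < s" "s < T" | "s = t" by fastforce
    then show "dist (\<Phi> s z) (\<Phi> t z) \<le> C * dist s t"
    proof cases
      case 1
      then show ?thesis using le[of s t] by (simp add: dist_norm norm_minus_commute)
    next
      case 2
      then show ?thesis using le[of t s] by (simp add: dist_norm norm_minus_commute)
    qed simp
  qed
qed

definition approach :: "nat \<Rightarrow> real" where
  "approach n = T - T / real (Suc n)"

lemma approach_in: "approach n \<in> {0..<T}"
  using T_pos by (simp add: approach_def field_simps)

lemma approach_tendsto: "approach \<longlonglongrightarrow> T"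
proof -
  have "(\<lambda>n. T - T * inverse (real (Suc n))) \<longlonglongrightarrow> T - T * 0"
    by (intro tendsto_intros LIMSEQ_inverse_real_of_nat)
  then show ?thesis by (simp add: approach_def[abs_def] divide_inverse)
qed

definition terminal :: "'a \<times> 'a \<Rightarrow> 'a \<times> 'a" where
  "terminal z = lim (\<lambda>n. \<Phi> (approach n) z)"

lemma flow_tendsto_terminal: "(\<lambda>n. \<Phi> (approach n) z) \<longlonglongrightarrow> terminal z"
proof -
  obtain C where "C-lipschitz_on {0..<T} (\<lambda>t. \<Phi> t z)" by (rule flow_lipschitz)
  then have "uniformly_continuous_on {0..<T} (\<lambda>t. \<Phi> t z)"
    by (rule lipschitz_on_uniformly_continuous)
  moreover have "Cauchy approach" using approach_tendsto by (rule LIMSEQ_imp_Cauchy)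
  ultimately have "Cauchy (\<lambda>n. \<Phi> (approach n) z)"
    by (rule uniformly_continuous_on_Cauchy) (rule approach_in)
  then show ?thesis
    unfolding terminal_def by (simp add: Cauchy_convergent convergent_LIMSEQ_iff[symmetric])
qed

lemma terminal_measurable: "terminal \<in> borel \<rightarrow>\<^sub>M borel"
  by (rule borel_measurable_LIMSEQ_metric[OF flow_measurable[OF approach_in] flow_tendsto_terminal])

text \<open>
  Along the times \<open>approach n\<close>, the integral of a test function converges both to its integral over \<open>\<mu> T\<close>, by weak
  continuity, and to its integral over the pushforward, by dominated convergence.
\<close>

lemma terminal_push:
  assumes T: "prob_space (\<mu> T)" "sets (\<mu> T) = sets borel"
    and cont: "\<And>\<eta>. C1_compact_support \<eta> \<Longrightarrow> continuous_on {0..T} (\<lambda>t. LINT z|\<mu> t. \<eta> z)"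
  shows "\<mu> T = distr (\<mu> 0) borel terminal"
proof (rule prob_measure_eqI_C1_compact_support[OF T])
  have tm: "terminal \<in> \<mu> 0 \<rightarrow>\<^sub>M borel"
    using terminal_measurable by (simp cong: measurable_cong_sets add: sets_initial)
  show "prob_space (distr (\<mu> 0) borel terminal)" by (rule prob_space_distr[OF tm])
  show "sets (distr (\<mu> 0) borel terminal) = sets borel" by simp
  fix \<eta> :: "'a \<times> 'a \<Rightarrow> real" assume \<eta>: "C1_compact_support \<eta>"
  have \<eta>_cont: "continuous_on UNIV \<eta>" by (rule C1_compact_support_imp_continuous[OF \<eta>])
  then have [measurable]: "\<eta> \<in> borel_measurable borel" by (rule borel_measurable_continuous_onI)
  obtain C where C: "\<And>z. \<bar>\<eta> z\<bar> \<le> C" using C1_compact_support_bounded[OF \<eta>] by blast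
  note fm = flow_measurable_initial[OF approach_in]
  have "(\<lambda>n. LINT z|\<mu> 0. \<eta> (\<Phi> (approach n) z)) \<longlonglongrightarrow> (LINT z|\<mu> 0. \<eta> (terminal z))"
  proof (rule integral_dominated_convergence[where w = "\<lambda>_. C"])
    show "AE z in \<mu> 0. (\<lambda>n. \<eta> (\<Phi> (approach n) z)) \<longlonglongrightarrow> \<eta> (terminal z)"
      by (intro AE_I2 continuous_on_tendsto_compose[OF \<eta>_cont flow_tendsto_terminal]) auto
    show "AE z in \<mu> 0. norm (\<eta> (\<Phi> (approach n) z)) \<le> C" for n using C by simp
    show "(\<lambda>z. \<eta> (\<Phi> (approach n) z)) \<in> borel_measurable (\<mu> 0)" for n
      by (rule measurable_compose[OF fm]) measurable
    show "(\<lambda>z. \<eta> (terminal z)) \<in> borel_measurable (\<mu> 0)"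
      by (rule measurable_compose[OF tm]) measurable
  qed simp
  moreover have "(LINT z|\<mu> (approach n). \<eta> z) = (LINT z|\<mu> 0. \<eta> (\<Phi> (approach n) z))" for n
    unfolding flow_push[OF approach_in] by (rule integral_distr[OF fm]) measurable
  moreover have "(\<lambda>n. LINT z|\<mu> (approach n). \<eta> z) \<longlonglongrightarrow> (LINT z|\<mu> T. \<eta> z)"
  proof (rule continuous_on_tendsto_compose[OF cont[OF \<eta>] approach_tendsto])
    have "approach n \<in> {0..T}" for n using approach_in[of n] by auto
    then show "\<forall>\<^sub>F n in sequentially. approach n \<in> {0..T}" by simp
  qed (use T_pos in auto)
  ultimately have "(LINT z|\<mu> T. \<eta> z) = (LINT z|\<mu> 0. \<eta> (terminal z))"
    using LIMSEQ_unique by simp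
  also have "\<dots> = (LINT z|distr (\<mu> 0) borel terminal. \<eta> z)"
    by (rule integral_distr[OF tm, symmetric]) measurable
  finally show "(LINT z|\<mu> T. \<eta> z) = (LINT z|distr (\<mu> 0) borel terminal. \<eta> z)" .
qed

end

section \<open>Exponential moments\<close>

lemma power_le_exp:
  fixes x :: real assumes "0 \<le> x" "0 < n"
  shows "x ^ n \<le> real n ^ n * exp x"
proof -
  have "x / real n \<le> exp (x / real n)"
    using exp_ge_add_one_self[of "x / real n"] by linarith
  then have "(x / real n) ^ n \<le> exp (x / real n) ^ n"
    using assms by (intro power_mono) auto
  also have "\<dots> = exp x"
    using assms by (simp flip: exp_of_nat_mult)
  finally show ?thesis using assms by (simp add: field_simps)
qed

text \<open>
  For every \<open>r > 0\<close> we have \<open>h D \<le> (r h\<^sup>2 D + D / r) / 2\<close> and \<open>h\<^sup>2 D \<le> (h\<^sup>4 + D\<^sup>2) / 2\<close>. The choice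
  \<open>r = sqrt (\<integral> D)\<close> balances the two terms.
\<close>

lemma expectation_mult_le_sqrt:
  fixes h D :: "'a \<Rightarrow> real"
  assumes h: "h \<in> borel_measurable M" "integrable M (\<lambda>x. h x ^ 4)" "(LINT x|M. h x ^ 4) \<le> c"
    and D: "integrable M D" "integrable M (\<lambda>x. (D x)\<^sup>2)" "(LINT x|M. (D x)\<^sup>2) \<le> c'"
    and nonneg: "\<And>x. 0 \<le> h x" "\<And>x. 0 \<le> D x"
  shows "integrable M (\<lambda>x. h x * D x)"
    and "(LINT x|M. h x * D x) \<le> ((c + c' + 2) / 4) * sqrt (LINT x|M. D x)"
proof -
  have [measurable]: "D \<in> borel_measurable M" using D(1) by simp
  note [measurable] = h(1)
  have quad: "(h x)\<^sup>2 * D x \<le> (h x ^ 4 + (D x)\<^sup>2) / 2" for x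
    using sum_squares_bound[of "(h x)\<^sup>2" "D x"] by simp
  have amgm: "h x * D x \<le> (r * ((h x)\<^sup>2 * D x) + D x / r) / 2" if "r > 0" for r x
  proof -
    have "0 \<le> (r * h x - 1)\<^sup>2" by simp
    then have "2 * r * h x \<le> r\<^sup>2 * (h x)\<^sup>2 + 1" by (simp add: power2_eq_square algebra_simps)
    then have "2 * r * h x * D x \<le> (r\<^sup>2 * (h x)\<^sup>2 + 1) * D x"
      using nonneg(2) by (rule mult_right_mono)
    then have "(2 * r * h x * D x) / (2 * r) \<le> ((r\<^sup>2 * (h x)\<^sup>2 + 1) * D x) / (2 * r)"
      using that by (intro divide_right_mono) auto
    then show ?thesis using that by (simp add: field_simps power2_eq_square)
  qed
  have int2: "integrable M (\<lambda>x. (h x)\<^sup>2 * D x)"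
  proof (rule Bochner_Integration.integrable_bound)
    show "integrable M (\<lambda>x. (h x ^ 4 + (D x)\<^sup>2) / 2)" using h D by simp
    show "AE x in M. norm ((h x)\<^sup>2 * D x) \<le> norm ((h x ^ 4 + (D x)\<^sup>2) / 2)"
      using quad nonneg by (intro AE_I2) (simp add: abs_mult)
  qed measurable
  show int: "integrable M (\<lambda>x. h x * D x)"
  proof (rule Bochner_Integration.integrable_bound)
    show "integrable M (\<lambda>x. (1 * ((h x)\<^sup>2 * D x) + D x / 1) / 2)" using int2 D by simp
    show "AE x in M. norm (h x * D x) \<le> norm ((1 * ((h x)\<^sup>2 * D x) + D x / 1) / 2)"
    proof (rule AE_I2)
      fix x
      have "0 \<le> h x * D x" "h x * D x \<le> (1 * ((h x)\<^sup>2 * D x) + D x / 1) / 2"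
        using amgm[of 1 x] nonneg by auto
      then show "norm (h x * D x) \<le> norm ((1 * ((h x)\<^sup>2 * D x) + D x / 1) / 2)"
        by (simp del: mult_1)
    qed
  qed measurable
  have le: "(LINT x|M. (h x)\<^sup>2 * D x) \<le> (c + c') / 2"
  proof -
    have "(LINT x|M. (h x)\<^sup>2 * D x) \<le> (LINT x|M. (h x ^ 4 + (D x)\<^sup>2) / 2)"
      using int2 h D quad by (intro integral_mono) auto
    also have "\<dots> \<le> (c + c') / 2" using h D by simp
    finally show ?thesis .
  qed
  define Q where "Q = (LINT x|M. D x)"
  have "0 \<le> Q" unfolding Q_def using nonneg(2) by (rule Bochner_Integration.integral_nonneg)
  show "(LINT x|M. h x * D x) \<le> ((c + c' + 2) / 4) * sqrt (LINT x|M. D x)"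
  proof (cases "Q = 0")
    case True
    then have "AE x in M. D x = 0"
      using integral_nonneg_eq_0_iff_AE[OF D(1)] nonneg(2) by (auto simp: Q_def)
    then have "(LINT x|M. h x * D x) = (LINT x|M. 0)"
      by (intro integral_cong_AE) auto
    then show ?thesis using True by (simp add: Q_def)
  next
    case False
    define r where "r = sqrt Q"
    have r: "r > 0" "r * r = Q" using False \<open>0 \<le> Q\<close> by (auto simp: r_def)
    have "(LINT x|M. h x * D x) \<le> (LINT x|M. (r * ((h x)\<^sup>2 * D x) + D x / r) / 2)"
      using int int2 D amgm[OF r(1)] by (intro integral_mono) auto
    also have "\<dots> = (r * (LINT x|M. (h x)\<^sup>2 * D x) + Q / r) / 2"
      using int2 D by (simp add: Q_def)
    also have "\<dots> \<le> (r * ((c + c') / 2) + Q / r) / 2"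
      using le r by (intro divide_right_mono add_right_mono mult_left_mono) auto
    also have "Q / r = r" using r by (simp add: field_simps)
    also have "(r * ((c + c') / 2) + r) / 2 = (c + c' + 2) / 4 * r" by (simp add: field_simps)
    finally show ?thesis by (simp add: r_def Q_def)
  qed
qed

text \<open>
  All constants of the stability estimate are fixed here, before any solution is mentioned: the resulting
  modulus depends only on \<open>\<kappa>\<close>, \<open>T\<close>, \<open>M\<close>, \<open>\<alpha>\<close> and the two constants of the communication weight.
\<close>

locale cs_moment = cs_weight \<kappa> \<phi> K L
  for \<kappa> :: real and \<phi> :: "real \<Rightarrow> real" and K L :: real +
  fixes T \<alpha> M :: real
  assumes T_pos: "0 < T" and alpha_pos: "0 < \<alpha>" and M_pos: "0 < M"
begin

text \<open>
  The first three constants bound the first and second moment of the initial measure and the fourth moment of the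
  exponential weight below; \<open>flow_bound\<close> bounds the first moment at all times.
\<close>

definition first_bound :: real where "first_bound = 1 + M + M / \<alpha>"

definition second_bound :: real where "second_bound = M + (2 / \<alpha>)\<^sup>2 * M"

definition weight_bound :: real where "weight_bound = (8 / \<alpha>) ^ 4 * exp \<alpha> * M"

definition flow_bound :: real where
  "flow_bound = 3 ^ nat \<lceil>T / comparison_step\<rceil> * first_bound"

text \<open>
  Speeds are at most \<open>velocity_factor\<close> times \<open>1 + \<bar>v\<bar>\<close> with the initial velocity \<open>v\<close>, and the gap of a pair
  grows at most at the rate \<open>rate * (1 + \<bar>v\<bar>)\<close>.
\<close>

definition velocity_factor :: real where
  "velocity_factor = (1 + flow_bound) * exp (speed * T)"

definition rate :: real where
  "rate = 1 + speed + \<kappa> * L * velocity_factor * (3 + M / \<alpha>)"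

text \<open>
  The first bound on \<open>\<theta>\<close> makes the fourth power of \<open>exp (\<theta> (1 + \<bar>v\<bar>))\<close> grow at most like \<open>exp (\<alpha> \<bar>v\<bar> / 2)\<close>; the second
  one makes the coefficient of the term that is absorbed in a time step of length \<open>\<theta> / rate\<close> at most one half.
\<close>

definition \<theta> :: real where "\<theta> = min (\<alpha> / 8) (1 / (2 * weight_bound))"

definition stability_step :: real where "stability_step = \<theta> / rate"

text \<open>Bounds the second moment of the gap of a pair of trajectories at all times.\<close>

definition gap_square_bound :: real where
  "gap_square_bound = 3 * (exp ((1 + speed) * T))\<^sup>2 * (2 * second_bound + (2 * flow_bound)\<^sup>2)"

definition step_modulus :: "real \<Rightarrow> real" where
  "step_modulus \<zeta> = ((weight_bound + gap_square_bound + 2) / 2) * sqrt \<zeta>"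

definition modulus :: "real \<Rightarrow> real" where
  "modulus = step_modulus ^^ nat \<lceil>T / stability_step\<rceil>"

lemma first_bound_pos: "0 < first_bound"
  using alpha_pos M_pos by (simp add: first_bound_def add_pos_pos)

lemma second_bound_pos: "0 < second_bound"
  using alpha_pos M_pos by (simp add: second_bound_def add_pos_pos)

lemma weight_bound_pos: "0 < weight_bound"
  using alpha_pos M_pos by (simp add: weight_bound_def)

lemma flow_bound_pos: "0 < flow_bound"
  using first_bound_pos by (simp add: flow_bound_def)

lemma velocity_factor_pos: "0 < velocity_factor"
  using flow_bound_pos by (simp add: velocity_factor_def)

lemma rate_pos: "0 < rate"
  unfolding rate_def using speed_nonneg kappa_pos L_nonneg velocity_factor_pos M_pos alpha_pos
  by (intro add_pos_nonneg mult_nonneg_nonneg) auto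

lemma theta_pos: "0 < \<theta>"
  using weight_bound_pos alpha_pos by (simp add: \<theta>_def)

lemma theta_le: "\<theta> \<le> \<alpha> / 8" "\<theta> * weight_bound \<le> 1 / 2"
proof -
  show "\<theta> \<le> \<alpha> / 8" by (simp add: \<theta>_def)
  have "\<theta> * weight_bound \<le> 1 / (2 * weight_bound) * weight_bound"
    using weight_bound_pos by (intro mult_right_mono) (auto simp: \<theta>_def)
  then show "\<theta> * weight_bound \<le> 1 / 2" using weight_bound_pos by simp
qed

lemma stability_step_pos: "0 < stability_step"
  using theta_pos rate_pos by (simp add: stability_step_def)

lemma gap_square_bound_pos: "0 < gap_square_bound"
  using second_bound_pos flow_bound_pos by (simp add: gap_square_bound_def add_pos_pos)

definition weight :: "'a::euclidean_space \<times> 'a \<Rightarrow> real" where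
  "weight z = 1 + norm (snd z)"

definition exp_weight :: "'a::euclidean_space \<times> 'a \<Rightarrow> real" where
  "exp_weight z = weight z * exp (\<theta> * weight z)"

lemma weight_ge_1: "1 \<le> weight z"
  by (simp add: weight_def)

lemma weight_le_exp_weight: "weight z \<le> exp_weight z"
  using weight_ge_1[of z] theta_pos by (simp add: exp_weight_def)

lemma exp_weight_ge_1: "1 \<le> exp_weight z"
  using weight_ge_1 weight_le_exp_weight by (rule order_trans)

lemma weight_measurable [measurable]:
  "weight \<in> borel_measurable (borel :: ('a::euclidean_space \<times> 'a) measure)"
  unfolding weight_def[abs_def] by (intro borel_measurable_continuous_onI continuous_intros)

lemma exp_weight_measurable [measurable]:
  "exp_weight \<in> borel_measurable (borel :: ('a::euclidean_space \<times> 'a) measure)"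
  unfolding exp_weight_def[abs_def] weight_def
  by (intro borel_measurable_continuous_onI continuous_intros)

text \<open>
  One half of the exponential moment pays for the polynomial factor, the other half for the exponential factor.
\<close>

lemma exp_weight_power_le:
  "exp_weight z ^ 4 \<le> (8 / \<alpha>) ^ 4 * exp \<alpha> * exp (\<alpha> * norm (snd z))"
proof -
  define l where "l = weight z"
  have "1 \<le> l" by (simp add: l_def weight_ge_1)
  have "(\<alpha> / 2 * l) ^ 4 \<le> real 4 ^ 4 * exp (\<alpha> / 2 * l)"
    using \<open>1 \<le> l\<close> alpha_pos by (intro power_le_exp) auto
  then have l4: "l ^ 4 \<le> (8 / \<alpha>) ^ 4 * exp (\<alpha> / 2 * l)"
    using alpha_pos by (simp add: power_mult_distrib power_divide field_simps)
  have "exp_weight z ^ 4 = l ^ 4 * exp (4 * \<theta> * l)"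
    by (simp add: exp_weight_def l_def power_mult_distrib mult.assoc flip: exp_of_nat_mult)
  also have "\<dots> \<le> (8 / \<alpha>) ^ 4 * exp (\<alpha> / 2 * l) * exp (\<alpha> / 2 * l)"
    using theta_le(1) \<open>1 \<le> l\<close> alpha_pos l4 by (intro mult_mono) auto
  also have "\<dots> = (8 / \<alpha>) ^ 4 * exp (\<alpha> * l)"
    by (simp add: mult.assoc flip: exp_add)
  also have "exp (\<alpha> * l) = exp \<alpha> * exp (\<alpha> * norm (snd z))"
    by (simp add: l_def weight_def distrib_left exp_add)
  finally show ?thesis by (simp add: mult.assoc)
qed

text \<open>
  This is the factor of the absorbed term in a time step: it is \<open>\<theta>\<close> times a function whose
  integral is at most \<open>weight_bound\<close>, hence small.
\<close>

lemma weight_exp_minus_one_le: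
  "weight z * (exp (\<theta> * weight z) - 1) \<le> \<theta> * exp_weight z ^ 4"
proof -
  define l where "l = weight z"
  define e where "e = exp (\<theta> * l)"
  have l: "1 \<le> l" by (simp add: l_def weight_ge_1)
  have e: "1 \<le> e" using l theta_pos by (simp add: e_def)
  have "1 - \<theta> * l \<le> exp (- (\<theta> * l))" using exp_ge_add_one_self[of "- (\<theta> * l)"] by simp
  then have "(1 - \<theta> * l) * e \<le> exp (- (\<theta> * l)) * e" using e by (intro mult_right_mono) auto
  also have "\<dots> = 1" by (simp add: e_def flip: exp_add)
  finally have "e - 1 \<le> \<theta> * l * e" by (simp add: algebra_simps)
  then have "l * (e - 1) \<le> l * (\<theta> * l * e)" using l by (intro mult_left_mono) auto
  also have "\<dots> = \<theta> * (l ^ 2 * e ^ 1)" by (simp add: power2_eq_square)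
  also have "\<dots> \<le> \<theta> * (l ^ 4 * e ^ 4)"
    using l e theta_pos by (intro mult_left_mono mult_mono power_increasing) auto
  also have "\<dots> = \<theta> * exp_weight z ^ 4"
    by (simp add: exp_weight_def l_def e_def power_mult_distrib)
  finally show ?thesis by (simp add: l_def e_def)
qed

lemma step_modulus_mono: "\<zeta> \<le> \<xi> \<Longrightarrow> step_modulus \<zeta> \<le> step_modulus \<xi>"
  unfolding step_modulus_def using weight_bound_pos gap_square_bound_pos
  by (intro mult_left_mono) auto

end

locale cs_moment_flow =
  cs_moment \<kappa> \<phi> K L T \<alpha> M + cs_flow \<kappa> \<phi> K L T \<mu> \<Phi>
  for \<kappa> :: real and \<phi> :: "real \<Rightarrow> real" and K L T \<alpha> M :: real
    and \<mu> :: "real \<Rightarrow> ('a::euclidean_space \<times> 'a) measure" and \<Phi> :: "real \<Rightarrow> 'a \<times> 'a \<Rightarrow> 'a \<times> 'a" +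
  assumes initial_integrable:
      "integrable (\<mu> 0) (\<lambda>z. (norm (fst z))\<^sup>2 + exp (\<alpha> * norm (snd z)))"
    and initial_le: "(LINT z|\<mu> 0. (norm (fst z))\<^sup>2 + exp (\<alpha> * norm (snd z))) \<le> M"
begin

abbreviation initial_gauge :: "'a \<times> 'a \<Rightarrow> real" where
  "initial_gauge z \<equiv> (norm (fst z))\<^sup>2 + exp (\<alpha> * norm (snd z))"

text \<open>All moment bounds come from domination by an affine function of \<open>\<bar>x\<bar>\<^sup>2 + exp (\<alpha> \<bar>v\<bar>)\<close>.\<close>

lemma integral_le_initial_gauge:
  assumes f: "f \<in> borel_measurable borel"
    and le: "\<And>z. 0 \<le> f z" "\<And>z. f z \<le> a + b * initial_gauge z" and "0 \<le> b"
  shows "integrable (\<mu> 0) f" "(LINT z|\<mu> 0. f z) \<le> a + b * M"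
proof -
  have int: "integrable (\<mu> 0) (\<lambda>z. a + b * initial_gauge z)" using initial_integrable by simp
  show f_int: "integrable (\<mu> 0) f"
  proof (rule Bochner_Integration.integrable_bound[OF int])
    show "f \<in> borel_measurable (\<mu> 0)" using f by (simp cong: measurable_cong_sets add: sets_initial)
    show "AE z in \<mu> 0. norm (f z) \<le> norm (a + b * initial_gauge z)"
      using le by (intro AE_I2) (metis abs_of_nonneg order_trans real_norm_def)
  qed
  have "(LINT z|\<mu> 0. f z) \<le> (LINT z|\<mu> 0. a + b * initial_gauge z)"
    by (rule integral_mono[OF f_int int]) (rule le)
  also have "\<dots> = a + b * (LINT z|\<mu> 0. initial_gauge z)" using initial_integrable by (simp add: prob_space)
  also have "\<dots> \<le> a + b * M" using initial_le \<open>0 \<le> b\<close> by (intro add_left_mono mult_left_mono) auto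
  finally show "(LINT z|\<mu> 0. f z) \<le> a + b * M" .
qed

lemma velocity_le_initial_gauge: "norm (snd z) \<le> 1 / \<alpha> * exp (\<alpha> * norm (snd z))"
proof -
  have "\<alpha> * norm (snd z) \<le> exp (\<alpha> * norm (snd z))"
    using exp_ge_add_one_self[of "\<alpha> * norm (snd z)"] by linarith
  then show ?thesis using alpha_pos by (simp add: field_simps)
qed

lemma moment_0_le: "moment 0 \<le> first_bound"
proof -
  have "norm z \<le> 1 + (1 + 1 / \<alpha>) * initial_gauge z" for z :: "'a \<times> 'a"
  proof -
    have "norm z \<le> norm (fst z) + norm (snd z)" using norm_Pair_le[of "fst z" "snd z"] by simp
    moreover have "norm (fst z) \<le> 1 + (norm (fst z))\<^sup>2"
    proof -
      have "2 * norm (fst z) \<le> (norm (fst z))\<^sup>2 + 1"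
        using sum_squares_bound[of "norm (fst z)" 1] by simp
      then show ?thesis using norm_ge_zero[of "fst z"] by linarith
    qed
    moreover have "(1 + 1 / \<alpha>) * initial_gauge z = (norm (fst z))\<^sup>2 + exp (\<alpha> * norm (snd z))
        + 1 / \<alpha> * (norm (fst z))\<^sup>2 + 1 / \<alpha> * exp (\<alpha> * norm (snd z))"
      by (simp add: distrib_left distrib_right)
    moreover have "0 \<le> 1 / \<alpha> * (norm (fst z))\<^sup>2" using alpha_pos by simp
    ultimately show ?thesis using velocity_le_initial_gauge[of z] exp_gt_zero[of "\<alpha> * norm (snd z)"] by linarith
  qed
  then have "(LINT z|\<mu> 0. norm z) \<le> 1 + (1 + 1 / \<alpha>) * M"
    using alpha_pos by (intro integral_le_initial_gauge(2)) auto
  then show ?thesis by (simp add: moment_def flow_0 first_bound_def distrib_right)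
qed

lemma moment_bound_le: "moment_bound \<le> flow_bound"
  unfolding moment_bound_def flow_bound_def using moment_0_le by (intro mult_left_mono) auto

lemma velocity_le_weight:
  assumes "t \<in> {0..<T}"
  shows "norm (snd (\<Phi> t z)) \<le> velocity_factor * weight z"
proof -
  have "norm (snd (\<Phi> t z)) \<le> (norm (snd z) + flow_bound) * exp (speed * T)"
    by (rule norm_velocity_le[OF assms moment_bound_le])
  also have "norm (snd z) + flow_bound \<le> (1 + flow_bound) * weight z"
    using flow_bound_pos by (simp add: weight_def algebra_simps)
  finally show ?thesis by (simp add: velocity_factor_def mult_ac)
qed

lemma second_moment:
  shows "integrable (\<mu> 0) (\<lambda>z. (norm z)\<^sup>2)" "(LINT z|\<mu> 0. (norm z)\<^sup>2) \<le> second_bound"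
proof -
  have "(norm z)\<^sup>2 \<le> 0 + (1 + (2 / \<alpha>)\<^sup>2) * initial_gauge z" for z :: "'a \<times> 'a"
  proof -
    have "(\<alpha> * norm (snd z)) ^ 2 \<le> real 2 ^ 2 * exp (\<alpha> * norm (snd z))"
      using alpha_pos by (intro power_le_exp) auto
    then have "(norm (snd z))\<^sup>2 \<le> (2 / \<alpha>)\<^sup>2 * exp (\<alpha> * norm (snd z))"
      using alpha_pos by (simp add: power_mult_distrib power_divide field_simps)
    moreover have "(norm z)\<^sup>2 = (norm (fst z))\<^sup>2 + (norm (snd z))\<^sup>2"
      by (simp add: norm_prod_def)
    moreover have "(1 + (2 / \<alpha>)\<^sup>2) * initial_gauge z = (norm (fst z))\<^sup>2 + exp (\<alpha> * norm (snd z))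
        + (2 / \<alpha>)\<^sup>2 * (norm (fst z))\<^sup>2 + (2 / \<alpha>)\<^sup>2 * exp (\<alpha> * norm (snd z))"
      by (simp only: distrib_left distrib_right mult_1)
    moreover have "0 \<le> (2 / \<alpha>)\<^sup>2 * (norm (fst z))\<^sup>2" by simp
    ultimately show ?thesis using exp_gt_zero[of "\<alpha> * norm (snd z)"] by linarith
  qed
  note * = integral_le_initial_gauge[OF _ _ this]
  show "integrable (\<mu> 0) (\<lambda>z. (norm z)\<^sup>2)" by (rule *(1)) auto
  have "(LINT z|\<mu> 0. (norm z)\<^sup>2) \<le> 0 + (1 + (2 / \<alpha>)\<^sup>2) * M" by (rule *(2)) auto
  then show "(LINT z|\<mu> 0. (norm z)\<^sup>2) \<le> second_bound" by (simp add: second_bound_def distrib_right)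
qed

lemma exp_weight_moment:
  shows "integrable (\<mu> 0) (\<lambda>z. exp_weight z ^ 4)" "(LINT z|\<mu> 0. exp_weight z ^ 4) \<le> weight_bound"
proof -
  have "exp_weight z ^ 4 \<le> 0 + ((8 / \<alpha>) ^ 4 * exp \<alpha>) * initial_gauge z" for z :: "'a \<times> 'a"
  proof -
    have "(8 / \<alpha>) ^ 4 * exp \<alpha> * exp (\<alpha> * norm (snd z)) \<le> (8 / \<alpha>) ^ 4 * exp \<alpha> * initial_gauge z"
      using alpha_pos by (intro mult_left_mono) auto
    then show ?thesis using exp_weight_power_le[of z] by linarith
  qed
  note * = integral_le_initial_gauge[OF _ _ this]
  show "integrable (\<mu> 0) (\<lambda>z. exp_weight z ^ 4)"
    by (rule *(1)) (use alpha_pos in auto)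
  have "(LINT z|\<mu> 0. exp_weight z ^ 4) \<le> 0 + ((8 / \<alpha>) ^ 4 * exp \<alpha>) * M"
    by (rule *(2)) (use alpha_pos in auto)
  then show "(LINT z|\<mu> 0. exp_weight z ^ 4) \<le> weight_bound" by (simp add: weight_bound_def)
qed

lemma weight_mean:
  shows "integrable (\<mu> 0) weight" "(LINT z|\<mu> 0. weight z) \<le> 1 + M / \<alpha>"
proof -
  have "weight z \<le> 1 + 1 / \<alpha> * initial_gauge z" for z :: "'a \<times> 'a"
    using velocity_le_initial_gauge[of z] alpha_pos by (simp add: weight_def distrib_left add_increasing)
  note * = integral_le_initial_gauge[OF _ _ this]
  have nonneg: "0 \<le> weight z" for z :: "'a \<times> 'a" using weight_ge_1[of z] by simp
  show "integrable (\<mu> 0) weight" by (rule *(1)) (use alpha_pos nonneg in auto)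
  have "(LINT z|\<mu> 0. weight z) \<le> 1 + 1 / \<alpha> * M" by (rule *(2)) (use alpha_pos nonneg in auto)
  then show "(LINT z|\<mu> 0. weight z) \<le> 1 + M / \<alpha>" by simp
qed

end

section \<open>Stability for a coupled pair of flows\<close>

locale cs_coupling =
  cs_moment \<kappa> \<phi> K L T \<alpha> M +
  one: cs_moment_flow \<kappa> \<phi> K L T \<alpha> M \<mu> \<Phi> + two: cs_moment_flow \<kappa> \<phi> K L T \<alpha> M \<nu> \<Psi>
  for \<kappa> :: real and \<phi> :: "real \<Rightarrow> real" and K L T \<alpha> M :: real
    and \<mu> \<nu> :: "real \<Rightarrow> ('a::euclidean_space \<times> 'a) measure"
    and \<Phi> \<Psi> :: "real \<Rightarrow> 'a \<times> 'a \<Rightarrow> 'a \<times> 'a" +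
  fixes \<gamma> :: "(('a \<times> 'a) \<times> ('a \<times> 'a)) measure"
  assumes coupling: "\<gamma> \<in> couplings (\<mu> 0) (\<nu> 0)"
begin

lemma sets_coupling [measurable_cong]: "sets \<gamma> = sets (borel \<Otimes>\<^sub>M borel)"
  using coupling unfolding couplings_def
  by (simp add: sets_pair_measure_cong[OF one.sets_initial two.sets_initial])

lemma marginals:
  "distr \<gamma> (\<mu> 0) fst = \<mu> 0" "distr \<gamma> (\<nu> 0) snd = \<nu> 0"
  using coupling by (simp_all add: couplings_def)

lemma fst_measurable [measurable]: "fst \<in> \<gamma> \<rightarrow>\<^sub>M \<mu> 0"
  by (simp cong: measurable_cong_sets add: sets_coupling one.sets_initial)

lemma snd_measurable [measurable]: "snd \<in> \<gamma> \<rightarrow>\<^sub>M \<nu> 0"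
  by (simp cong: measurable_cong_sets add: sets_coupling two.sets_initial)

lemma prob_space_coupling: "prob_space \<gamma>"
proof (rule prob_spaceI)
  have "emeasure (distr \<gamma> (\<mu> 0) fst) (space (\<mu> 0)) = emeasure \<gamma> (space \<gamma>)"
    by (subst emeasure_distr[OF fst_measurable]) (auto intro!: arg_cong[where f = "emeasure \<gamma>"]
        dest: measurable_space[OF fst_measurable])
  then show "emeasure \<gamma> (space \<gamma>) = 1"
    unfolding marginals using one.emeasure_space_1 by simp
qed

lemma integral_fst:
  fixes f :: "'a \<times> 'a \<Rightarrow> 'b::{banach, second_countable_topology}"
  assumes "integrable (\<mu> 0) f"
  shows "integrable \<gamma> (\<lambda>p. f (fst p))" "(LINT p|\<gamma>. f (fst p)) = (LINT z|\<mu> 0. f z)"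
proof -
  have "f \<in> borel_measurable (\<mu> 0)" using assms by simp
  then show "integrable \<gamma> (\<lambda>p. f (fst p))" "(LINT p|\<gamma>. f (fst p)) = (LINT z|\<mu> 0. f z)"
    using integrable_distr_eq[OF fst_measurable, of f] integral_distr[OF fst_measurable, of f]
      assms unfolding marginals by auto
qed

lemma integral_snd:
  fixes f :: "'a \<times> 'a \<Rightarrow> 'b::{banach, second_countable_topology}"
  assumes "integrable (\<nu> 0) f"
  shows "integrable \<gamma> (\<lambda>p. f (snd p))" "(LINT p|\<gamma>. f (snd p)) = (LINT z|\<nu> 0. f z)"
proof -
  have "f \<in> borel_measurable (\<nu> 0)" using assms by simp
  then show "integrable \<gamma> (\<lambda>p. f (snd p))" "(LINT p|\<gamma>. f (snd p)) = (LINT z|\<nu> 0. f z)"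
    using integrable_distr_eq[OF snd_measurable, of f] integral_distr[OF snd_measurable, of f]
      assms unfolding marginals by auto
qed

definition gap :: "real \<Rightarrow> ('a \<times> 'a) \<times> ('a \<times> 'a) \<Rightarrow> real" where
  "gap t p = norm (\<Phi> t (fst p) - \<Psi> t (snd p))"

abbreviation cost :: "real \<Rightarrow> real" where
  "cost t \<equiv> LINT p|\<gamma>. gap t p"

lemma gap_nonneg: "0 \<le> gap t p"
  by (simp add: gap_def)

lemma flows_measurable:
  assumes "t \<in> {0..<T}"
  shows "(\<lambda>p. \<Phi> t (fst p)) \<in> \<gamma> \<rightarrow>\<^sub>M borel" "(\<lambda>p. \<Psi> t (snd p)) \<in> \<gamma> \<rightarrow>\<^sub>M borel"
  using measurable_compose[OF fst_measurable one.flow_measurable_initial[OF assms]]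
    measurable_compose[OF snd_measurable two.flow_measurable_initial[OF assms]] by auto

lemma gap_measurable: "t \<in> {0..<T} \<Longrightarrow> gap t \<in> borel_measurable \<gamma>"
  unfolding gap_def[abs_def] using flows_measurable by measurable

lemma gap_le:
  assumes "t \<in> {0..<T}"
  shows "gap t p \<le> exp ((1 + speed) * T) * (norm (fst p) + norm (snd p) + 2 * flow_bound)"
proof -
  have "gap t p \<le> norm (\<Phi> t (fst p)) + norm (\<Psi> t (snd p))"
    unfolding gap_def by (rule norm_triangle_ineq4)
  also have "\<dots> \<le> (norm (fst p) + flow_bound) * exp ((1 + speed) * T)
      + (norm (snd p) + flow_bound) * exp ((1 + speed) * T)"
    by (intro add_mono one.norm_flow_le two.norm_flow_le assms one.moment_bound_le two.moment_bound_le)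
  finally show ?thesis by (simp add: algebra_simps)
qed

lemma gap_square:
  assumes "t \<in> {0..<T}"
  shows "integrable \<gamma> (\<lambda>p. (gap t p)\<^sup>2)" "(LINT p|\<gamma>. (gap t p)\<^sup>2) \<le> gap_square_bound"
proof -
  interpret \<gamma>: prob_space \<gamma> by (rule prob_space_coupling)
  let ?E = "(exp ((1 + speed) * T))\<^sup>2"
  let ?b = "\<lambda>p. 3 * ?E * ((norm (fst p))\<^sup>2 + (norm (snd p))\<^sup>2 + (2 * flow_bound)\<^sup>2)"
  have sq: "(a + b + c)\<^sup>2 \<le> 3 * (a\<^sup>2 + b\<^sup>2 + c\<^sup>2)" for a b c :: real
    using sum_squares_bound[of a b] sum_squares_bound[of a c] sum_squares_bound[of b c]
    by (simp add: power2_eq_square algebra_simps)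
  have le: "(gap t p)\<^sup>2 \<le> ?b p" for p
  proof -
    have "(gap t p)\<^sup>2 \<le> (exp ((1 + speed) * T) * (norm (fst p) + norm (snd p) + 2 * flow_bound))\<^sup>2"
      by (intro power_mono gap_le gap_nonneg assms)
    also have "\<dots> = ?E * (norm (fst p) + norm (snd p) + 2 * flow_bound)\<^sup>2"
      by (simp add: power_mult_distrib)
    also have "\<dots> \<le> ?E * (3 * ((norm (fst p))\<^sup>2 + (norm (snd p))\<^sup>2 + (2 * flow_bound)\<^sup>2))"
      by (intro mult_left_mono sq) simp
    finally show ?thesis by (simp only: mult_ac)
  qed
  note m1 = integral_fst[OF one.second_moment(1)] note m2 = integral_snd[OF two.second_moment(1)]
  have bi: "integrable \<gamma> ?b"
    using m1(1) m2(1) by (intro integrable_mult_right Bochner_Integration.integrable_add) auto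
  show gi: "integrable \<gamma> (\<lambda>p. (gap t p)\<^sup>2)"
  proof (rule Bochner_Integration.integrable_bound[OF bi])
    show "(\<lambda>p. (gap t p)\<^sup>2) \<in> borel_measurable \<gamma>" using gap_measurable[OF assms] by measurable
    show "AE p in \<gamma>. norm ((gap t p)\<^sup>2) \<le> norm (?b p)"
      using le by (intro AE_I2) (metis abs_of_nonneg order_trans real_norm_def zero_le_power2)
  qed
  have "(LINT p|\<gamma>. (gap t p)\<^sup>2) \<le> (LINT p|\<gamma>. ?b p)"
    by (rule integral_mono[OF gi bi le])
  also have "\<dots> = 3 * ?E * ((LINT z|\<mu> 0. (norm z)\<^sup>2) + (LINT z|\<nu> 0. (norm z)\<^sup>2) + (2 * flow_bound)\<^sup>2)"
    using m1 m2 by (simp add: \<gamma>.prob_space)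
  also have "\<dots> \<le> 3 * ?E * (second_bound + second_bound + (2 * flow_bound)\<^sup>2)"
    by (intro mult_left_mono add_mono one.second_moment two.second_moment) auto
  finally show "(LINT p|\<gamma>. (gap t p)\<^sup>2) \<le> gap_square_bound"
    by (simp add: gap_square_bound_def)
qed

lemma exp_weight_coupling:
  "integrable \<gamma> (\<lambda>p. exp_weight (snd p) ^ 4)" "(LINT p|\<gamma>. exp_weight (snd p) ^ 4) \<le> weight_bound"
  "(\<lambda>p. exp_weight (snd p)) \<in> borel_measurable \<gamma>" "(\<lambda>p. weight (snd p)) \<in> borel_measurable \<gamma>"
  using integral_snd[OF two.exp_weight_moment(1)] two.exp_weight_moment(2) by auto

lemma gap_integrable:
  assumes "t \<in> {0..<T}" shows "integrable \<gamma> (gap t)"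
proof -
  interpret \<gamma>: prob_space \<gamma> by (rule prob_space_coupling)
  show ?thesis
  proof (rule Bochner_Integration.integrable_bound)
    show "integrable \<gamma> (\<lambda>p. 1 + (gap t p)\<^sup>2)" using gap_square(1)[OF assms] by simp
    have "gap t p \<le> 1 + (gap t p)\<^sup>2" for p
      using sum_squares_bound[of "gap t p" 1] gap_nonneg[of t p] by (simp add: power2_eq_square)
    then show "AE p in \<gamma>. norm (gap t p) \<le> norm (1 + (gap t p)\<^sup>2)"
      using gap_nonneg by (intro AE_I2) simp
  qed (rule gap_measurable[OF assms])
qed

lemma exp_weight_gap:
  assumes "t \<in> {0..<T}"
  shows "integrable \<gamma> (\<lambda>p. exp_weight (snd p) * gap t p)"
    and "2 * (LINT p|\<gamma>. exp_weight (snd p) * gap t p) \<le> step_modulus (cost t)"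
proof -
  have nonneg: "0 \<le> exp_weight z" for z :: "'a \<times> 'a" using exp_weight_ge_1[of z] by simp
  note * = expectation_mult_le_sqrt[OF exp_weight_coupling(3,1,2) gap_integrable[OF assms]
      gap_square[OF assms] nonneg gap_nonneg]
  show "integrable \<gamma> (\<lambda>p. exp_weight (snd p) * gap t p)" by (rule *(1))
  show "2 * (LINT p|\<gamma>. exp_weight (snd p) * gap t p) \<le> step_modulus (cost t)"
    using *(2) by (simp add: step_modulus_def)
qed

lemma weight_gap_integrable:
  assumes "t \<in> {0..<T}"
  shows "integrable \<gamma> (\<lambda>p. weight (snd p) * gap t p)"
proof (rule Bochner_Integration.integrable_bound[OF exp_weight_gap(1)[OF assms]])
  show "(\<lambda>p. weight (snd p) * gap t p) \<in> borel_measurable \<gamma>"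
    using exp_weight_coupling(4) gap_measurable[OF assms] by measurable
  show "AE p in \<gamma>. norm (weight (snd p) * gap t p) \<le> norm (exp_weight (snd p) * gap t p)"
  proof (rule AE_I2)
    fix p
    have "0 \<le> weight (snd p) * gap t p"
      using weight_ge_1[of "snd p"] gap_nonneg[of t p] by simp
    moreover have "weight (snd p) * gap t p \<le> exp_weight (snd p) * gap t p"
      by (rule mult_right_mono[OF weight_le_exp_weight gap_nonneg])
    ultimately show "norm (weight (snd p) * gap t p) \<le> norm (exp_weight (snd p) * gap t p)"
      unfolding real_norm_def by (metis abs_ge_self abs_of_nonneg order_trans)
  qed
qed

lemma cost_le_weighted:
  assumes "t \<in> {0..<T}" shows "cost t \<le> (LINT p|\<gamma>. weight (snd p) * gap t p)"
proof (rule integral_mono[OF gap_integrable[OF assms] weight_gap_integrable[OF assms]])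
  show "gap t p \<le> weight (snd p) * gap t p" for p
    using mult_right_mono[OF weight_ge_1[of "snd p"] gap_nonneg[of t p]] by simp
qed

text \<open>
  Integrating the Lipschitz estimate of the kernel over the coupling produces the products \<open>D \<lambda>\<close>, \<open>D \<integral> \<lambda>\<close>,
  \<open>\<lambda> \<integral> D\<close> and \<open>\<integral> \<lambda> D\<close>. The last one is the reason for working with the weighted cost: it cannot be controlled by
  the cost itself. As \<open>\<lambda> \<ge> 1\<close>, all four are at most a constant times \<open>\<lambda> (D + S)\<close>.
\<close>

lemma alignment_difference:
  assumes t: "t \<in> {0..<T}" and S: "(LINT p|\<gamma>. weight (snd p) * gap t p) \<le> S"
  shows "norm (alignment \<kappa> \<phi> (\<mu> t) (fst (\<Phi> t (fst p))) (snd (\<Phi> t (fst p)))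
             - alignment \<kappa> \<phi> (\<nu> t) (fst (\<Psi> t (snd p))) (snd (\<Psi> t (snd p))))
    \<le> (rate - 1) * weight (snd p) * (gap t p + S)"
proof -
  interpret \<gamma>: prob_space \<gamma> by (rule prob_space_coupling)
  define x v x' v' where xv: "x = fst (\<Phi> t (fst p))" "v = snd (\<Phi> t (fst p))"
    "x' = fst (\<Psi> t (snd p))" "v' = snd (\<Psi> t (snd p))"
  define D l where Dl: "D = gap t p" "l = weight (snd p)"
  define k where "k q = alignment_kernel \<phi> x v (\<Phi> t (fst q))" for q :: "('a \<times> 'a) \<times> ('a \<times> 'a)"
  define k' where "k' q = alignment_kernel \<phi> x' v' (\<Psi> t (snd q))" for q :: "('a \<times> 'a) \<times> ('a \<times> 'a)"
  note k1 = integral_fst[OF one.kernel_integrable[OF t, of x v], folded k_def]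
  note k2 = integral_snd[OF two.kernel_integrable[OF t, of x' v'], folded k'_def]
  let ?b = "\<lambda>q. K * (D + gap t q)
      + L * velocity_factor * (D * l + D * weight (snd q) + l * gap t q + weight (snd q) * gap t q)"
  have D0: "0 \<le> D" and l1: "1 \<le> l" by (simp_all add: Dl gap_nonneg weight_ge_1)
  have comp: "norm (fst a - fst b) \<le> norm (a - b)" "norm (snd a - snd b) \<le> norm (a - b)"
    for a b :: "'a \<times> 'a"
    using norm_components_le[of "a - b"] by simp_all
  have pointwise: "norm (k q - k' q) \<le> ?b q" for q
  proof -
    define y w y' w' where yw: "y = fst (\<Phi> t (fst q))" "w = snd (\<Phi> t (fst q))"
      "y' = fst (\<Psi> t (snd q))" "w' = snd (\<Psi> t (snd q))"
    have d: "norm (x - x') \<le> D" "norm (v - v') \<le> D" "norm (y - y') \<le> gap t q" "norm (w - w') \<le> gap t q"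
      unfolding xv yw Dl gap_def by (rule comp)+
    have vel: "norm v' \<le> velocity_factor * l" "norm w' \<le> velocity_factor * weight (snd q)"
      unfolding xv yw Dl by (rule two.velocity_le_weight[OF t])+
    have "norm (k q - k' q) \<le> K * (norm (v - v') + norm (w - w'))
        + L * (norm (x - x') + norm (y - y')) * (norm v' + norm w')"
      using kernel_lipschitz[of x v y w x' v' y' w'] by (simp add: k_def k'_def yw)
    also have "\<dots> \<le> K * (D + gap t q)
        + L * (D + gap t q) * (velocity_factor * l + velocity_factor * weight (snd q))"
      using d vel K_nonneg L_nonneg gap_nonneg[of t q] D0
      by (intro add_mono mult_mono mult_left_mono) auto
    also have "\<dots> = ?b q" by (simp add: algebra_simps)
    finally show ?thesis .
  qed
  note gi = gap_integrable[OF t] note wi = integral_snd[OF two.weight_mean(1)]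
  note wgi = weight_gap_integrable[OF t]
  have bi: "integrable \<gamma> ?b" using gi wi(1) wgi by simp
  have ki: "integrable \<gamma> (\<lambda>q. k q - k' q)" using k1(1) k2(1) by simp
  have "norm (LINT q|\<gamma>. k q - k' q) \<le> (LINT q|\<gamma>. norm (k q - k' q))"
    by (rule integral_norm_bound)
  also have "\<dots> \<le> (LINT q|\<gamma>. ?b q)"
    by (rule integral_mono[OF integrable_norm[OF ki] bi pointwise])
  also have "\<dots> = K * (D + cost t) + L * velocity_factor *
      (D * l + D * (LINT z|\<nu> 0. weight z) + l * cost t + (LINT q|\<gamma>. weight (snd q) * gap t q))"
    using gi wi wgi by (simp add: \<gamma>.prob_space)
  also have "\<dots> \<le> K * (l * (D + S)) + L * velocity_factor * ((3 + M / \<alpha>) * (l * (D + S)))"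
  proof -
    have c: "cost t \<le> S" using cost_le_weighted[OF t] S by linarith
    have c0: "0 \<le> cost t" by (intro Bochner_Integration.integral_nonneg gap_nonneg)
    have Dlk: "D \<le> l * D" "S \<le> l * S" using l1 D0 c c0 by (simp_all add: mult_le_cancel_right1)
    have sum: "D + cost t \<le> l * (D + S)" unfolding distrib_left using Dlk c by linarith
    have W0: "0 \<le> (LINT z|\<nu> 0. weight z)"
      by (intro Bochner_Integration.integral_nonneg order_trans[OF zero_le_one weight_ge_1])
    have 1: "D * (LINT z|\<nu> 0. weight z) \<le> (l * D) * (1 + M / \<alpha>)"
      using Dlk(1) two.weight_mean(2) D0 l1 W0 by (intro mult_mono) auto
    have 2: "l * cost t \<le> l * S" using c l1 by (intro mult_left_mono) auto
    have 3: "0 \<le> M / \<alpha> * (l * S)" "0 \<le> l * D" "0 \<le> l * S"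
      using M_pos alpha_pos l1 c c0 D0 by simp_all
    have "(3 + M / \<alpha>) * (l * (D + S))
        = (l * D) * (1 + M / \<alpha>) + 2 * (l * D) + 3 * (l * S) + M / \<alpha> * (l * S)"
      by (simp only: distrib_left distrib_right mult_1_right mult.commute[of "M / \<alpha>"])
    then have "D * l + D * (LINT z|\<nu> 0. weight z) + l * cost t + (LINT q|\<gamma>. weight (snd q) * gap t q)
        \<le> (3 + M / \<alpha>) * (l * (D + S))"
      unfolding mult.commute[of D l] using S Dlk 1 2 3 by linarith
    note this sum
    then show ?thesis
      using K_nonneg L_nonneg velocity_factor_pos by (intro add_mono mult_left_mono) auto
  qed
  finally have "\<kappa> * norm (LINT q|\<gamma>. k q - k' q)
      \<le> \<kappa> * (K * (l * (D + S)) + L * velocity_factor * ((3 + M / \<alpha>) * (l * (D + S))))"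
    using kappa_pos by (intro mult_left_mono) auto
  also have "\<dots> = (rate - 1) * l * (D + S)"
    by (simp add: rate_def speed_def algebra_simps add_divide_distrib)
  finally have "norm (\<kappa> *\<^sub>R (LINT q|\<gamma>. k q - k' q)) \<le> (rate - 1) * l * (D + S)"
    using kappa_pos by simp
  moreover have "alignment \<kappa> \<phi> (\<mu> t) x v - alignment \<kappa> \<phi> (\<nu> t) x' v'
      = - (\<kappa> *\<^sub>R (LINT q|\<gamma>. k q - k' q))"
    unfolding one.alignment_eq[OF t] two.alignment_eq[OF t]
    using k1 k2 by (simp add: scaleR_right_diff_distrib)
  ultimately show ?thesis unfolding xv Dl by simp
qed

lemma gap_growth:
  assumes "0 \<le> s" "s \<le> t" "t < T"
    and S: "\<And>r. r \<in> {s..t} \<Longrightarrow> (LINT p|\<gamma>. weight (snd p) * gap r p) \<le> S"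
  shows "gap t p + S \<le> (gap s p + S) * exp (rate * weight (snd p) * (t - s))"
  unfolding gap_def
proof (rule norm_gronwall[OF \<open>s \<le> t\<close>, where U = "\<lambda>r. \<Phi> r (fst p) - \<Psi> r (snd p)"])
  show "continuous_on {s..t} (\<lambda>r. \<Phi> r (fst p) - \<Psi> r (snd p))"
    by (intro continuous_on_diff continuous_on_subset[OF one.continuous_on_flow]
        continuous_on_subset[OF two.continuous_on_flow]) (use assms in auto)
  have weight0: "0 \<le> weight z" for z :: "'a \<times> 'a" using weight_ge_1[of z] by simp
  have "0 \<le> (LINT p|\<gamma>. weight (snd p) * gap s p)"
    by (intro Bochner_Integration.integral_nonneg mult_nonneg_nonneg gap_nonneg weight0)
  then show S0: "0 \<le> S" using S[of s] \<open>s \<le> t\<close> by auto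
  show "0 \<le> rate * weight (snd p)" using rate_pos weight0 by simp
  fix r assume r: "s < r" "r < t"
  let ?a = "alignment \<kappa> \<phi> (\<mu> r) (fst (\<Phi> r (fst p))) (snd (\<Phi> r (fst p)))"
  let ?a' = "alignment \<kappa> \<phi> (\<nu> r) (fst (\<Psi> r (snd p))) (snd (\<Psi> r (snd p)))"
  let ?V = "(snd (\<Phi> r (fst p)) - snd (\<Psi> r (snd p)), ?a - ?a')"
  have "((\<lambda>r. \<Phi> r (fst p) - \<Psi> r (snd p)) has_vector_derivative
      (snd (\<Phi> r (fst p)), ?a) - (snd (\<Psi> r (snd p)), ?a')) (at r)"
    by (intro has_vector_derivative_diff one.flow_deriv_interior two.flow_deriv_interior)
      (use r assms in auto)
  then show "((\<lambda>r. \<Phi> r (fst p) - \<Psi> r (snd p)) has_vector_derivative ?V) (at r)" by simp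
  have D: "norm (\<Phi> r (fst p) - \<Psi> r (snd p)) = gap r p" by (simp add: gap_def)
  have "1 * (gap r p + S) \<le> weight (snd p) * (gap r p + S)"
    by (rule mult_right_mono[OF weight_ge_1]) (simp add: gap_nonneg S0)
  from order_trans[OF _ this] have "gap r p \<le> weight (snd p) * (gap r p + S)"
    by (simp add: S0)
  moreover have "norm (snd (\<Phi> r (fst p)) - snd (\<Psi> r (snd p))) \<le> gap r p"
    using norm_components_le(2)[of "\<Phi> r (fst p) - \<Psi> r (snd p)"] by (simp add: gap_def)
  moreover have "norm (?a - ?a') \<le> (rate - 1) * weight (snd p) * (gap r p + S)"
    by (rule alignment_difference) (use r assms in auto)
  moreover have "norm ?V \<le> norm (snd (\<Phi> r (fst p)) - snd (\<Psi> r (snd p))) + norm (?a - ?a')"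
    by (rule norm_Pair_le)
  ultimately have "norm ?V \<le> weight (snd p) * (gap r p + S) + (rate - 1) * weight (snd p) * (gap r p + S)"
    by linarith
  also have "\<dots> = rate * weight (snd p) * (gap r p + S)" by (simp add: algebra_simps)
  finally show "norm ?V \<le> rate * weight (snd p) * (norm (\<Phi> r (fst p) - \<Psi> r (snd p)) + S)"
    unfolding D .
qed

text \<open>
  Multiply the growth estimate by the weight and integrate. The part with the gap at time \<open>s\<close> is
  \<open>\<integral> exp_weight D s\<close>; the part with \<open>S\<close> has the coefficient \<open>\<integral> \<lambda> (exp (\<theta> \<lambda>) - 1) \<le> 1 / 2\<close>, which is what the absorption
  lemma requires. The second and fourth moments make the weighted cost bounded in time, so that there is a
  finite supremum to absorb.
\<close>

lemma cost_step:
  assumes "0 \<le> s" "s \<le> t" "t < T" "t - s \<le> stability_step"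
  shows "cost t \<le> step_modulus (cost s)"
proof -
  interpret \<gamma>: prob_space \<gamma> by (rule prob_space_coupling)
  let ?P = "\<lambda>r. LINT p|\<gamma>. weight (snd p) * gap r p"
  let ?H = "LINT p|\<gamma>. exp_weight (snd p) * gap s p"
  have weight0: "0 \<le> weight z" for z :: "'a \<times> 'a" using weight_ge_1[of z] by simp
  have sT: "s \<in> {0..<T}" using assms by auto
  have "?P t \<le> 2 * ?H"
  proof (rule bounded_absorption[where J = "{s..t}" and g = ?P and i = t and B = ?H])
    show "bdd_above (?P ` {s..t})"
    proof (rule bdd_aboveI2)
      fix r assume "r \<in> {s..t}"
      then have r: "r \<in> {0..<T}" using assms by auto
      have "?P r \<le> (LINT p|\<gamma>. (exp_weight (snd p) ^ 4 + (gap r p)\<^sup>2) / 1)"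
      proof (rule integral_mono[OF weight_gap_integrable[OF r]])
        show "integrable \<gamma> (\<lambda>p. (exp_weight (snd p) ^ 4 + (gap r p)\<^sup>2) / 1)"
          using exp_weight_coupling(1) gap_square(1)[OF r] by simp
        fix p :: "('a \<times> 'a) \<times> ('a \<times> 'a)"
        have "2 * weight (snd p) * gap r p \<le> (weight (snd p))\<^sup>2 + (gap r p)\<^sup>2"
          by (rule sum_squares_bound)
        moreover have "0 \<le> weight (snd p) * gap r p" by (simp add: weight0 gap_nonneg)
        moreover have "(weight (snd p))\<^sup>2 \<le> exp_weight (snd p) ^ 4"
        proof -
          have "(weight (snd p))\<^sup>2 \<le> (exp_weight (snd p))\<^sup>2"
            by (intro power_mono weight_le_exp_weight weight0)
          also have "\<dots> \<le> exp_weight (snd p) ^ 4"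
            by (rule power_increasing) (auto simp: exp_weight_ge_1)
          finally show ?thesis .
        qed
        ultimately show "weight (snd p) * gap r p \<le> (exp_weight (snd p) ^ 4 + (gap r p)\<^sup>2) / 1"
          by simp
      qed
      also have "\<dots> \<le> weight_bound + gap_square_bound"
        using exp_weight_coupling(1,2) gap_square[OF r] by simp
      finally show "?P r \<le> weight_bound + gap_square_bound" .
    qed
  next
    show "t \<in> {s..t}" using assms by simp
  next
    fix S r assume S: "\<And>j. j \<in> {s..t} \<Longrightarrow> ?P j \<le> S" and r: "r \<in> {s..t}"
    have rT: "r \<in> {0..<T}" using r assms by auto
    have "0 \<le> ?P r" by (intro Bochner_Integration.integral_nonneg mult_nonneg_nonneg gap_nonneg weight0)
    then have "0 \<le> S" using S[OF r] by linarith
    have pointwise: "weight (snd p) * gap r p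
        \<le> exp_weight (snd p) * gap s p + S * (\<theta> * exp_weight (snd p) ^ 4)" for p
    proof -
      have "rate * (r - s) \<le> rate * stability_step"
        using r assms rate_pos by (intro mult_left_mono) auto
      also have "\<dots> = \<theta>" using rate_pos by (simp add: stability_step_def)
      finally have "weight (snd p) * (rate * (r - s)) \<le> weight (snd p) * \<theta>"
        by (rule mult_left_mono) (rule weight0)
      then have e: "exp (rate * weight (snd p) * (r - s)) \<le> exp (\<theta> * weight (snd p))"
        by (simp add: mult_ac)
      have "gap r p + S \<le> (gap s p + S) * exp (rate * weight (snd p) * (r - s))"
        by (rule gap_growth) (use r assms S in auto)
      also have "\<dots> \<le> (gap s p + S) * exp (\<theta> * weight (snd p))"
        using e gap_nonneg[of s p] \<open>0 \<le> S\<close> by (intro mult_left_mono) auto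
      finally have "weight (snd p) * (gap r p + S)
          \<le> weight (snd p) * ((gap s p + S) * exp (\<theta> * weight (snd p)))"
        by (rule mult_left_mono) (rule weight0)
      then have "weight (snd p) * gap r p \<le> exp_weight (snd p) * gap s p
          + S * (weight (snd p) * (exp (\<theta> * weight (snd p)) - 1))"
        by (simp add: exp_weight_def algebra_simps)
      also have "\<dots> \<le> exp_weight (snd p) * gap s p + S * (\<theta> * exp_weight (snd p) ^ 4)"
        using \<open>0 \<le> S\<close> by (intro add_left_mono mult_left_mono weight_exp_minus_one_le) auto
      finally show ?thesis .
    qed
    have "?P r \<le> (LINT p|\<gamma>. exp_weight (snd p) * gap s p + S * (\<theta> * exp_weight (snd p) ^ 4))"
      using exp_weight_gap(1)[OF sT] exp_weight_coupling(1)
      by (intro integral_mono[OF weight_gap_integrable[OF rT] _ pointwise]) auto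
    also have "\<dots> = ?H + S * (\<theta> * (LINT p|\<gamma>. exp_weight (snd p) ^ 4))"
      using exp_weight_gap(1)[OF sT] exp_weight_coupling(1) by simp
    also have "\<dots> \<le> ?H + S * (1 / 2)"
    proof -
      have "\<theta> * (LINT p|\<gamma>. exp_weight (snd p) ^ 4) \<le> \<theta> * weight_bound"
        using theta_pos exp_weight_coupling(2) by (intro mult_left_mono) auto
      then have "\<theta> * (LINT p|\<gamma>. exp_weight (snd p) ^ 4) \<le> 1 / 2" using theta_le(2) by linarith
      then show ?thesis using \<open>0 \<le> S\<close> by (intro add_left_mono mult_left_mono)
    qed
    finally show "?P r \<le> ?H + S / 2" by simp
  qed
  moreover have "cost t \<le> ?P t" by (rule cost_le_weighted) (use assms in auto)
  moreover have "2 * ?H \<le> step_modulus (cost s)" by (rule exp_weight_gap(2)[OF sT])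
  ultimately show ?thesis by linarith
qed

text \<open>
  The interval \<open>[0, t]\<close> is always cut into the same number of equal steps, whatever \<open>t\<close> is, so that one
  modulus serves all times.
\<close>

lemma cost_le_modulus:
  assumes t: "t \<in> {0..<T}"
  shows "cost t \<le> modulus (cost 0)"
proof -
  define n where "n = nat \<lceil>T / stability_step\<rceil>"
  have "T / stability_step \<le> real n" unfolding n_def by (rule real_nat_ceiling_ge)
  then have n: "T \<le> real n * stability_step" using stability_step_pos by (simp add: field_simps)
  then have "0 < real n" using T_pos stability_step_pos
    by (metis mult_zero_left not_less_iff_gr_or_eq of_nat_0_le_iff order_le_less order_less_le_trans)
  define h where "h = t / real n"
  have "t \<le> real n * stability_step" using n t by simp
  then have h: "0 \<le> h" "h \<le> stability_step" "real n * h = t"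
    using t \<open>0 < real n\<close> by (auto simp: h_def field_simps)
  have "j \<le> n \<Longrightarrow> cost (real j * h) \<le> (step_modulus ^^ j) (cost 0)" for j
  proof (induction j)
    case 0
    then show ?case by simp
  next
    case (Suc j)
    have "real (Suc j) * h \<le> t"
      using Suc.prems h(1) unfolding h(3)[symmetric] by (intro mult_right_mono) auto
    then have "cost (real (Suc j) * h) \<le> step_modulus (cost (real j * h))"
      using h t by (intro cost_step) (auto simp: algebra_simps)
    also have "\<dots> \<le> step_modulus ((step_modulus ^^ j) (cost 0))"
      using Suc by (intro step_modulus_mono) simp
    finally show ?case by simp
  qed
  from this[of n] show ?thesis by (simp add: h(3) modulus_def flip: n_def)
qed

text \<open>
  The flow maps are passed as arguments so that the lemma applies to the limit flows at the final time as well.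
\<close>

lemma W1_le_cost:
  assumes F: "F \<in> borel \<rightarrow>\<^sub>M borel" "distr (\<mu> 0) borel F = \<mu> t"
    and G: "G \<in> borel \<rightarrow>\<^sub>M borel" "distr (\<nu> 0) borel G = \<nu> t"
  shows "W1 (\<mu> t) (\<nu> t) \<le> (\<integral>\<^sup>+p. ennreal (norm (F (fst p) - G (snd p))) \<partial>\<gamma>)"
proof -
  let ?h = "\<lambda>p. (F (fst p), G (snd p))"
  have Fm: "F \<in> \<mu> 0 \<rightarrow>\<^sub>M borel" and Gm: "G \<in> \<nu> 0 \<rightarrow>\<^sub>M borel"
    using F(1) G(1) by (simp_all cong: measurable_cong_sets add: one.sets_initial two.sets_initial)
  have Fm': "(\<lambda>p. F (fst p)) \<in> \<gamma> \<rightarrow>\<^sub>M borel" by (rule measurable_compose[OF fst_measurable Fm])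
  have Gm': "(\<lambda>p. G (snd p)) \<in> \<gamma> \<rightarrow>\<^sub>M borel" by (rule measurable_compose[OF snd_measurable Gm])
  have hm: "?h \<in> \<gamma> \<rightarrow>\<^sub>M borel \<Otimes>\<^sub>M borel" by (rule measurable_Pair[OF Fm' Gm'])
  have sets: "sets (\<mu> t) = sets borel" "sets (\<nu> t) = sets borel"
    using F(2) G(2) by (metis sets_distr)+
  let ?g = "distr \<gamma> (borel \<Otimes>\<^sub>M borel) ?h"
  have "?g \<in> couplings (\<mu> t) (\<nu> t)"
    unfolding couplings_def
  proof (intro CollectI conjI)
    show "sets ?g = sets (\<mu> t \<Otimes>\<^sub>M \<nu> t)"
      using sets_pair_measure_cong[OF sets] by simp
    have "distr ?g borel fst = distr \<gamma> borel (\<lambda>p. F (fst p))"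
      by (subst distr_distr[OF measurable_fst hm]) (simp add: o_def)
    also have "\<dots> = distr (distr \<gamma> (\<mu> 0) fst) borel F"
      by (subst distr_distr[OF Fm fst_measurable]) (simp add: o_def)
    finally have "distr ?g borel fst = \<mu> t" unfolding marginals F(2) .
    then show "distr ?g (\<mu> t) fst = \<mu> t"
      by (subst distr_cong[OF refl sets(1) refl])
    have "distr ?g borel snd = distr \<gamma> borel (\<lambda>p. G (snd p))"
      by (subst distr_distr[OF measurable_snd hm]) (simp add: o_def)
    also have "\<dots> = distr (distr \<gamma> (\<nu> 0) snd) borel G"
      by (subst distr_distr[OF Gm snd_measurable]) (simp add: o_def)
    finally have "distr ?g borel snd = \<nu> t" unfolding marginals G(2) .
    then show "distr ?g (\<nu> t) snd = \<nu> t"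
      by (subst distr_cong[OF refl sets(2) refl])
  qed
  then have "W1 (\<mu> t) (\<nu> t) \<le> (\<integral>\<^sup>+(z, w). ennreal (dist z w) \<partial>?g)"
    unfolding W1_def by (rule INF_lower)
  also have "\<dots> = (\<integral>\<^sup>+p. ennreal (norm (F (fst p) - G (snd p))) \<partial>\<gamma>)"
    by (subst nn_integral_distr[OF hm]) (simp_all add: dist_norm case_prod_unfold)
  finally show ?thesis .
qed

text \<open>At the final time, the bound for the cost passes to the limit flows by Fatou's lemma.\<close>

lemma W1_le_modulus:
  assumes t: "t \<in> {0..T}"
    and one_T: "prob_space (\<mu> T)" "sets (\<mu> T) = sets borel"
      "\<And>\<eta>. C1_compact_support \<eta> \<Longrightarrow> continuous_on {0..T} (\<lambda>t. LINT z|\<mu> t. \<eta> z)"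
    and two_T: "prob_space (\<nu> T)" "sets (\<nu> T) = sets borel"
      "\<And>\<eta>. C1_compact_support \<eta> \<Longrightarrow> continuous_on {0..T} (\<lambda>t. LINT z|\<nu> t. \<eta> z)"
  shows "W1 (\<mu> t) (\<nu> t) \<le> ennreal (modulus (LINT p|\<gamma>. dist (fst p) (snd p)))"
proof -
  have cost_0: "cost 0 = (LINT p|\<gamma>. dist (fst p) (snd p))"
    by (simp add: gap_def one.flow_0 two.flow_0 dist_norm)
  have nn: "(\<integral>\<^sup>+p. ennreal (norm (\<Phi> t (fst p) - \<Psi> t (snd p))) \<partial>\<gamma>) \<le> ennreal (modulus (cost 0))"
    if "t \<in> {0..<T}" for t
  proof -
    have "(\<integral>\<^sup>+p. ennreal (gap t p) \<partial>\<gamma>) = ennreal (cost t)"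
      by (intro nn_integral_eq_integral gap_integrable[OF that]) (simp add: gap_nonneg)
    also have "\<dots> \<le> ennreal (modulus (cost 0))" by (intro ennreal_leI cost_le_modulus that)
    finally show ?thesis by (simp add: gap_def)
  qed
  show ?thesis
  proof (cases "t < T")
    case True
    then have t': "t \<in> {0..<T}" using t by simp
    have "W1 (\<mu> t) (\<nu> t) \<le> (\<integral>\<^sup>+p. ennreal (norm (\<Phi> t (fst p) - \<Psi> t (snd p))) \<partial>\<gamma>)"
      by (intro W1_le_cost one.flow_measurable two.flow_measurable t'
          one.flow_push[symmetric] two.flow_push[symmetric])
    also have "\<dots> \<le> ennreal (modulus (cost 0))" by (rule nn[OF t'])
    finally show ?thesis by (simp add: cost_0)
  next
    case False
    then have "t = T" using t by simp
    have "W1 (\<mu> T) (\<nu> T) \<le> (\<integral>\<^sup>+p. ennreal (norm (one.terminal (fst p) - two.terminal (snd p))) \<partial>\<gamma>)"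
      by (intro W1_le_cost one.terminal_measurable two.terminal_measurable
          one.terminal_push[symmetric] two.terminal_push[symmetric] one_T two_T)
    also have "\<dots> \<le> ennreal (modulus (cost 0))"
    proof (rule nn_integral_limit_le)
      fix n
      show "(\<lambda>p. ennreal (norm (\<Phi> (one.approach n) (fst p) - \<Psi> (one.approach n) (snd p))))
          \<in> borel_measurable \<gamma>"
        using flows_measurable[OF one.approach_in] by measurable
      show "(\<integral>\<^sup>+p. ennreal (norm (\<Phi> (one.approach n) (fst p) - \<Psi> (one.approach n) (snd p))) \<partial>\<gamma>)
          \<le> ennreal (modulus (cost 0))"
        by (rule nn[OF one.approach_in])
    next
      fix p
      show "(\<lambda>n. ennreal (norm (\<Phi> (one.approach n) (fst p) - \<Psi> (one.approach n) (snd p))))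
          \<longlonglongrightarrow> ennreal (norm (one.terminal (fst p) - two.terminal (snd p)))"
        by (intro tendsto_ennrealI tendsto_norm tendsto_diff one.flow_tendsto_terminal
            two.flow_tendsto_terminal)
    qed
    finally show ?thesis by (simp add: cost_0 \<open>t = T\<close>)
  qed
qed

end

section \<open>The modulus and the stability theorem\<close>

lemma product_coupling:
  assumes "prob_space M1" "prob_space M2"
  shows "M1 \<Otimes>\<^sub>M M2 \<in> couplings M1 M2"
proof -
  interpret M1: prob_space M1 by fact
  interpret M2: prob_space M2 by fact
  have "distr (M1 \<Otimes>\<^sub>M M2) M2 snd = M2"
  proof (rule measure_eqI)
    fix A assume "A \<in> sets (distr (M1 \<Otimes>\<^sub>M M2) M2 snd)"
    then have A: "A \<in> sets M2" by simp
    have "snd -` A \<inter> space (M1 \<Otimes>\<^sub>M M2) = space M1 \<times> A"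
      using sets.sets_into_space[OF A] by (auto simp: space_pair_measure)
    then show "emeasure (distr (M1 \<Otimes>\<^sub>M M2) M2 snd) A = emeasure M2 A"
      using A by (simp add: emeasure_distr M2.emeasure_pair_measure_Times M1.emeasure_space_1)
  qed simp
  then show ?thesis by (simp add: couplings_def M2.distr_pair_fst)
qed

lemma measure_valued_solutionD:
  assumes "measure_valued_solution \<kappa> \<phi> T \<mu>" "t \<in> {0..T}"
  shows "prob_space (\<mu> t)" "sets (\<mu> t) = sets borel"
    "C1_compact_support \<eta> \<Longrightarrow> continuous_on {0..T} (\<lambda>t. LINT z|\<mu> t. \<eta> z)"
proof -
  have "\<mu> \<in> restrict_space borel {0..T} \<rightarrow>\<^sub>M prob_algebra borel"
    using assms(1) by (simp add: measure_valued_solution_def)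
  then have "\<mu> t \<in> space (prob_algebra borel)"
    using assms(2) by (intro measurable_space[of \<mu> "restrict_space borel {0..T}"])
      (auto simp: space_restrict_space)
  then show "prob_space (\<mu> t)" "sets (\<mu> t) = sets borel"
    by (simp_all add: space_prob_algebra)
  show "C1_compact_support \<eta> \<Longrightarrow> continuous_on {0..T} (\<lambda>t. LINT z|\<mu> t. \<eta> z)"
    using assms(1) by (simp add: measure_valued_solution_def)
qed

lemma sqrt_concave:
  assumes "0 \<le> a" "0 \<le> b" "0 \<le> u" "0 \<le> v" "u + v = 1"
  shows "u * sqrt a + v * sqrt b \<le> sqrt (u * a + v * b)"
proof (rule real_le_rsqrt)
  have ab: "2 * sqrt a * sqrt b \<le> a + b"
    using sum_squares_bound[of "sqrt a" "sqrt b"] assms by simp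
  have "(u * sqrt a + v * sqrt b)\<^sup>2 = u\<^sup>2 * (sqrt a)\<^sup>2 + v\<^sup>2 * (sqrt b)\<^sup>2 + (u * v) * (2 * sqrt a * sqrt b)"
    by (simp add: power2_eq_square algebra_simps)
  also have "\<dots> \<le> u\<^sup>2 * a + v\<^sup>2 * b + (u * v) * (a + b)"
    using assms ab by (intro add_mono mult_left_mono) auto
  also have "\<dots> = (u * a + v * b) * (u + v)"
    by (simp add: power2_eq_square algebra_simps)
  finally show "(u * sqrt a + v * sqrt b)\<^sup>2 \<le> u * a + v * b"
    using assms(5) by simp
qed

text \<open>
  Concavity of an iterate uses both concavity and monotonicity of the square root.
\<close>

lemma iterated_sqrt_modulus:
  fixes c :: real
  assumes "0 < c" and F: "\<And>\<zeta>. F \<zeta> = c * sqrt \<zeta>"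
  shows "F ^^ n \<in> {0..} \<rightarrow> {0..}" "continuous_on {0..} (F ^^ n)" "concave_on {0..} (F ^^ n)"
    "strict_mono_on {0..} (F ^^ n)" "(F ^^ n) 0 = 0"
proof -
  have step: "(F ^^ Suc n) \<zeta> = c * sqrt ((F ^^ n) \<zeta>)" for n \<zeta> by (simp add: F)
  then have step_fun: "F ^^ Suc n = (\<lambda>\<zeta>. c * sqrt ((F ^^ n) \<zeta>))" for n by (rule ext)
  have nonneg: "0 \<le> (F ^^ n) \<zeta>" if "0 \<le> \<zeta>" for n \<zeta>
    using that \<open>0 < c\<close> by (induction n) (simp_all add: F)
  then show "F ^^ n \<in> {0..} \<rightarrow> {0..}" by auto
  show "continuous_on {0..} (F ^^ n)"
  proof (induction n)
    case (Suc n)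
    have "continuous_on {0..} (\<lambda>\<zeta>. c * sqrt ((F ^^ n) \<zeta>))" by (intro continuous_intros Suc)
    then show ?case by (simp only: step_fun)
  qed (simp add: continuous_on_id)
  have strict: "\<zeta> < \<xi> \<Longrightarrow> (F ^^ n) \<zeta> < (F ^^ n) \<xi>" for n \<zeta> \<xi>
    by (induction n) (use \<open>0 < c\<close> in \<open>auto simp: F\<close>)
  then show "strict_mono_on {0..} (F ^^ n)" by (intro strict_mono_onI)
  show "(F ^^ n) 0 = 0" by (induction n) (simp_all add: F)
  have conc: "u * (F ^^ n) x + v * (F ^^ n) y \<le> (F ^^ n) (u * x + v * y)"
    if "0 \<le> x" "0 \<le> y" "0 \<le> u" "0 \<le> v" "u + v = 1" for n x y u v
  proof (induction n)
    case (Suc n)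
    have "u * (F ^^ Suc n) x + v * (F ^^ Suc n) y = c * (u * sqrt ((F ^^ n) x) + v * sqrt ((F ^^ n) y))"
      unfolding step by (simp add: algebra_simps)
    also have "\<dots> \<le> c * sqrt (u * (F ^^ n) x + v * (F ^^ n) y)"
      using \<open>0 < c\<close> that by (intro mult_left_mono sqrt_concave nonneg) auto
    also have "\<dots> \<le> c * sqrt ((F ^^ n) (u * x + v * y))"
      using \<open>0 < c\<close> Suc by (intro mult_left_mono) auto
    finally show ?case unfolding step .
  qed simp
  show "concave_on {0..} (F ^^ n)"
    unfolding concave_on_iff using conc by (simp add: convex_real_interval)
qed

context cs_moment
begin

lemma modulus_properties:
  "modulus \<in> {0..} \<rightarrow> {0..}" "continuous_on {0..} modulus" "concave_on {0..} modulus"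
  "strict_mono_on {0..} modulus" "modulus 0 = 0"
proof -
  have pos: "0 < (weight_bound + gap_square_bound + 2) / 2"
    using weight_bound_pos gap_square_bound_pos by simp
  show "modulus \<in> {0..} \<rightarrow> {0..}" "continuous_on {0..} modulus" "concave_on {0..} modulus"
    "strict_mono_on {0..} modulus" "modulus 0 = 0"
    unfolding modulus_def by (rule iterated_sqrt_modulus[OF pos step_modulus_def])+
qed

lemma modulus_tendsto_0: "(modulus \<longlongrightarrow> 0) (at_right 0)"
proof -
  have "(modulus \<longlongrightarrow> modulus 0) (at 0 within {0..})"
    using modulus_properties(2) by (simp add: continuous_on)
  then have "(modulus \<longlongrightarrow> modulus 0) (at_right 0)"
    by (rule tendsto_within_subset) auto
  then show ?thesis by (simp add: modulus_properties(5))
qed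

text \<open>
  The moment hypotheses are stated for densities with respect to Lebesgue measure; here they are turned into
  integrability statements for the measures themselves.
\<close>

lemma solution_has_flow:
  fixes \<mu> :: "real \<Rightarrow> ('a::euclidean_space \<times> 'a) measure"
  assumes sol: "measure_valued_solution \<kappa> \<phi> T \<mu>"
    and f0: "bounded_probability_density f0" "initial_moment \<alpha> f0 \<le> ennreal M"
    and init: "\<mu> 0 = density lborel (\<lambda>z. ennreal (f0 z))"
    and frame: "has_density_in_framework \<kappa> \<phi> T \<mu> f"
  obtains \<Phi> where "cs_moment_flow \<kappa> \<phi> K L T \<alpha> M \<mu> \<Phi>"
proof -
  have prob: "prob_space (\<mu> t)" "sets (\<mu> t) = sets borel" if "t \<in> {0..<T}" for t
    using measure_valued_solutionD[OF sol, of t] that by auto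
  have T0: "0 \<in> {0..<T}" using T_pos by simp
  obtain X V where XV0: "\<And>z. (X 0 z, V 0 z) = z"
    and XV: "\<And>z t. t \<in> {0..<T} \<Longrightarrow> ((\<lambda>s. X s z) has_vector_derivative V t z) (at t within {0..<T})"
      "\<And>z t. t \<in> {0..<T} \<Longrightarrow> ((\<lambda>s. V s z) has_vector_derivative
          alignment \<kappa> \<phi> (\<mu> t) (X t z) (V t z)) (at t within {0..<T})"
    and meas: "\<And>t. t \<in> {0..<T} \<Longrightarrow> (\<lambda>z. (X t z, V t z)) \<in> borel \<rightarrow>\<^sub>M borel"
    and push: "\<And>t. t \<in> {0..<T} \<Longrightarrow> \<mu> t = distr (\<mu> 0) borel (\<lambda>z. (X t z, V t z))"
    using frame unfolding has_density_in_framework_def transported_by_characteristics_def by blast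
  define \<Phi> where "\<Phi> = (\<lambda>t z. (X t z, V t z))"
  have second: "integrable (\<mu> t) (\<lambda>z. norm z)" if t: "t \<in> {0..<T}" for t
  proof -
    interpret prob_space "\<mu> t" by (rule prob(1)[OF t])
    have dens: "\<mu> t = density lborel (\<lambda>z. ennreal (f t z))"
      and ft: "integrable lborel (f t)" "integrable lborel (\<lambda>z. (norm z)\<^sup>2 * f t z)"
      using frame t by (auto simp: has_density_in_framework_def continuous_L1_def)
    have [measurable]: "f t \<in> borel_measurable borel" using ft(1) by simp
    have "(\<integral>\<^sup>+z. ennreal ((norm z)\<^sup>2) \<partial>\<mu> t) = (\<integral>\<^sup>+z. ennreal ((norm z)\<^sup>2 * f t z) \<partial>lborel)"
    proof -
      have "ennreal (f t z) * ennreal ((norm z)\<^sup>2) = ennreal ((norm z)\<^sup>2 * f t z)" for z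
        using ennreal_mult'[of "(norm z)\<^sup>2" "f t z"] by (simp add: mult.commute)
      then show ?thesis unfolding dens by (subst nn_integral_density) auto
    qed
    also have "\<dots> < \<infinity>"
      using ft(2) by (simp add: real_integrable_def less_top)
    finally have "integrable (\<mu> t) (\<lambda>z. (norm z)\<^sup>2)"
      using prob(2)[OF t] by (intro integrableI_bounded) (auto cong: measurable_cong_sets)
    then have "integrable (\<mu> t) (\<lambda>z. 1 + (norm z)\<^sup>2)" by simp
    then show ?thesis
    proof (rule Bochner_Integration.integrable_bound)
      show "(\<lambda>z. norm z) \<in> borel_measurable (\<mu> t)"
        using prob(2)[OF t] by (auto cong: measurable_cong_sets)
      have "norm z \<le> 1 + (norm z)\<^sup>2" for z :: "'a \<times> 'a"
      proof -
        have "2 * norm z \<le> (norm z)\<^sup>2 + 1" using sum_squares_bound[of "norm z" 1] by simp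
        then show ?thesis using norm_ge_zero[of z] by linarith
      qed
      then show "AE z in \<mu> t. norm (norm z) \<le> norm (1 + (norm z)\<^sup>2)" by simp
    qed
  qed
  let ?g = "\<lambda>z :: 'a \<times> 'a. (norm (fst z))\<^sup>2 + exp (\<alpha> * norm (snd z))"
  have g_meas: "?g \<in> borel_measurable borel"
    by (intro borel_measurable_continuous_onI continuous_intros)
  have [measurable]: "f0 \<in> borel_measurable borel"
    using f0(1) borel_measurable_integrable[of lborel f0] by (simp add: bounded_probability_density_def)
  have g_nn: "(\<integral>\<^sup>+z. ennreal (?g z) \<partial>\<mu> 0) \<le> ennreal M"
  proof -
    have "(\<integral>\<^sup>+z. ennreal (?g z) \<partial>\<mu> 0) = (\<integral>\<^sup>+z. ennreal (f0 z) * ennreal (?g z) \<partial>lborel)"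
      unfolding init
    proof (rule nn_integral_density)
      show "(\<lambda>z. ennreal (?g z)) \<in> borel_measurable lborel"
        by (rule measurable_compose[OF _ measurable_ennreal]) (use g_meas in simp)
    qed measurable
    also have "\<dots> = initial_moment \<alpha> f0"
      unfolding initial_moment_def case_prod_unfold
    proof (intro nn_integral_cong)
      fix z :: "'a \<times> 'a"
      have "0 \<le> ?g z" by (intro add_nonneg_nonneg) auto
      then show "ennreal (f0 z) * ennreal (?g z) = ennreal (?g z * f0 (fst z, snd z))"
        using ennreal_mult'[of "?g z" "f0 z"] by (simp add: mult.commute)
    qed
    finally show ?thesis using f0(2) by simp
  qed
  have g0: "0 \<le> ?g z" for z by (intro add_nonneg_nonneg) auto
  have g_int: "integrable (\<mu> 0) ?g"
  proof (rule integrableI_bounded)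
    show "?g \<in> borel_measurable (\<mu> 0)"
      using g_meas prob(2)[OF T0] by (simp cong: measurable_cong_sets)
    have "(\<integral>\<^sup>+z. ennreal (norm (?g z)) \<partial>\<mu> 0) = (\<integral>\<^sup>+z. ennreal (?g z) \<partial>\<mu> 0)"
      by (intro nn_integral_cong) (simp only: real_norm_def abs_of_nonneg[OF g0])
    also have "\<dots> < \<infinity>" using g_nn by (rule le_less_trans) simp
    finally show "(\<integral>\<^sup>+z. ennreal (norm (?g z)) \<partial>\<mu> 0) < \<infinity>" .
  qed
  have g_le: "(LINT z|\<mu> 0. ?g z) \<le> M"
  proof -
    have "ennreal (LINT z|\<mu> 0. ?g z) = (\<integral>\<^sup>+z. ennreal (?g z) \<partial>\<mu> 0)"
      by (rule nn_integral_eq_integral[OF g_int, symmetric]) (use g0 in auto)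
    then have "ennreal (LINT z|\<mu> 0. ?g z) \<le> ennreal M" using g_nn by simp
    then show ?thesis using M_pos by (simp add: ennreal_le_iff)
  qed
  interpret initial: prob_space "\<mu> 0" by (rule prob(1)[OF T0])
  have "cs_moment_flow \<kappa> \<phi> K L T \<alpha> M \<mu> \<Phi>"
  proof unfold_locales
    show "sets (\<mu> 0) = sets borel" by (rule prob(2)[OF T0])
    show "\<Phi> 0 z = z" for z by (simp add: \<Phi>_def XV0)
    fix t assume t: "t \<in> {0..<T}"
    show "((\<lambda>s. \<Phi> s z) has_vector_derivative
        (snd (\<Phi> t z), alignment \<kappa> \<phi> (\<mu> t) (fst (\<Phi> t z)) (snd (\<Phi> t z)))) (at t within {0..<T})" for z
      unfolding \<Phi>_def fst_conv snd_conv by (intro has_vector_derivative_Pair XV t)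
    show "\<Phi> t \<in> borel \<rightarrow>\<^sub>M borel" unfolding \<Phi>_def by (rule meas[OF t])
    show \<mu>t: "\<mu> t = distr (\<mu> 0) borel (\<Phi> t)" unfolding \<Phi>_def by (rule push[OF t])
    have "\<Phi> t \<in> \<mu> 0 \<rightarrow>\<^sub>M borel"
      using meas[OF t] prob(2)[OF T0] by (simp add: \<Phi>_def cong: measurable_cong_sets)
    then show "integrable (\<mu> 0) (\<lambda>z. norm (\<Phi> t z))"
      using second[OF t] integrable_distr[of "\<Phi> t" "\<mu> 0" borel norm] \<mu>t by metis
  next
    show "integrable (\<mu> 0) ?g" "(LINT z|\<mu> 0. ?g z) \<le> M" by (rule g_int g_le)+
  qed (rule T_pos)
  then show ?thesis by (rule that)
qed

text \<open>
  The infimum in \<^const>\<open>W1\<close> need not be attained by a coupling at hand, so couplings with cost at most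
  \<open>W1 + e\<close> are used, and \<open>e\<close> tends to \<open>0\<close> by continuity of the modulus. The product coupling has finite cost; this
  ensures that \<^const>\<open>enn2real\<close> loses nothing.
\<close>

lemma W1_stability:
  fixes \<mu> \<nu> :: "real \<Rightarrow> ('a::euclidean_space \<times> 'a) measure"
  assumes one: "cs_moment_flow \<kappa> \<phi> K L T \<alpha> M \<mu> \<Phi>" "measure_valued_solution \<kappa> \<phi> T \<mu>"
    and two: "cs_moment_flow \<kappa> \<phi> K L T \<alpha> M \<nu> \<Psi>" "measure_valued_solution \<kappa> \<phi> T \<nu>"
    and t: "t \<in> {0..T}"
  shows "W1 (\<mu> t) (\<nu> t) \<le> ennreal (modulus (enn2real (W1 (\<mu> 0) (\<nu> 0))))"
proof -
  interpret one: cs_moment_flow \<kappa> \<phi> K L T \<alpha> M \<mu> \<Phi> by (rule one(1))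
  interpret two: cs_moment_flow \<kappa> \<phi> K L T \<alpha> M \<nu> \<Psi> by (rule two(1))
  have TT: "T \<in> {0..T}" using T_pos by simp
  let ?c = "\<lambda>\<gamma>. LINT p|\<gamma>. dist (fst p) (snd p)"
  have coupled: "(\<integral>\<^sup>+(z, w). ennreal (dist z w) \<partial>\<gamma>) = ennreal (?c \<gamma>)"
      "W1 (\<mu> t) (\<nu> t) \<le> ennreal (modulus (?c \<gamma>))" if "\<gamma> \<in> couplings (\<mu> 0) (\<nu> 0)" for \<gamma>
  proof -
    interpret cs_coupling \<kappa> \<phi> K L T \<alpha> M \<mu> \<nu> \<Phi> \<Psi> \<gamma>
      using that by unfold_locales
    have "gap 0 = (\<lambda>p. dist (fst p) (snd p))"
      by (simp add: gap_def[abs_def] one.flow_0 two.flow_0 dist_norm)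
    then have "integrable \<gamma> (\<lambda>p. dist (fst p) (snd p))"
      using gap_integrable[of 0] T_pos by simp
    then show "(\<integral>\<^sup>+(z, w). ennreal (dist z w) \<partial>\<gamma>) = ennreal (?c \<gamma>)"
      unfolding case_prod_unfold by (intro nn_integral_eq_integral) auto
    show "W1 (\<mu> t) (\<nu> t) \<le> ennreal (modulus (?c \<gamma>))"
      by (rule W1_le_modulus[OF t measure_valued_solutionD[OF one(2) TT] measure_valued_solutionD[OF two(2) TT]])
  qed
  let ?w = "W1 (\<mu> 0) (\<nu> 0)"
  have "?w \<le> (\<integral>\<^sup>+(z, w). ennreal (dist z w) \<partial>(\<mu> 0 \<Otimes>\<^sub>M \<nu> 0))"
    unfolding W1_def by (intro INF_lower product_coupling one.prob_initial two.prob_initial)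
  also have "\<dots> < \<infinity>"
    unfolding coupled(1)[OF product_coupling[OF one.prob_initial two.prob_initial]] by simp
  finally have w: "?w = ennreal (enn2real ?w)" by (simp add: less_top)
  have near: "W1 (\<mu> t) (\<nu> t) \<le> ennreal (modulus (enn2real ?w + e))" if "e > 0" for e
  proof -
    have "?w < ennreal (enn2real ?w + e)"
      by (subst w) (use that in \<open>simp add: ennreal_less_iff\<close>)
    then obtain \<gamma> where \<gamma>: "\<gamma> \<in> couplings (\<mu> 0) (\<nu> 0)"
        "(\<integral>\<^sup>+(z, w). ennreal (dist z w) \<partial>\<gamma>) < ennreal (enn2real ?w + e)"
      unfolding W1_def INF_less_iff by blast
    have c0: "0 \<le> ?c \<gamma>" by simp
    then have "?c \<gamma> < enn2real ?w + e"
      using \<gamma>(2) unfolding coupled(1)[OF \<gamma>(1)] by (simp add: ennreal_less_iff)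
    then have "modulus (?c \<gamma>) \<le> modulus (enn2real ?w + e)"
      using c0 that strict_mono_onD[OF modulus_properties(4), of "?c \<gamma>" "enn2real ?w + e"]
      by (simp add: add_nonneg_nonneg)
    then show ?thesis
      using coupled(2)[OF \<gamma>(1)] by (meson ennreal_leI order_trans)
  qed
  have "(\<lambda>n. enn2real ?w + inverse (real (Suc n))) \<longlonglongrightarrow> enn2real ?w + 0"
    by (intro tendsto_intros LIMSEQ_inverse_real_of_nat)
  then have "(\<lambda>n. modulus (enn2real ?w + inverse (real (Suc n)))) \<longlonglongrightarrow> modulus (enn2real ?w + 0)"
    by (rule continuous_on_tendsto_compose[OF modulus_properties(2)])
      (auto intro!: always_eventually add_nonneg_nonneg)
  then have "(\<lambda>n. ennreal (modulus (enn2real ?w + inverse (real (Suc n))))) \<longlonglongrightarrow> ennreal (modulus (enn2real ?w))"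
    by (intro tendsto_ennrealI) simp
  then show ?thesis
    by (rule LIMSEQ_le_const) (auto intro!: exI[of _ 0] near)
qed

end

theorem theorem3p1:
  fixes \<kappa> T M \<alpha> :: real and \<phi> :: "real \<Rightarrow> real"
  assumes "\<kappa> > 0"
    and "W1infty_halfline \<phi>"
    and "\<And>r. 0 \<le> r \<Longrightarrow> 0 \<le> \<phi> r \<and> ereal (\<phi> r) \<le> Linfty_norm (restrict_space lborel {0..}) \<phi>"
    and "T > 0" and "M > 0" and "\<alpha> > 0"
  shows "\<exists>G :: real \<Rightarrow> real.
    G \<in> {0..} \<rightarrow> {0..} \<and> continuous_on {0..} G \<and> concave_on {0..} G \<and>
    strict_mono_on {0..} G \<and> (G \<longlongrightarrow> 0) (at_right 0) \<and>
    (\<forall>(f0 :: (real ^ 'd) \<times> (real ^ 'd) \<Rightarrow> real) g0 \<mu> \<nu> f g.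
      bounded_probability_density f0 \<longrightarrow> bounded_probability_density g0 \<longrightarrow>
      max (initial_moment \<alpha> f0) (initial_moment \<alpha> g0) \<le> ennreal M \<longrightarrow>
      measure_valued_solution \<kappa> \<phi> T \<mu> \<longrightarrow> measure_valued_solution \<kappa> \<phi> T \<nu> \<longrightarrow>
      \<mu> 0 = density lborel (\<lambda>z. ennreal (f0 z)) \<longrightarrow>
      \<nu> 0 = density lborel (\<lambda>z. ennreal (g0 z)) \<longrightarrow>
      has_density_in_framework \<kappa> \<phi> T \<mu> f \<longrightarrow> has_density_in_framework \<kappa> \<phi> T \<nu> g \<longrightarrow>
      (SUP t\<in>{0..T}. W1 (\<mu> t) (\<nu> t)) \<le> ennreal (G (enn2real (W1 (\<mu> 0) (\<nu> 0)))))"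
proof -
  obtain K where K: "0 \<le> K" "\<And>r. 0 \<le> r \<Longrightarrow> \<phi> r \<in> {0..K}"
    using W1infty_halfline_bounded[OF assms(2,3)] by blast
  obtain L where L: "0 \<le> L" "\<And>r s. 0 \<le> r \<Longrightarrow> 0 \<le> s \<Longrightarrow> \<bar>\<phi> r - \<phi> s\<bar> \<le> L * \<bar>r - s\<bar>"
    using W1infty_halfline_lipschitz[OF assms(2)] by blast
  interpret cs_moment \<kappa> \<phi> K L T \<alpha> M
    using assms K L by unfold_locales auto
  show ?thesis
  proof (intro exI[of _ modulus] conjI allI impI modulus_properties modulus_tendsto_0)
    fix f0 g0 :: "(real ^ 'd) \<times> (real ^ 'd) \<Rightarrow> real" and \<mu> \<nu> f g
    assume f0: "bounded_probability_density f0" and g0: "bounded_probability_density g0"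
      and moments: "max (initial_moment \<alpha> f0) (initial_moment \<alpha> g0) \<le> ennreal M"
      and sol: "measure_valued_solution \<kappa> \<phi> T \<mu>" "measure_valued_solution \<kappa> \<phi> T \<nu>"
      and init: "\<mu> 0 = density lborel (\<lambda>z. ennreal (f0 z))" "\<nu> 0 = density lborel (\<lambda>z. ennreal (g0 z))"
      and frame: "has_density_in_framework \<kappa> \<phi> T \<mu> f" "has_density_in_framework \<kappa> \<phi> T \<nu> g"
    have m: "initial_moment \<alpha> f0 \<le> ennreal M" "initial_moment \<alpha> g0 \<le> ennreal M"
      using moments by simp_all
    obtain \<Phi> where one: "cs_moment_flow \<kappa> \<phi> K L T \<alpha> M \<mu> \<Phi>"
      by (rule solution_has_flow[OF sol(1) f0 m(1) init(1) frame(1)])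
    obtain \<Psi> where two: "cs_moment_flow \<kappa> \<phi> K L T \<alpha> M \<nu> \<Psi>"
      by (rule solution_has_flow[OF sol(2) g0 m(2) init(2) frame(2)])
    show "(SUP t\<in>{0..T}. W1 (\<mu> t) (\<nu> t)) \<le> ennreal (modulus (enn2real (W1 (\<mu> 0) (\<nu> 0))))"
      by (intro SUP_least W1_stability[OF one sol(1) two sol(2)])
  qed
qed

end
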